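(* Let $F:\mathbb{R}\to\mathbb{R}$ be such that the associated mapping $J(u,v)=(0,F\circ u)$ maps $D(\mathcal A)$ into $D(\mathcal A)$ and satisfies $J(0)=0$, $(H_0^L)$ and $(H_1^L)$ (see context). Let $(f_1,f_2)\in D(A)$ with $f_2\equiv 0$ and such that the support $\Sigma$ of $f_1$ is a compact set included in $(0,R)$ for some $R>0$. Let $0<T\le+\infty$ and let $u=(u_1,u_2)$ be the solution on $[0,T)$ of the nonlinear transmission problem (NLP) with initial data $(f_1,f_2)$ and vanishing initial velocity, i.e. $\varphi(t)=(u(t),u_t(t))$ is the continuously differentiable $D(\mathcal A)$-valued solution of (Q) on $[0,T)$ with $\varphi(0)=((f_1,f_2),0)$. Then for every $t\in[0,T)$ the support of $u(t,\cdot)$ (that is, the support of each component $u_k(t,\cdot)$, $k=1,2$) is a subset of $$\mathcal{C}(\Sigma,t)=\{x\in\mathbb{R} : \operatorname{dist}(x,\Sigma)\le ct\}.$$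
   Context: Fix positive constants $c,a_1,a_2$ with $a_2>a_1$, and let $\Omega_1=\Omega_2=(0,+\infty)$. All functions are real-valued. Problem (NLP): find $u_k:[0,\infty)\times\overline{\Omega_k}\to\mathbb{R}$ ($k=1,2$) with $\partial_t^2u_k-c^2\partial_x^2u_k+a_ku_k=F(u_k)$ on $(0,\infty)\times\Omega_k$; transmission conditions $(T_0)$: $u_1(t,0)=u_2(t,0)$ and $(T_1)$: $\partial_xu_1(t,0^+)+\partial_xu_2(t,0^+)=0$ for all $t\ge0$; initial conditions $u_k(0,\cdot)=f_k$, $\partial_tu_k(0,\cdot)=0$. (On a time interval $[0,T)$, the same with $t$ restricted to it.) Let $H=L^2(\Omega_1)\times L^2(\Omega_2)$ with norm $\|u\|_2=(\sum_{k}\int_{\Omega_k}|u_k|^2dx)^{1/2}$. Let $D(A)=\{v\in H^2(\Omega_1)\times H^2(\Omega_2): v_1(0)=v_2(0),\ v_1'(0^+)+v_2'(0^+)=0\}$ and $Av=(-c^2v_k''+a_kv_k)_{k=1,2}$. $A$ is a positive self-adjoint operator in $H$, and $D(\sqrt A)=\{v\in H^1(\Omega_1)\times H^1(\Omega_2): v_1(0)=v_2(0)\}$. First-order form: for $\varphi=(u,v)\in D(\sqrt A)\oplus H$ put $\|\varphi\|=(\|\sqrt Au\|_2^2+\|v\|_2^2)^{1/2}$. Let $\mathcal A=i\begin{pmatrix}0&I\\-A&0\end{pmatrix}$ with $D(\mathcal A)=D(A)\oplus D(\sqrt A)$, so that $\|\mathcal A\varphi\|=(\|\sqrt Av\|_2^2+\|Au\|_2^2)^{1/2}$.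 With $F\circ u=(F\circ u_1,F\circ u_2)$ and $J(u,v)=(0,F\circ u)$ one has $\|J(\varphi)\|=\|F\circ u\|_2$, $\|\mathcal AJ(\varphi)\|=\|\sqrt A(F\circ u)\|_2$. Problem (Q) is $\frac{d\varphi}{dt}+i\mathcal A\varphi=J(\varphi)$, $\varphi(0)=\varphi_0$, i.e. $\frac{d}{dt}(u,v)=(v,-Au+F\circ u)$. Conditions: for all $\varphi,\psi\in D(\mathcal A)$, $(H_0^L)$: $\|J(\varphi)-J(\psi)\|\le C(\|\varphi\|,\|\psi\|)\,\|\varphi-\psi\|$; $(H_1^L)$: $\|\mathcal A(J(\varphi)-J(\psi))\|\le C(\|\varphi\|,\|\mathcal A\varphi\|,\|\psi\|,\|\mathcal A\psi\|)\,\|\mathcal A\varphi-\mathcal A\psi\|$, where each $C$ is an everywhere finite function, monotone increasing in each argument. Under $J(0)=0$, $(H_0^L)$, $(H_1^L)$, (Q) has, for each $\varphi_0\in D(\mathcal A)$, a unique continuously differentiable solution on some interval $[0,T)$, $T>0$. *)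

theory Defs
  imports "HOL-Analysis.Analysis"
begin

abbreviation half_line :: "real measure" where
  "half_line \<equiv> lebesgue_on {0<..}"

definition square_integrable :: "(real \<Rightarrow> real) \<Rightarrow> bool" where
  "square_integrable f \<longleftrightarrow>
     f \<in> borel_measurable half_line \<and> integrable half_line (\<lambda>x. (f x)\<^sup>2)"

definition L2_rel :: "(real \<Rightarrow> real) \<Rightarrow> (real \<Rightarrow> real) \<Rightarrow> bool" where
  "L2_rel f g \<longleftrightarrow>
     square_integrable f \<and> square_integrable g \<and> (AE x in half_line. f x = g x)"

lemma square_integrable_mult:
  assumes "square_integrable f" "square_integrable g"
  shows "integrable half_line (\<lambda>x. f x * g x)"
proof (rule Bochner_Integration.integrable_bound)
  show "integrable half_line (\<lambda>x. (f x)\<^sup>2 + (g x)\<^sup>2)"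
    using assms by (auto simp: square_integrable_def)
  show "(\<lambda>x. f x * g x) \<in> borel_measurable half_line"
    using assms by (auto simp: square_integrable_def)
  have "\<bar>a * b\<bar> \<le> a\<^sup>2 + b\<^sup>2" for a b :: real
  proof -
    have "2 * \<bar>a\<bar> * \<bar>b\<bar> \<le> \<bar>a\<bar>\<^sup>2 + \<bar>b\<bar>\<^sup>2"
      by (rule sum_squares_bound)
    moreover have "0 \<le> \<bar>a\<bar> * \<bar>b\<bar>" by simp
    ultimately show ?thesis unfolding abs_mult power2_abs by linarith
  qed
  then show "AE x in half_line. norm (f x * g x) \<le> norm ((f x)\<^sup>2 + (g x)\<^sup>2)"
    by (simp add: abs_of_nonneg)
qed

lemma square_integrable_zero: "square_integrable (\<lambda>x. 0)"
  by (simp add: square_integrable_def)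

lemma square_integrable_add:
  assumes "square_integrable f" "square_integrable g"
  shows "square_integrable (\<lambda>x. f x + g x)"
  using assms square_integrable_mult[OF assms]
  by (auto simp: square_integrable_def power2_sum mult.assoc)

lemma square_integrable_scale:
  "square_integrable f \<Longrightarrow> square_integrable (\<lambda>x. r * f x)"
  by (auto simp: square_integrable_def power_mult_distrib)

lemma square_integrable_uminus:
  "square_integrable f \<Longrightarrow> square_integrable (\<lambda>x. - f x)"
  using square_integrable_scale[of f "-1"] by simp

lemma square_integrable_diff:
  assumes "square_integrable f" "square_integrable g"
  shows "square_integrable (\<lambda>x. f x - g x)"
  using square_integrable_add[OF assms(1) square_integrable_uminus[OF assms(2)]] by simp

quotient_type L2 = "real \<Rightarrow> real" / partial: L2_rel
proof (rule part_equivpI)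
  show "\<exists>f. L2_rel f f"
    using square_integrable_zero by (auto simp: L2_rel_def)
  show "symp L2_rel"
    by (auto simp: symp_def L2_rel_def)
  show "transp L2_rel"
    by (auto simp: transp_def L2_rel_def)
qed

instantiation L2 :: real_inner
begin

lift_definition zero_L2 :: L2 is "\<lambda>x. 0"
  by (simp add: L2_rel_def square_integrable_zero)

lift_definition plus_L2 :: "L2 \<Rightarrow> L2 \<Rightarrow> L2" is "\<lambda>f g x. f x + g x"
  by (auto simp: L2_rel_def square_integrable_add)

lift_definition uminus_L2 :: "L2 \<Rightarrow> L2" is "\<lambda>f x. - f x"
  by (auto simp: L2_rel_def square_integrable_uminus)

lift_definition minus_L2 :: "L2 \<Rightarrow> L2 \<Rightarrow> L2" is "\<lambda>f g x. f x - g x"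
  by (auto simp: L2_rel_def square_integrable_diff)

lift_definition scaleR_L2 :: "real \<Rightarrow> L2 \<Rightarrow> L2" is "\<lambda>r f x. r * f x"
  by (auto simp: L2_rel_def square_integrable_scale)

lift_definition inner_L2 :: "L2 \<Rightarrow> L2 \<Rightarrow> real" is "\<lambda>f g. LINT x|half_line. f x * g x"
  by (rule integral_cong_AE) (auto simp: L2_rel_def square_integrable_def)

definition norm_L2 :: "L2 \<Rightarrow> real" where
  "norm_L2 u = sqrt (inner u u)"

definition sgn_L2 :: "L2 \<Rightarrow> L2" where
  "sgn_L2 u = inverse (norm u) *\<^sub>R u"

definition dist_L2 :: "L2 \<Rightarrow> L2 \<Rightarrow> real" where
  "dist_L2 u v = norm (u - v)"

definition uniformity_L2 :: "(L2 \<times> L2) filter" where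
  "uniformity_L2 = (INF e\<in>{0<..}. principal {(u, v). dist u v < e})"

definition open_L2 :: "L2 set \<Rightarrow> bool" where
  "open_L2 U \<longleftrightarrow> (\<forall>u\<in>U. \<forall>\<^sub>F (u', v) in uniformity. u' = u \<longrightarrow> v \<in> U)"

instance
proof
  fix u v w :: L2 and r s :: real and U :: "L2 set"
  note add_rl = square_integrable_add square_integrable_uminus square_integrable_diff
    square_integrable_scale square_integrable_zero
  show "u + v + w = u + (v + w)"
    by transfer (auto simp: L2_rel_def add.assoc intro: add_rl)
  show "u + v = v + u"
    by transfer (auto simp: L2_rel_def add.commute intro: add_rl)
  show "0 + u = u"
    by transfer (auto simp: L2_rel_def)
  show "- u + u = 0"
    by transfer (auto simp: L2_rel_def intro: add_rl)
  show "u - v = u + - v"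
    by transfer (auto simp: L2_rel_def intro: add_rl square_integrable_diff)
  show "r *\<^sub>R (u + v) = r *\<^sub>R u + r *\<^sub>R v"
    by transfer (auto simp: L2_rel_def distrib_left intro!: add_rl)
  show "(r + s) *\<^sub>R u = r *\<^sub>R u + s *\<^sub>R u"
    by transfer (auto simp: L2_rel_def distrib_right intro!: add_rl)
  show "r *\<^sub>R s *\<^sub>R u = (r * s) *\<^sub>R u"
    by transfer (auto simp: L2_rel_def mult.assoc intro!: add_rl)
  show "1 *\<^sub>R u = u"
    by transfer (auto simp: L2_rel_def)
  show "dist u v = norm (u - v)" by (rule dist_L2_def)
  show "sgn u = inverse (norm u) *\<^sub>R u" by (rule sgn_L2_def)
  show "uniformity = (INF e\<in>{0<..}. principal {(u, v :: L2). dist u v < e})"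
    by (rule uniformity_L2_def)
  show "open U \<longleftrightarrow> (\<forall>u\<in>U. \<forall>\<^sub>F (u', v) in uniformity. u' = u \<longrightarrow> v \<in> U)"
    by (rule open_L2_def)
  show "inner u v = inner v u"
    by transfer (simp add: mult.commute)
  show "inner (u + v) w = inner u w + inner v w"
    by transfer (simp add: L2_rel_def distrib_right square_integrable_mult)
  show "inner (r *\<^sub>R u) v = r * inner u v"
    by transfer (simp add: mult.assoc)
  show "0 \<le> inner u u"
    by transfer simp
  show "inner u u = 0 \<longleftrightarrow> u = 0"
  proof transfer
    fix f assume "L2_rel f f"
    then have f: "square_integrable f" by (simp add: L2_rel_def)
    then have "(LINT x|half_line. f x * f x) = 0 \<longleftrightarrow> (AE x in half_line. f x * f x = 0)"
      by (intro integral_nonneg_eq_0_iff_AE) (auto intro: square_integrable_mult)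
    then show "(LINT x|half_line. f x * f x) = 0 \<longleftrightarrow> L2_rel f (\<lambda>x. 0)"
      using f by (simp add: L2_rel_def square_integrable_zero)
  qed
  show "norm u = sqrt (inner u u)" by (rule norm_L2_def)
qed

end

text \<open>The support of a class: the complement of the largest open set on which it vanishes
  almost everywhere. For a class with a representative that is continuous on \<open>{0..}\<close> this is the
  closure of the set of points of \<open>{0..}\<close> at which that representative does not vanish.\<close>

definition supp :: "L2 \<Rightarrow> real set" where
  "supp u = - \<Union>{U. open U \<and> (AE x in half_line. x \<in> U \<longrightarrow> rep_L2 u x = 0)}"

definition test_function :: "(real \<Rightarrow> real) \<Rightarrow> bool" where
  "test_function \<eta> \<longleftrightarrow>
     (\<forall>n x. (deriv ^^ n) \<eta> differentiable (at x)) \<and>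
     (\<exists>a b. 0 < a \<and> (\<forall>x. x \<notin> {a..b} \<longrightarrow> \<eta> x = 0))"

definition has_weak_deriv :: "L2 \<Rightarrow> L2 \<Rightarrow> bool" where
  "has_weak_deriv u g \<longleftrightarrow>
     (\<forall>\<eta>. test_function \<eta> \<longrightarrow>
        (LINT x|half_line. rep_L2 u x * deriv \<eta> x) = - (LINT x|half_line. rep_L2 g x * \<eta> x))"

definition weak_deriv :: "L2 \<Rightarrow> L2" where
  "weak_deriv u = (THE g. has_weak_deriv u g)"

definition H1 :: "L2 set" where
  "H1 = {u. \<exists>g. has_weak_deriv u g}"

definition H2 :: "L2 set" where
  "H2 = {u \<in> H1. weak_deriv u \<in> H1}"

text \<open>The boundary value at \<open>0\<close> of (the continuous representative of) an element of \<^term>\<open>H1\<close>.\<close>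

definition trace0 :: "L2 \<Rightarrow> real" where
  "trace0 u = (THE l. \<exists>f. continuous_on {0..} f \<and> (AE x in half_line. rep_L2 u x = f x) \<and> f 0 = l)"

text \<open>The norm and inner product of the product type are those of the direct sum of Hilbert spaces.\<close>

type_synonym H = "L2 \<times> L2"

definition dom_A :: "H set" where
  "dom_A = {(v1, v2). v1 \<in> H2 \<and> v2 \<in> H2 \<and> trace0 v1 = trace0 v2 \<and>
                      trace0 (weak_deriv v1) + trace0 (weak_deriv v2) = 0}"

definition op_A :: "real \<Rightarrow> real \<Rightarrow> real \<Rightarrow> H \<Rightarrow> H" where
  "op_A c a1 a2 = (\<lambda>(v1, v2).
     (- (c\<^sup>2 *\<^sub>R weak_deriv (weak_deriv v1)) + a1 *\<^sub>R v1,
      - (c\<^sup>2 *\<^sub>R weak_deriv (weak_deriv v2)) + a2 *\<^sub>R v2))"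

definition dom_sqrt_A :: "H set" where
  "dom_sqrt_A = {(v1, v2). v1 \<in> H1 \<and> v2 \<in> H1 \<and> trace0 v1 = trace0 v2}"

text \<open>An unbounded operator is given by a domain and a total function, of which only the values on
  the domain are relevant. The last conjunct says that the operator equals its adjoint.\<close>

definition self_adjoint :: "'a::real_inner set \<Rightarrow> ('a \<Rightarrow> 'a) \<Rightarrow> bool" where
  "self_adjoint D S \<longleftrightarrow>
     subspace D \<and> closure D = UNIV \<and>
     (\<forall>x\<in>D. \<forall>y\<in>D. S (x + y) = S x + S y) \<and> (\<forall>r. \<forall>x\<in>D. S (r *\<^sub>R x) = r *\<^sub>R S x) \<and>
     (\<forall>x y. (\<forall>z\<in>D. inner (S z) x = inner z y) \<longleftrightarrow> x \<in> D \<and> S x = y)"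

definition is_positive_sqrt ::
  "'a::real_inner set \<Rightarrow> ('a \<Rightarrow> 'a) \<Rightarrow> 'a set \<Rightarrow> ('a \<Rightarrow> 'a) \<Rightarrow> bool" where
  "is_positive_sqrt D S DA A \<longleftrightarrow>
     self_adjoint D S \<and> (\<forall>x\<in>D. 0 \<le> inner (S x) x) \<and>
     {x \<in> D. S x \<in> D} = DA \<and> (\<forall>x\<in>DA. S (S x) = A x)"

text \<open>Throughout, \<open>S\<close> stands for the square root of the operator \<^term>\<open>op_A c a1 a2\<close>.
  All functions are real-valued, so the first-order generator is written without the factor
  \<open>i\<close>: \<open>gen c a1 a2\<close> is \<open>- i\<close> times the operator with matrix \<open>i ((0, I), (- A, 0))\<close>,
  and the two have the same norms.\<close>

definition energy_norm :: "(H \<Rightarrow> H) \<Rightarrow> H \<times> H \<Rightarrow> real" where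
  "energy_norm S = (\<lambda>(u, v). sqrt ((norm (S u))\<^sup>2 + (norm v)\<^sup>2))"

definition dom_gen :: "(H \<times> H) set" where
  "dom_gen = dom_A \<times> dom_sqrt_A"

definition gen :: "real \<Rightarrow> real \<Rightarrow> real \<Rightarrow> H \<times> H \<Rightarrow> H \<times> H" where
  "gen c a1 a2 = (\<lambda>(u, v). (v, - op_A c a1 a2 u))"

text \<open>Composition of classes with \<open>F\<close> is meaningful if \<open>F \<circ> rep_L2 u\<close> is square-integrable, which
  is part of \<open>J_maps_domain\<close> below.\<close>

definition comp_L2 :: "(real \<Rightarrow> real) \<Rightarrow> L2 \<Rightarrow> L2" where
  "comp_L2 F u = abs_L2 (F \<circ> rep_L2 u)"

definition J :: "(real \<Rightarrow> real) \<Rightarrow> H \<times> H \<Rightarrow> H \<times> H" where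
  "J F = (\<lambda>((u1, u2), v). (0, (comp_L2 F u1, comp_L2 F u2)))"

definition J_maps_domain :: "(real \<Rightarrow> real) \<Rightarrow> bool" where
  "J_maps_domain F \<longleftrightarrow>
     (\<forall>((u1, u2), v) \<in> dom_gen.
        square_integrable (F \<circ> rep_L2 u1) \<and> square_integrable (F \<circ> rep_L2 u2) \<and>
        J F ((u1, u2), v) \<in> dom_gen)"

definition H0L :: "(H \<Rightarrow> H) \<Rightarrow> (real \<Rightarrow> real) \<Rightarrow> bool" where
  "H0L S F \<longleftrightarrow>
     (\<exists>C :: real \<Rightarrow> real \<Rightarrow> real.
        (\<forall>p p' q q'. 0 \<le> p \<and> p \<le> p' \<and> 0 \<le> q \<and> q \<le> q' \<longrightarrow> C p q \<le> C p' q') \<and>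
        (\<forall>\<phi>\<in>dom_gen. \<forall>\<psi>\<in>dom_gen.
           energy_norm S (J F \<phi> - J F \<psi>)
             \<le> C (energy_norm S \<phi>) (energy_norm S \<psi>) * energy_norm S (\<phi> - \<psi>)))"

definition H1L :: "(H \<Rightarrow> H) \<Rightarrow> real \<Rightarrow> real \<Rightarrow> real \<Rightarrow> (real \<Rightarrow> real) \<Rightarrow> bool" where
  "H1L S c a1 a2 F \<longleftrightarrow>
     (\<exists>C :: real \<Rightarrow> real \<Rightarrow> real \<Rightarrow> real \<Rightarrow> real.
        (\<forall>p p' q q' r r' s s'.
           0 \<le> p \<and> p \<le> p' \<and> 0 \<le> q \<and> q \<le> q' \<and> 0 \<le> r \<and> r \<le> r' \<and> 0 \<le> s \<and> s \<le> s' \<longrightarrow>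
           C p q r s \<le> C p' q' r' s') \<and>
        (\<forall>\<phi>\<in>dom_gen. \<forall>\<psi>\<in>dom_gen.
           energy_norm S (gen c a1 a2 (J F \<phi> - J F \<psi>))
             \<le> C (energy_norm S \<phi>) (energy_norm S (gen c a1 a2 \<phi>))
                 (energy_norm S \<psi>) (energy_norm S (gen c a1 a2 \<psi>))
               * energy_norm S (gen c a1 a2 \<phi> - gen c a1 a2 \<psi>)))"

definition time_interval :: "ereal \<Rightarrow> real set" where
  "time_interval T = {t. 0 \<le> t \<and> ereal t < T}"

text \<open>Limits are taken in the energy norm; at \<open>t = 0\<close> they are one-sided.\<close>

definition is_solution ::
  "(H \<Rightarrow> H) \<Rightarrow> real \<Rightarrow> real \<Rightarrow> real \<Rightarrow> (real \<Rightarrow> real) \<Rightarrow> ereal \<Rightarrow> H \<times> H \<Rightarrow> (real \<Rightarrow> H \<times> H) \<Rightarrow> bool"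
where
  "is_solution S c a1 a2 F T \<phi>\<^sub>0 \<phi> \<longleftrightarrow>
     \<phi> 0 = \<phi>\<^sub>0 \<and> \<phi> \<in> time_interval T \<rightarrow> dom_gen \<and>
     (\<exists>\<phi>'. \<phi>' \<in> time_interval T \<rightarrow> dom_sqrt_A \<times> UNIV \<and>
        (\<forall>t\<in>time_interval T.
           ((\<lambda>s. energy_norm S ((\<phi> s - \<phi> t) /\<^sub>R (s - t) - \<phi>' t)) \<longlongrightarrow> 0)
             (at t within time_interval T) \<and>
           ((\<lambda>s. energy_norm S (\<phi>' s - \<phi>' t)) \<longlongrightarrow> 0) (at t within time_interval T) \<and>
           \<phi>' t = gen c a1 a2 (\<phi> t) + J F (\<phi> t)))"

text \<open>The library has \<open>infdist x {} = 0\<close>; here the distance to the empty set is infinite.\<close>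

definition neighbourhood_upto :: "real set \<Rightarrow> real \<Rightarrow> real set" where
  "neighbourhood_upto \<Sigma> r = {x. \<Sigma> \<noteq> {} \<and> infdist x \<Sigma> \<le> r}"

end

(* Energy method with the time-independent weights theta = exp (- l * sqrt (d^2 + (x - x0)^2)), which
   satisfy |theta'| <= l * theta. For E = 1/2 sum_k int theta (|v_k|^2 + c^2 |u_k'|^2 + a_k |u_k|^2)
   the boundary terms cancel by the transmission conditions and E' <= (c l + K) E, where K comes from
   |F a| <= L |a| on the bounded range of the solution; this bound follows from (H0L), applied to
   multiples of a plateau function. Off a ball of radius r > c t around x0 the weight is at most
   exp (- l r), so l -> oo shows that a solution whose data vanish on that ball vanishes near x0 at
   time t. The functional analysis is kept elementary: elements of H1 are the indefinite integrals of
   their weak derivatives (du Bois-Reymond), and convergence in the energy norm implies convergence in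
   L2 because A z = zeta is solved explicitly for zeta with compact support. *)

theory Submission
  imports Defs "HOL-Computational_Algebra.Polynomial"
begin

section \<open>Smooth bump functions\<close>

text \<open>A weight that does not move with time keeps the argument inside inner products: no
  integral over a moving cone and no pointwise derivative of the solution occurs. The speed is a
  balance of exponents, growth \<open>c * l\<close> in time against decay \<open>l\<close> in space,
  so the constant in front of \<open>l\<close> in the growth rate has to be exactly
  \<open>c\<close>, while the contribution of F is free of \<open>l\<close> and is lost in the
  limit. Both half lines carry the same weight in the same coordinate; hence its value at the node
  is common to both. The obstacle is the abstract root \<open>S\<close>. It is accessible only
  through self-adjointness and \<open>S (S z) = A z\<close> on \<open>dom_A\<close>, whereas the
  velocity, and with it the error of the difference quotient, is only known to lie in
  \<open>dom_sqrt_A\<close>. There the norm of \<open>S w\<close> is not computed but bounded from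
  below by duality with solutions of A z = \<zeta>. The function F is constrained only through norms
  of compositions, so pointwise information has to be extracted from functions that take a
  prescribed value on a set of positive measure.\<close>

definition flat_exp :: "real poly \<Rightarrow> real \<Rightarrow> real" where
  "flat_exp p x = (if x > 0 then poly p (1 / x) * exp (- (1 / x)) else 0)"

lemma poly_times_exp_tendsto_0: "((\<lambda>s. poly p s * exp (- s)) \<longlongrightarrow> (0::real)) at_top"
proof -
  have "((\<lambda>s. \<Sum>i\<le>degree p. coeff p i * (s ^ i / exp s)) \<longlongrightarrow> (\<Sum>i\<le>degree p. coeff p i * 0)) at_top"
    by (intro tendsto_sum tendsto_mult tendsto_const tendsto_power_div_exp_0)
  then show ?thesis
    by (simp add: poly_altdef sum_distrib_right exp_minus divide_inverse mult.assoc)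
qed

text \<open>With s = 1 / x one has d/dx = - s^2 d/ds, which sends p(s) exp(-s) to s^2 (p - p')(s)
  exp(-s). Differentiation therefore only changes the polynomial, also at the origin, where the
  exponential beats every power of 1 / x.\<close>

lemma flat_exp_deriv:
  "(flat_exp p has_real_derivative flat_exp ([:0, 0, 1:] * (p - pderiv p)) x) (at x)"
proof (cases x "0 :: real" rule: linorder_cases)
  case less
  have "((\<lambda>_. 0) has_real_derivative 0) (at x)" by simp
  then have "(flat_exp p has_real_derivative 0) (at x)"
    by (rule has_field_derivative_transform_within_open[where S="{..<0}"]) (auto simp: flat_exp_def less)
  with less show ?thesis by (simp add: flat_exp_def)
next
  case greater
  have "((\<lambda>x. poly p (1 / x) * exp (- (1 / x))) has_real_derivative
          (poly (pderiv p) (1 / x) * (- 1 / x\<^sup>2)) * exp (- (1 / x)) + poly p (1 / x) * (exp (- (1 / x)) * (1 / x\<^sup>2))) (at x)"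
    using greater
    by (auto intro!: derivative_eq_intros DERIV_chain2[OF poly_DERIV] simp: power2_eq_square)
  also have "(poly (pderiv p) (1 / x) * (- 1 / x\<^sup>2)) * exp (- (1 / x)) + poly p (1 / x) * (exp (- (1 / x)) * (1 / x\<^sup>2))
      = flat_exp ([:0, 0, 1:] * (p - pderiv p)) x"
    using greater by (simp add: flat_exp_def field_simps power2_eq_square)
  finally have d: "((\<lambda>x. poly p (1 / x) * exp (- (1 / x))) has_real_derivative
      flat_exp ([:0, 0, 1:] * (p - pderiv p)) x) (at x)" .
  show ?thesis
    by (rule has_field_derivative_transform_within_open[OF d, where S="{0<..}"]) (auto simp: flat_exp_def greater)
next
  case equal
  \<comment> \<open>The factor \<open>[:0, 1:]\<close> is the 1 / y of the difference quotient at
    0.\<close>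
  have "((\<lambda>y. poly ([:0, 1:] * p) (1 / y) * exp (- (1 / y))) \<longlongrightarrow> 0) (at_right 0)"
    using filterlim_compose[OF poly_times_exp_tendsto_0[of "[:0, 1:] * p"] filterlim_inverse_at_top_right]
    by (simp add: inverse_eq_divide)
  then have "((\<lambda>y. (flat_exp p y - flat_exp p 0) / (y - 0)) \<longlongrightarrow> 0) (at_right 0)"
    by (rule Lim_transform_eventually)
       (auto simp: flat_exp_def eventually_at_right_less intro!: eventually_mono[OF eventually_at_right_less])
  moreover have "((\<lambda>y. (flat_exp p y - flat_exp p 0) / (y - 0)) \<longlongrightarrow> 0) (at_left 0)"
    by (rule Lim_transform_eventually[OF tendsto_const])
       (auto simp: flat_exp_def eventually_at_filter intro!: always_eventually)
  ultimately have "((\<lambda>y. (flat_exp p y - flat_exp p 0) / (y - 0)) \<longlongrightarrow> 0) (at 0)"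
    by (subst filterlim_at_split) simp
  then show ?thesis
    using equal by (simp add: has_field_derivative_iff flat_exp_def)
qed

text \<open>The product rule turns one product into two, so it is the finite sums that are closed
  under \<open>deriv\<close>; this yields derivatives of all orders at once. For positive
  \<open>n\<close> the first factor kills everything left of \<open>p\<close>, the second everything
  right of \<open>q\<close>.\<close>

inductive_set bump_span :: "real \<Rightarrow> real \<Rightarrow> real \<Rightarrow> (real \<Rightarrow> real) set" for n p q where
  base: "(\<lambda>x. flat_exp P (n * (x - p)) * flat_exp Q (n * (q - x))) \<in> bump_span n p q"
| add: "f \<in> bump_span n p q \<Longrightarrow> g \<in> bump_span n p q \<Longrightarrow> (\<lambda>x. f x + g x) \<in> bump_span n p q"

lemma flat_exp_smult: "r * flat_exp P x = flat_exp (smult r P) x"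
  by (simp add: flat_exp_def)

lemma bump_span_deriv:
  assumes "f \<in> bump_span n p q"
  shows "\<exists>f'\<in>bump_span n p q. \<forall>x. (f has_real_derivative f' x) (at x)"
  using assms
proof induction
  case (base P Q)
  define P' where "P' = smult n ([:0, 0, 1:] * (P - pderiv P))"
  define Q' where "Q' = smult (- n) ([:0, 0, 1:] * (Q - pderiv Q))"
  have "((\<lambda>x. flat_exp P (n * (x - p)) * flat_exp Q (n * (q - x))) has_real_derivative
      flat_exp P' (n * (x - p)) * flat_exp Q (n * (q - x)) + flat_exp P (n * (x - p)) * flat_exp Q' (n * (q - x))) (at x)" for x
    unfolding P'_def Q'_def flat_exp_smult[symmetric]
    by (rule derivative_eq_intros DERIV_chain2[OF flat_exp_deriv] refl)+ (simp add: algebra_simps)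
  then show ?case
    by (intro bexI[where x="\<lambda>x. flat_exp P' (n * (x - p)) * flat_exp Q (n * (q - x)) + flat_exp P (n * (x - p)) * flat_exp Q' (n * (q - x))"]
        bump_span.intros) auto
next
  case (add f g)
  then obtain f' g' where "f' \<in> bump_span n p q" "g' \<in> bump_span n p q"
    "\<forall>x. (f has_real_derivative f' x) (at x)" "\<forall>x. (g has_real_derivative g' x) (at x)"
    by blast
  then show ?case
    by (intro bexI[where x="\<lambda>x. f' x + g' x"] bump_span.intros) (auto intro!: derivative_eq_intros)
qed

lemma bump_span_iterated_deriv: "f \<in> bump_span n p q \<Longrightarrow> (deriv ^^ k) f \<in> bump_span n p q"
proof (induction k)
  case (Suc k)
  then obtain f' where f': "f' \<in> bump_span n p q" "\<forall>x. ((deriv ^^ k) f has_real_derivative f' x) (at x)"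
    using bump_span_deriv by blast
  then have "deriv ((deriv ^^ k) f) = f'"
    by (auto intro: DERIV_imp_deriv)
  with f' show ?case by simp
qed simp

lemma bump_span_support:
  assumes "f \<in> bump_span n p q" "n > 0" "x \<notin> {p..q}"
  shows "f x = 0"
  using assms(1)
proof induction
  case (base P Q)
  show ?case
  proof (cases "x < p")
    case True
    then have "n * (x - p) \<le> 0" using assms by (simp add: mult_nonneg_nonpos)
    then show ?thesis by (simp add: flat_exp_def)
  next
    case False
    then have "n * (q - x) \<le> 0" using assms by (simp add: mult_nonneg_nonpos)
    then show ?thesis by (simp add: flat_exp_def)
  qed
qed simp

lemma test_function_bump_span:
  assumes "f \<in> bump_span n p q" "n > 0" "0 < p"
  shows "test_function f"
  unfolding test_function_def
proof (intro conjI allI exI)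
  fix k x
  obtain f' where "\<forall>x. ((deriv ^^ k) f has_real_derivative f' x) (at x)"
    using bump_span_deriv[OF bump_span_iterated_deriv[OF assms(1)]] by blast
  then show "(deriv ^^ k) f differentiable at x"
    by (auto simp: real_differentiable_def)
next
  show "x \<notin> {p..q} \<longrightarrow> f x = 0" for x
    using bump_span_support[OF assms(1,2)] by blast
qed fact

definition bump :: "real \<Rightarrow> real \<Rightarrow> real \<Rightarrow> real \<Rightarrow> real" where
  "bump n p q x = flat_exp 1 (n * (x - p)) * flat_exp 1 (n * (q - x))"

lemma bump_in_span: "bump n p q \<in> bump_span n p q"
  unfolding bump_def[abs_def] by (rule bump_span.base)

lemma test_function_bump: "n > 0 \<Longrightarrow> 0 < p \<Longrightarrow> test_function (bump n p q)"
  using test_function_bump_span bump_in_span by blast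

lemma bump_nonneg: "0 \<le> bump n p q x"
  by (simp add: bump_def flat_exp_def)

lemma bump_pos: "n > 0 \<Longrightarrow> p < x \<Longrightarrow> x < q \<Longrightarrow> 0 < bump n p q x"
  by (simp add: bump_def flat_exp_def)

lemma bump_le_1: "bump n p q x \<le> 1"
  by (auto simp: bump_def flat_exp_def intro!: mult_le_one)

lemma bump_support: "n > 0 \<Longrightarrow> x \<notin> {p<..<q} \<Longrightarrow> bump n p q x = 0"
proof -
  assume n: "n > 0" and x: "x \<notin> {p<..<q}"
  then have "x - p \<le> 0 \<or> q - x \<le> 0" by auto
  then have "n * (x - p) \<le> 0 \<or> n * (q - x) \<le> 0" using n by (auto simp: mult_nonneg_nonpos)
  then show ?thesis by (auto simp: bump_def flat_exp_def)
qed

lemma bump_continuous: "continuous_on S (bump n p q)"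
proof -
  obtain f' where "\<forall>x. (bump n p q has_real_derivative f' x) (at x)"
    using bump_span_deriv[OF bump_in_span] by blast
  then show ?thesis
    by (meson DERIV_isCont continuous_at_imp_continuous_on)
qed

text \<open>Inside the interval the exponents \<open>1 / (n * (x - p))\<close> and
  \<open>1 / (n * (q - x))\<close> tend to 0. This is the purpose of the parameter \<open>n\<close>:
  smooth functions approximate an indicator without any convolution.\<close>

lemma bump_tendsto_indicator: "(\<lambda>n. bump (real (Suc n)) p q x) \<longlonglongrightarrow> indicator {p<..<q} x"
proof (cases "x \<in> {p<..<q}")
  case True
  have L: "(\<lambda>n. exp (- (inverse (real (Suc n)) * (1 / y)))) \<longlonglongrightarrow> exp (- (0 * (1 / y)))" for y :: real
    by (intro tendsto_intros LIMSEQ_inverse_real_of_nat)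
  have "(\<lambda>n. exp (- (inverse (real (Suc n)) * (1 / (x - p)))) * exp (- (inverse (real (Suc n)) * (1 / (q - x)))))
     \<longlonglongrightarrow> exp (- (0 * (1 / (x - p)))) * exp (- (0 * (1 / (q - x))))"
    by (intro tendsto_mult L)
  moreover have "bump (real (Suc n)) p q x = exp (- (inverse (real (Suc n)) * (1 / (x - p)))) * exp (- (inverse (real (Suc n)) * (1 / (q - x))))" for n
  proof -
    have "0 < real (Suc n) * (x - p)" "0 < real (Suc n) * (q - x)" using True by auto
    then show ?thesis by (simp only: bump_def flat_exp_def if_True poly_1 mult_1 inverse_eq_divide) (simp add: field_simps)
  qed
  ultimately show ?thesis using True by simp
next
  case False
  then show ?thesis using bump_support[of "real (Suc n)" x p q for n] by simp
qed

section \<open>Closure properties of test functions\<close>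

lemma test_function_antideriv:
  assumes d: "\<And>x. (\<eta> has_real_derivative f x) (at x)" and f: "test_function f"
    and supp: "0 < a" "\<And>x. x \<notin> {a..b} \<Longrightarrow> \<eta> x = 0"
  shows "test_function \<eta>" "deriv \<eta> = f"
proof -
  show eq: "deriv \<eta> = f" using d by (auto intro: DERIV_imp_deriv)
  have "(deriv ^^ n) \<eta> differentiable (at x)" for n x
  proof (cases n)
    case 0
    then show ?thesis using d by (auto simp: real_differentiable_def)
  next
    case (Suc m)
    then have "(deriv ^^ n) \<eta> = (deriv ^^ m) f" by (simp add: funpow_swap1 eq del: funpow.simps) (metis eq funpow_swap1 funpow.simps(2) comp_apply)
    then show ?thesis using f by (simp add: test_function_def)
  qed
  then show "test_function \<eta>" using supp unfolding test_function_def by blast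
qed

lemma test_function_lincomb:
  assumes "test_function f" "test_function g"
  shows "test_function (\<lambda>x. r * f x + s * g x)"
proof -
  have D: "((deriv ^^ n) f has_real_derivative (deriv ^^ Suc n) f x) (at x)"
          "((deriv ^^ n) g has_real_derivative (deriv ^^ Suc n) g x) (at x)" for n x
    using assms by (auto simp: test_function_def DERIV_deriv_iff_real_differentiable)
  have eq: "(deriv ^^ n) (\<lambda>x. r * f x + s * g x) = (\<lambda>x. r * (deriv ^^ n) f x + s * (deriv ^^ n) g x)" for n
  proof (induction n)
    case (Suc n)
    have "deriv (\<lambda>x. r * (deriv ^^ n) f x + s * (deriv ^^ n) g x) x = r * (deriv ^^ Suc n) f x + s * (deriv ^^ Suc n) g x" for x
      by (rule DERIV_imp_deriv) (auto intro!: derivative_eq_intros D[unfolded funpow.simps comp_apply] )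
    then show ?case by (auto simp: Suc)
  qed simp
  obtain a b a' b' where ab: "0 < a" "\<And>x. x \<notin> {a..b} \<Longrightarrow> f x = 0" "0 < a'" "\<And>x. x \<notin> {a'..b'} \<Longrightarrow> g x = 0"
    using assms unfolding test_function_def by blast
  show ?thesis
    unfolding test_function_def
  proof (intro conjI allI exI)
    show "(deriv ^^ n) (\<lambda>x. r * f x + s * g x) differentiable at x" for n x
      unfolding eq using D(1)[of n x] D(2)[of n x] by (intro derivative_intros) (auto simp: real_differentiable_def simp del: funpow.simps)
    show "0 < min a a'" using ab by simp
    show "x \<notin> {min a a'..max b b'} \<longrightarrow> r * f x + s * g x = 0" for x
      using ab(2)[of x] ab(4)[of x] by (cases "x \<in> {a..b}"; cases "x \<in> {a'..b'}") auto
  qed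
qed

lemma test_functionD:
  assumes "test_function \<eta>"
  shows "(\<eta> has_real_derivative deriv \<eta> x) (at x)" "continuous_on A \<eta>" "continuous_on A (deriv \<eta>)"
    "\<exists>a b. 0 < a \<and> a < b \<and> (\<forall>x. x \<notin> {a..b} \<longrightarrow> \<eta> x = 0 \<and> deriv \<eta> x = 0)"
proof -
  have "(deriv ^^ 0) \<eta> differentiable (at x)" "(deriv ^^ 1) \<eta> differentiable (at x)" for x
    using assms unfolding test_function_def by blast+
  then have d: "\<eta> differentiable (at x)" "deriv \<eta> differentiable (at x)" for x by simp_all
  then show "(\<eta> has_real_derivative deriv \<eta> x) (at x)" by (simp add: DERIV_deriv_iff_real_differentiable)
  show "continuous_on A \<eta>" "continuous_on A (deriv \<eta>)"
    using d by (meson continuous_at_imp_continuous_on differentiable_imp_continuous_within)+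
  obtain a b where ab: "0 < a" "\<And>x. x \<notin> {a..b} \<Longrightarrow> \<eta> x = 0"
    using assms unfolding test_function_def by blast
  \<comment> \<open>The definition of \<open>test_function\<close> does not exclude
    \<open>b \<le> a\<close>; raising the right end to \<open>a + 1\<close> provides the
    nondegenerate interval that is claimed.\<close>
  have "deriv \<eta> x = 0" if "x \<notin> {a..max b (a+1)}" for x
  proof (rule DERIV_imp_deriv, rule has_field_derivative_transform_within_open)
    show "((\<lambda>_. 0) has_real_derivative 0) (at x)" by simp
    show "open (- {a..max b (a+1)})" by (simp add: open_Compl)
    show "x \<in> - {a..max b (a+1)}" using that by simp
    show "0 = \<eta> y" if "y \<in> - {a..max b (a+1)}" for y
      using that ab(2)[of y] by (auto simp: not_le)
  qed
  then show "\<exists>a b. 0 < a \<and> a < b \<and> (\<forall>x. x \<notin> {a..b} \<longrightarrow> \<eta> x = 0 \<and> deriv \<eta> x = 0)"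
    using ab(1) ab(2) by (intro exI[of _ a] exI[of _ "max b (a+1)"]) (force)
qed

section \<open>The fundamental lemma of the calculus of variations\<close>

lemma AE_half_line_iff: "(AE x in half_line. P x) \<longleftrightarrow> (AE x in lebesgue. 0 < x \<longrightarrow> P x)"
  by (simp add: AE_restrict_space_iff)

text \<open>The open rays are an intersection-stable generator of the Borel sets, so vanishing
  integrals over intervals pass to all Borel sets by Dynkin's argument; uniqueness of densities then
  gives \<open>w = 0\<close> almost everywhere.\<close>

lemma set_integral_zero_imp_AE_zero:
  fixes w :: "real \<Rightarrow> real"
  assumes w: "w absolutely_integrable_on {a<..<b}"
    and zero: "\<And>p q. a < p \<Longrightarrow> q < b \<Longrightarrow> p < q \<Longrightarrow> (LINT x:{p<..<q}|lebesgue. w x) = 0"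
  shows "AE x in lebesgue. x \<in> {a<..<b} \<longrightarrow> w x = 0"
proof (cases "a < b")
  case True
  have w_int: "integrable lebesgue (\<lambda>x. indicator {a<..<b} x * w x)"
    using w by (simp add: set_integrable_def)
  \<comment> \<open>The sets that are reached are the Borel sets, so \<open>w\<close> is traded for
    a Borel version \<open>v\<close> that agrees with it almost everywhere.\<close>
  obtain v where v: "v \<in> borel_measurable lborel" "AE x in lborel. indicator {a<..<b} x * w x = v x"
    using completion_ex_borel_measurable_real[OF borel_measurable_integrable[OF w_int]] by auto
  have AE_v: "AE x in lebesgue. indicator {a<..<b} x * w x = v x"
    using v(2) by (rule AE_completion)
  have v_leb: "v \<in> borel_measurable lebesgue"
    using v(1) by (rule measurable_completion)
  have v_int': "integrable lebesgue v"
    using w_int AE_v v_leb by (subst integrable_cong_AE[symmetric, OF _ v_leb AE_v]) auto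
  then have v_int: "integrable lborel v"
    using integrable_completion[OF v(1)] by simp
  have bor: "(LINT x:A|lborel. v x) = (LINT x:A \<inter> {a<..<b}|lebesgue. w x)" if "A \<in> sets borel" for A
  proof -
    have "(LINT x:A|lborel. v x) = (LINT x:A|lebesgue. v x)"
      using that v(1) unfolding set_lebesgue_integral_def by (subst integral_completion) auto
    also have "\<dots> = (\<integral>x. indicator A x * (indicator {a<..<b} x * w x) \<partial>lebesgue)"
      unfolding set_lebesgue_integral_def
    proof (rule integral_cong_AE)
      show "AE x in lebesgue. indicator A x *\<^sub>R v x = indicator A x * (indicator {a<..<b} x * w x)"
        using AE_v by eventually_elim simp
      have "A \<in> sets lebesgue" using that by (simp add: sets_completionI_sets)
      then show "(\<lambda>x. indicator A x *\<^sub>R v x) \<in> borel_measurable lebesgue"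
        "(\<lambda>x. indicator A x * (indicator {a<..<b} x * w x)) \<in> borel_measurable lebesgue"
        using v_leb w_int by (auto intro!: borel_measurable_times)
    qed
    also have "\<dots> = (LINT x:A \<inter> {a<..<b}|lebesgue. w x)"
      unfolding set_lebesgue_integral_def by (intro Bochner_Integration.integral_cong) (auto simp: indicator_def)
    finally show ?thesis .
  qed
  have sI: "w absolutely_integrable_on (A \<inter> {a<..<b})" if "A \<in> sets borel" for A
    using that by (intro set_integrable_subset[OF w]) (auto simp: sets_completionI_sets)
  have lim: "(LINT x:{p<..<q}|lebesgue. w x) = 0" if pq: "a \<le> p" "q \<le> b" for p q
  proof (cases "p < q")
    case True
    \<comment> \<open>Intervals that touch \<open>a\<close> or \<open>b\<close> are exhausted from
      inside. The 3 gives \<open>3 * e n \<le> q - p\<close>, so that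
      \<open>p + e n < q - e n\<close> already for \<open>n = 0\<close>.\<close>
    define e where "e n = (q - p) / (real n + 3)" for n :: nat
    have e: "0 < e n" "3 * e n \<le> q - p" for n
    proof -
      show "0 < e n" using True by (simp add: e_def)
      have "e n \<le> (q - p) / 3"
        unfolding e_def using True by (intro divide_left_mono) auto
      then show "3 * e n \<le> q - p" by simp
    qed
    have e_decr: "e (Suc n) \<le> e n" for n
      unfolding e_def using True by (intro divide_left_mono) auto
    define A where "A n = {p + e n <..< q - e n}" for n
    have UN: "(\<Union>n. A n) = {p<..<q}"
    proof (intro equalityI subsetI)
      fix x assume x: "x \<in> {p<..<q}"
      define d where "d = min (x - p) (q - x)"
      have "d > 0" using x by (simp add: d_def)
      obtain n :: nat where "(q - p) / d < real n" using reals_Archimedean2 by blast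
      then have "(q - p) < real n * d" using \<open>d > 0\<close> by (simp add: field_simps)
      also have "\<dots> \<le> (real n + 3) * d" using \<open>d > 0\<close> by (intro mult_right_mono) auto
      finally have "e n < d" by (simp add: e_def field_simps)
      then show "x \<in> (\<Union>n. A n)" by (auto simp: A_def d_def intro!: exI[of _ n])
    next
      fix x assume "x \<in> (\<Union>n. A n)"
      then obtain n where "x \<in> A n" by blast
      then show "x \<in> {p<..<q}" using e(1)[of n] by (simp add: A_def)
    qed
    have "(\<lambda>n. LINT x:A n|lebesgue. w x) \<longlonglongrightarrow> (LINT x:(\<Union>n. A n)|lebesgue. w x)"
    proof (rule set_integral_cont_up)
      show "incseq A"
      proof (rule incseq_SucI)
        show "A n \<le> A (Suc n)" for n
          using e_decr[of n] by (auto simp: A_def)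
      qed
      show "w absolutely_integrable_on \<Union> (range A)"
        unfolding UN using pq by (intro set_integrable_subset[OF w]) auto
    qed (auto simp: A_def)
    moreover have "(LINT x:A n|lebesgue. w x) = 0" for n
      unfolding A_def using pq e[of n] by (intro zero) linarith+
    ultimately show ?thesis unfolding UN by (simp add: LIMSEQ_const_iff)
  qed (simp add: set_lebesgue_integral_def)
  have all: "(LINT x:A \<inter> {a<..<b}|lebesgue. w x) = 0" if "A \<in> sets borel" for A
  proof -
    have "Int_stable (range (\<lambda>a::real. {a<..}))"
    proof (rule Int_stableI_image)
      show "\<exists>k\<in>UNIV. {x<..} \<inter> {y<..} = {k<..}" for x y :: real
        by (intro bexI[of _ "max x y"]) auto
    qed
    moreover have "(range (\<lambda>a::real. {a<..})) \<subseteq> Pow UNIV" by simp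
    moreover have "A \<in> sigma_sets UNIV (range (\<lambda>a::real. {a<..}))"
      using that by (simp add: borel_Ioi)
    ultimately show ?thesis
    proof (induction rule: sigma_sets_induct_disjoint)
      case (basic A)
      then obtain c where "A = {c<..}" by auto
      then have "A \<inter> {a<..<b} = {max a c<..<b}" by auto
      then show ?case using lim[of "max a c" b] by simp
    next
      case empty
      then show ?case by (simp add: set_lebesgue_integral_def)
    next
      case (compl A)
      then have A: "A \<in> sets borel" by (simp add: borel_Ioi)
      have "(LINT x:(A \<inter> {a<..<b}) \<union> ((UNIV - A) \<inter> {a<..<b})|lebesgue. w x) =
        (LINT x:A \<inter> {a<..<b}|lebesgue. w x) + (LINT x:(UNIV - A) \<inter> {a<..<b}|lebesgue. w x)"
        using A by (intro set_integral_Un sI) auto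
      moreover have "(A \<inter> {a<..<b}) \<union> ((UNIV - A) \<inter> {a<..<b}) = {a<..<b}" by auto
      ultimately show ?case using compl lim[of a b] by simp
    next
      case (union A)
      then have A: "A n \<in> sets borel" for n by (auto simp: borel_Ioi)
      have "(LINT x:(\<Union>n. A n \<inter> {a<..<b})|lebesgue. w x) = (\<Sum>n. LINT x:A n \<inter> {a<..<b}|lebesgue. w x)"
      proof (rule lebesgue_integral_countable_add)
        show "A n \<inter> {a<..<b} \<in> sets lebesgue" for n
          using A by (auto simp: sets_completionI_sets)
        show "(A i \<inter> {a<..<b}) \<inter> (A j \<inter> {a<..<b}) = {}" if "i \<noteq> j" for i j
          using union(1) that by (auto simp: disjoint_family_on_def)
        have "w absolutely_integrable_on ((\<Union>n. A n) \<inter> {a<..<b})"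
          using A by (intro sI) auto
        then show "w absolutely_integrable_on (\<Union>n. A n \<inter> {a<..<b})" by simp
      qed
      then show ?case using union by simp
    qed
  qed
  have "AE x in lborel. v x = 0"
    using v_int by (rule density_unique_real) (auto simp: bor all)
  then have "AE x in lebesgue. v x = 0" by (rule AE_completion)
  with AE_v show ?thesis by eventually_elim (auto split: split_indicator_asm)
qed auto

lemma AE_half_lineI:
  assumes "\<And>N. N > 0 \<Longrightarrow> AE x in lebesgue. x \<in> {0<..<N} \<longrightarrow> P x"
  shows "AE x in half_line. P x"
proof -
  have "AE x in lebesgue. \<forall>n. x \<in> {0<..<real (Suc n)} \<longrightarrow> P x"
    using assms by (subst AE_all_countable) auto
  then show ?thesis
    unfolding AE_half_line_iff
  proof eventually_elim
    case (elim x)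
    obtain n where "x < real n" using reals_Archimedean2 by blast
    then show ?case using elim[rule_format, of n] by auto
  qed
qed

lemma set_integral_half_line:
  fixes f :: "real \<Rightarrow> real"
  assumes "\<And>x. x \<notin> A \<Longrightarrow> f x = 0" "A \<subseteq> {0<..}"
  shows "(LINT x|half_line. f x) = (LINT x:A|lebesgue. f x)"
proof -
  have "(LINT x|half_line. f x) = (LINT x|lebesgue. indicator {0<..} x *\<^sub>R f x)"
    by (simp add: Bochner_Integration.integral_restrict_space)
  also have "\<dots> = (LINT x:A|lebesgue. f x)"
    unfolding set_lebesgue_integral_def
    using assms by (intro Bochner_Integration.integral_cong) (auto split: split_indicator)
  finally show ?thesis .
qed

lemma bump_integral_tendsto:
  assumes "w absolutely_integrable_on {p<..<q}" "0 < p"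
  shows "(\<lambda>n. LINT x|half_line. w x * bump (real (Suc n)) p q x) \<longlonglongrightarrow> (LINT x:{p<..<q}|lebesgue. w x)"
proof -
  have eq: "(LINT x|half_line. w x * bump (real (Suc n)) p q x) = (LINT x|lebesgue. (indicator {p<..<q} x * w x) * bump (real (Suc n)) p q x)" for n
    using bump_support[of "real (Suc n)" _ p q] assms(2)
    by (subst set_integral_half_line[where A="{p<..<q}"]) (auto simp: set_lebesgue_integral_def mult.assoc)
  have meas: "(\<lambda>x. indicator {p<..<q} x * w x) \<in> borel_measurable lebesgue"
    using assms(1) by (auto simp: set_integrable_def)
  have meas_bump: "bump m p q \<in> borel_measurable lebesgue" for m
    using borel_measurable_continuous_onI[OF bump_continuous] by (auto intro: measurable_completion)
  have "(\<lambda>n. LINT x|lebesgue. (indicator {p<..<q} x * w x) * bump (real (Suc n)) p q x) \<longlonglongrightarrow>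
     (LINT x|lebesgue. indicator {p<..<q} x * w x)"
  proof (rule integral_dominated_convergence)
    show "integrable lebesgue (\<lambda>x. \<bar>indicator {p<..<q} x * w x\<bar>)"
      using assms(1) by (auto simp: set_integrable_def)
    show "AE x in lebesgue. norm ((indicator {p<..<q} x * w x) * bump (real (Suc n)) p q x) \<le> \<bar>indicator {p<..<q} x * w x\<bar>" for n
      using bump_nonneg[of "real (Suc n)" p q] bump_le_1[of "real (Suc n)" p q]
      by (intro always_eventually allI) (auto simp: abs_mult intro!: mult_left_le)
    show "AE x in lebesgue. (\<lambda>n. (indicator {p<..<q} x * w x) * bump (real (Suc n)) p q x) \<longlonglongrightarrow> indicator {p<..<q} x * w x"
    proof (intro always_eventually allI)
      fix x
      have "(\<lambda>n. (indicator {p<..<q} x * w x) * bump (real (Suc n)) p q x) \<longlonglongrightarrow> (indicator {p<..<q} x * w x) * indicator {p<..<q} x"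
        by (intro tendsto_intros bump_tendsto_indicator)
      then show "(\<lambda>n. (indicator {p<..<q} x * w x) * bump (real (Suc n)) p q x) \<longlonglongrightarrow> indicator {p<..<q} x * w x"
        by (auto split: split_indicator_asm split_indicator)
    qed
  qed (use meas meas_bump in auto)
  then show ?thesis unfolding eq by (simp add: set_lebesgue_integral_def)
qed

lemma bump_orthogonal_imp_AE_zero:
  assumes w: "\<And>N. N > 0 \<Longrightarrow> w absolutely_integrable_on {0<..<N}"
    and orth: "\<And>n p q. n > 0 \<Longrightarrow> 0 < p \<Longrightarrow> p < q \<Longrightarrow> (LINT x|half_line. w x * bump n p q x) = 0"
  shows "AE x in half_line. w x = 0"
proof (rule AE_half_lineI, rule set_integral_zero_imp_AE_zero)
  fix N p q :: real assume N: "N > 0" and pq: "0 < p" "q < N" "p < q"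
  have "w absolutely_integrable_on {p<..<q}"
    using pq by (intro set_integrable_subset[OF w[OF N]]) auto
  from bump_integral_tendsto[OF this pq(1)] show "(LINT x:{p<..<q}|lebesgue. w x) = 0"
    using pq by (simp add: orth LIMSEQ_const_iff)
qed (use w in auto)

section \<open>Functions with an integrable density\<close>

text \<open>Local absolute continuity on the closed half line, with the derivative kept as an
  integrable function and never as a pointwise limit: weak derivatives are available only up to null
  sets.\<close>

definition has_density :: "(real \<Rightarrow> real) \<Rightarrow> (real \<Rightarrow> real) \<Rightarrow> bool" where
  "has_density f f' \<longleftrightarrow>
     (\<forall>N. f' absolutely_integrable_on {0..N}) \<and> (\<forall>x\<ge>0. f x = f 0 + integral {0..x} f')"

lemma has_densityD:
  assumes "has_density f f'"
  shows "f' absolutely_integrable_on {0..N}" "0 \<le> x \<Longrightarrow> f x = f 0 + integral {0..x} f'"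
  using assms unfolding has_density_def by blast+

lemma has_densityI:
  assumes "\<And>N. f' absolutely_integrable_on {0..N}" "\<And>x. 0 \<le> x \<Longrightarrow> f x = f 0 + integral {0..x} f'"
  shows "has_density f f'"
  using assms unfolding has_density_def by blast

lemma has_density_integrable:
  assumes "has_density f f'" "0 \<le> x"
  shows "f' absolutely_integrable_on {x..y}" "f' integrable_on {x..y}"
proof -
  have "f' absolutely_integrable_on {0..y}" by (rule has_densityD[OF assms(1)])
  then show "f' absolutely_integrable_on {x..y}"
    by (rule set_integrable_subset) (use assms in auto)
  then show "f' integrable_on {x..y}"
    by (rule set_lebesgue_integral_eq_integral)
qed

lemma has_density_diff:
  assumes "has_density f f'" "0 \<le> x" "x \<le> y"
  shows "f y - f x = integral {x..y} f'"
proof -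
  have "integral {0..x} f' + integral {x..y} f' = integral {0..y} f'"
    using assms by (intro Henstock_Kurzweil_Integration.integral_combine has_density_integrable[OF assms(1)]) auto
  moreover have "f x = f 0 + integral {0..x} f'" "f y = f 0 + integral {0..y} f'"
    using assms by (auto intro: has_densityD)
  ultimately show ?thesis by simp
qed

lemma continuous_on_atLeastI:
  fixes f :: "real \<Rightarrow> real"
  assumes "\<And>N. continuous_on {a..N} f"
  shows "continuous_on {a..} f"
  unfolding continuous_on_def
proof
  fix x assume x: "x \<in> {a..}"
  have "at x within {a..} = at x within {a..x + 1}"
    by (rule at_within_nhd[where S="{..<x + 1}"]) auto
  then show "(f \<longlongrightarrow> f x) (at x within {a..})"
    using assms[of "x + 1"] x by (auto simp: continuous_on_def)
qed

lemma has_density_continuous: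
  assumes "has_density f f'"
  shows "continuous_on {0..} f"
proof (rule continuous_on_atLeastI)
  fix N
  have "continuous_on {0..N} (\<lambda>x. f 0 + integral {0..x} f')"
    by (intro continuous_intros indefinite_integral_continuous_1 has_density_integrable[OF assms]) auto
  then show "continuous_on {0..N} f"
    by (rule continuous_on_eq) (auto intro: has_densityD(2)[OF assms, symmetric])
qed

lemma has_density_measurable:
  assumes "has_density f f'"
  shows "f \<in> borel_measurable (lebesgue_on {0..N})"
  using has_density_continuous[OF assms]
  by (intro continuous_imp_measurable_on_sets_lebesgue) (auto intro: continuous_on_subset)

lemma has_density_bounded:
  assumes "has_density f f'"
  shows "bounded (f ` {0..N})"
  using has_density_continuous[OF assms]
  by (intro compact_imp_bounded compact_continuous_image) (auto intro: continuous_on_subset)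

lemma has_density_C1:
  assumes "\<And>x. 0 \<le> x \<Longrightarrow> (f has_real_derivative f' x) (at x)" "continuous_on {0..} f'"
  shows "has_density f f'"
proof (rule has_densityI)
  show "f' absolutely_integrable_on {0..N}" for N
    by (rule absolutely_integrable_continuous_real) (use assms(2) in \<open>auto intro: continuous_on_subset\<close>)
  fix x :: real assume "0 \<le> x"
  then have "(f' has_integral f x - f 0) {0..x}"
    using assms(1) by (intro fundamental_theorem_of_calculus)
      (auto simp: has_real_derivative_iff_has_vector_derivative[symmetric] intro: has_field_derivative_at_within)
  then show "f x = f 0 + integral {0..x} f'" by (simp add: integral_unique)
qed

text \<open>Partition \<open>{0..N}\<close> finely: the increments of \<open>h\<close> are quadratic in those of \<open>A\<close>, whose sum telescopes.\<close>

lemma quadratic_increments_imp_constant: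
  fixes h A :: "real \<Rightarrow> real"
  assumes "0 \<le> N" and cont: "continuous_on {0..N} A"
    and bound: "\<And>x y. 0 \<le> x \<Longrightarrow> x \<le> y \<Longrightarrow> y \<le> N \<Longrightarrow> A x \<le> A y \<and> \<bar>h y - h x\<bar> \<le> (A y - A x)\<^sup>2"
  shows "h N = h 0"
proof -
  have small: "\<bar>h N - h 0\<bar> \<le> e * (A N - A 0)" if "e > 0" for e
  proof -
    have "uniformly_continuous_on {0..N} A"
      using cont by (intro compact_uniformly_continuous) auto
    then obtain d where d: "d > 0" "\<And>x y. x \<in> {0..N} \<Longrightarrow> y \<in> {0..N} \<Longrightarrow> dist y x < d \<Longrightarrow> dist (A y) (A x) < e"
      using \<open>e > 0\<close> unfolding uniformly_continuous_on_def by metis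
    obtain n :: nat where N_d: "N / d < real n" using reals_Archimedean2 by blast
    have "0 \<le> N / d" using d assms by simp
    with N_d have "0 < real n" by linarith
    with N_d d have n: "n > 0" "N / real n < d" by (auto simp: field_simps)
    define x where "x i = N * real i / real n" for i
    have x0: "x 0 = 0" "x n = N" using n by (auto simp: x_def)
    have step: "\<bar>h (x (Suc i)) - h (x i)\<bar> \<le> e * (A (x (Suc i)) - A (x i))" if "i < n" for i
    proof -
      have diff: "x (Suc i) - x i = N / real n" by (simp add: x_def field_simps add_divide_distrib)
      have "x (Suc i) \<le> N * real n / real n"
        unfolding x_def using that assms(1) by (intro divide_right_mono mult_left_mono) auto
      then have "x (Suc i) \<le> N" using n by simp
      moreover have "0 \<le> x i" using assms(1) by (simp add: x_def)
      moreover have "x i \<le> x (Suc i)" using diff assms(1) by (metis diff_ge_0_iff_ge divide_nonneg_nonneg of_nat_0_le_iff)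
      ultimately have r: "0 \<le> x i" "x i \<le> x (Suc i)" "x (Suc i) \<le> N" by auto
      from d(2)[of "x i" "x (Suc i)"] r diff n have "\<bar>A (x (Suc i)) - A (x i)\<bar> < e"
        by (auto simp: dist_real_def)
      with bound[OF r] have "(A (x (Suc i)) - A (x i))\<^sup>2 \<le> e * (A (x (Suc i)) - A (x i))"
        unfolding power2_eq_square by (intro mult_right_mono) auto
      with bound[OF r] show ?thesis by linarith
    qed
    have "h N - h 0 = (\<Sum>i<n. h (x (Suc i)) - h (x i))"
      using sum_lessThan_telescope[of "\<lambda>i. h (x i)" n] by (simp add: x0)
    then have "\<bar>h N - h 0\<bar> \<le> (\<Sum>i<n. \<bar>h (x (Suc i)) - h (x i)\<bar>)" by simp
    also have "\<dots> \<le> (\<Sum>i<n. e * (A (x (Suc i)) - A (x i)))"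
      using step by (intro sum_mono) auto
    also have "\<dots> = e * (A N - A 0)"
      using sum_lessThan_telescope[of "\<lambda>i. A (x i)" n] by (simp add: sum_distrib_left[symmetric] x0)
    finally show ?thesis .
  qed
  have A: "0 \<le> A N - A 0" using bound[of 0 N] assms(1) by simp
  have "\<bar>h N - h 0\<bar> \<le> 0 + e" if "e > 0" for e
  proof -
    \<comment> \<open>The \<open>+ 1\<close> keeps the denominator positive when \<open>A\<close>
      does not increase.\<close>
    have "\<bar>h N - h 0\<bar> \<le> e / (A N - A 0 + 1) * (A N - A 0)"
      using that A by (intro small) auto
    also have "\<dots> \<le> e" using that A by (simp add: field_simps)
    finally show ?thesis by simp
  qed
  then have "\<bar>h N - h 0\<bar> \<le> 0" by (rule field_le_epsilon)
  then show ?thesis by simp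
qed

text \<open>The product rule without differentiability. Let \<open>A\<close> be the integral of
  \<open>\<bar>f'\<bar> + \<bar>g'\<bar>\<close>. On \<open>{x..y}\<close> the error of
  \<open>f * g\<close> against the integral of \<open>w\<close> is an integral of \<open>f'\<close>
  and \<open>g'\<close> times increments of \<open>g\<close> and \<open>f\<close>, hence at most the
  square of the increment of \<open>A\<close>, and such errors add up to 0.\<close>

lemma has_density_mult:
  assumes f: "has_density f f'" and g: "has_density g g'"
  shows "has_density (\<lambda>x. f x * g x) (\<lambda>x. f' x * g x + f x * g' x)"
proof -
  have int: "(\<lambda>x. f x * g' x) absolutely_integrable_on {0..N}" "(\<lambda>x. f' x * g x) absolutely_integrable_on {0..N}" for N
    using absolutely_integrable_bounded_measurable_product_real[OF has_density_measurable[OF f] _ has_density_bounded[OF f], of N g']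
      absolutely_integrable_bounded_measurable_product_real[OF has_density_measurable[OF g] _ has_density_bounded[OF g], of N f']
      has_density_integrable[OF f, of 0 N] has_density_integrable[OF g, of 0 N]
    by (auto simp: mult.commute)
  define w where "w = (\<lambda>x. f' x * g x + f x * g' x)"
  have w: "w absolutely_integrable_on {0..N}" for N
    unfolding w_def using int by (intro set_integral_add) auto
  define A where "A x = integral {0..x} (\<lambda>t. \<bar>f' t\<bar> + \<bar>g' t\<bar>)" for x
  have dA: "has_density A (\<lambda>t. \<bar>f' t\<bar> + \<bar>g' t\<bar>)"
  proof (rule has_densityI)
    show "(\<lambda>t. \<bar>f' t\<bar> + \<bar>g' t\<bar>) absolutely_integrable_on {0..N}" for N
      using has_densityD(1)[OF f, of N] has_densityD(1)[OF g, of N]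
      by (intro set_integral_add set_integrable_abs) auto
  qed (simp add: A_def)
  have dW: "has_density (\<lambda>x. integral {0..x} w) w"
    using w by (intro has_densityI) auto
  have "f N * g N - integral {0..N} w = f 0 * g 0 - integral {0..0} w" if N: "N \<ge> 0" for N
  proof (rule quadratic_increments_imp_constant[OF N, where A=A])
    show "continuous_on {0..N} A"
      using has_density_continuous[OF dA] by (rule continuous_on_subset) auto
    fix x y assume xy: "0 \<le> x" "x \<le> y" "y \<le> N"
    have ints: "f' integrable_on {x..y}" "g' integrable_on {x..y}" "w integrable_on {x..y}"
       "(\<lambda>t. \<bar>f' t\<bar> + \<bar>g' t\<bar>) integrable_on {x..y}"
      using has_density_integrable(2)[OF f xy(1)] has_density_integrable(2)[OF g xy(1)]
        has_density_integrable(2)[OF dA xy(1)] has_density_integrable(2)[OF dW xy(1)] by auto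
    have bnd: "\<bar>f t - f s\<bar> \<le> A y - A x \<and> \<bar>g t - g s\<bar> \<le> A y - A x" if "x \<le> s" "s \<le> t" "t \<le> y" for s t
    proof -
      have st: "0 \<le> s" using xy that by simp
      have "\<bar>f t - f s\<bar> \<le> A t - A s" "\<bar>g t - g s\<bar> \<le> A t - A s"
        unfolding has_density_diff[OF f st that(2)] has_density_diff[OF g st that(2)] has_density_diff[OF dA st that(2)]
        by (auto intro!: Henstock_Kurzweil_Integration.integral_norm_bound_integral[where 'n=real and 'a=real, simplified real_norm_def]
           has_density_integrable(2)[OF f st] has_density_integrable(2)[OF g st] has_density_integrable(2)[OF dA st])
      moreover have "0 \<le> A s - A x" "0 \<le> A y - A t"
        using that xy by (auto simp: has_density_diff[OF dA] intro!: Henstock_Kurzweil_Integration.integral_nonneg has_density_integrable(2)[OF dA])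
      ultimately show ?thesis by linarith
    qed
    have A_xy: "A y - A x = integral {x..y} (\<lambda>t. \<bar>f' t\<bar> + \<bar>g' t\<bar>)"
      using xy by (simp add: has_density_diff[OF dA])
    have A0: "0 \<le> A y - A x"
      unfolding A_xy using ints by (intro Henstock_Kurzweil_Integration.integral_nonneg) auto
    have "(f y * g y - integral {0..y} w) - (f x * g x - integral {0..x} w)
      = (f y - f x) * g y + f x * (g y - g x) - (integral {0..y} w - integral {0..x} w)"
      by (simp add: algebra_simps)
    also have "\<dots> = integral {x..y} f' * g y + f x * integral {x..y} g' - integral {x..y} w"
      using xy by (simp add: has_density_diff[OF f] has_density_diff[OF g] has_density_diff[OF dW])
    also have "\<dots> = integral {x..y} (\<lambda>t. f' t * g y + f x * g' t - w t)"
    proof (rule integral_unique[symmetric])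
      show "((\<lambda>t. f' t * g y + f x * g' t - w t) has_integral integral {x..y} f' * g y + f x * integral {x..y} g' - integral {x..y} w) {x..y}"
        using ints by (intro has_integral_diff has_integral_add has_integral_mult_left has_integral_mult_right integrable_integral)
    qed
    also have "\<bar>\<dots>\<bar> \<le> integral {x..y} (\<lambda>t. (\<bar>f' t\<bar> + \<bar>g' t\<bar>) * (A y - A x))"
    proof (rule Henstock_Kurzweil_Integration.integral_norm_bound_integral[where 'n=real and 'a=real, simplified real_norm_def])
      show "(\<lambda>t. f' t * g y + f x * g' t - w t) integrable_on {x..y}"
        using ints by (intro integrable_diff integrable_add integrable_on_mult_left integrable_on_mult_right)
      show "(\<lambda>t. (\<bar>f' t\<bar> + \<bar>g' t\<bar>) * (A y - A x)) integrable_on {x..y}"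
        using ints by (intro integrable_on_mult_left)
      fix t assume t: "t \<in> {x..y}"
      have "f' t * g y + f x * g' t - w t = f' t * (g y - g t) + g' t * (f x - f t)"
        by (simp add: w_def algebra_simps)
      also have "\<bar>\<dots>\<bar> \<le> \<bar>f' t\<bar> * \<bar>g y - g t\<bar> + \<bar>g' t\<bar> * \<bar>f t - f x\<bar>"
        by (rule order_trans[OF abs_triangle_ineq]) (simp add: abs_mult abs_minus_commute)
      also have "\<dots> \<le> \<bar>f' t\<bar> * (A y - A x) + \<bar>g' t\<bar> * (A y - A x)"
        using bnd[of t y] bnd[of x t] t by (intro add_mono mult_left_mono) auto
      finally show "\<bar>f' t * g y + f x * g' t - w t\<bar> \<le> (\<bar>f' t\<bar> + \<bar>g' t\<bar>) * (A y - A x)"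
        by (simp add: algebra_simps)
    qed
    also have "\<dots> = (A y - A x)\<^sup>2"
      unfolding A_xy power2_eq_square by (rule Henstock_Kurzweil_Integration.integral_mult_left)
    finally show "A x \<le> A y \<and> \<bar>(f y * g y - integral {0..y} w) - (f x * g x - integral {0..x} w)\<bar> \<le> (A y - A x)\<^sup>2"
      using A0 by simp
  qed
  then have eq: "f x * g x = f 0 * g 0 + integral {0..x} w" if "0 \<le> x" for x
    using that by fastforce
  show ?thesis
    unfolding w_def[symmetric] by (rule has_densityI[OF w eq])
qed

section \<open>Integrals over the whole half line\<close>

lemma set_integrable_half_line_iff:
  fixes f :: "real \<Rightarrow> real"
  shows "integrable half_line f \<longleftrightarrow> f absolutely_integrable_on {0..}"
proof -
  have "integrable half_line f \<longleftrightarrow> f absolutely_integrable_on {0<..}"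
    by (simp add: set_integrable_def integrable_restrict_space)
  also have "\<dots> \<longleftrightarrow> f absolutely_integrable_on {0..}"
    by (rule absolutely_integrable_spike_set_eq) (rule negligible_subset[of "{0}"], auto)+
  finally show ?thesis .
qed

lemma lebesgue_integral_half_line:
  fixes f :: "real \<Rightarrow> real"
  assumes "integrable half_line f"
  shows "(LINT x|half_line. f x) = integral {0..} f"
proof -
  have "(LINT x|half_line. f x) = integral {0<..} f"
    using assms by (intro lebesgue_integral_eq_integral) auto
  also have "\<dots> = integral {0..} f"
    by (rule integral_spike_set) (rule negligible_subset[of "{0}"], auto)+
  finally show ?thesis .
qed

text \<open>Otherwise \<open>\<bar>k\<bar>\<close> is at least \<open>\<bar>L\<bar> / 2\<close> on a
  ray, which has infinite measure.\<close>

lemma integrable_half_line_limit_0: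
  fixes k :: "real \<Rightarrow> real"
  assumes k: "integrable half_line k" and lim: "(k \<longlongrightarrow> L) at_top"
  shows "L = 0"
proof (rule ccontr)
  assume "L \<noteq> 0"
  then have "\<forall>\<^sub>F x in at_top. dist (k x) L < \<bar>L\<bar> / 2" using lim by (intro tendstoD) auto
  then obtain X0 where X0: "\<And>x. x \<ge> X0 \<Longrightarrow> dist (k x) L < \<bar>L\<bar> / 2" by (auto simp: eventually_at_top_linorder)
  define X where "X = max X0 0"
  have X: "\<bar>L\<bar> / 2 \<le> \<bar>k x\<bar>" "0 \<le> X" if "x \<in> {X..}" for x
    using X0[of x] that by (auto simp: X_def dist_real_def abs_if split: if_splits)
  have "k absolutely_integrable_on {X..}"
    using k unfolding set_integrable_half_line_iff by (rule set_integrable_subset) (auto simp: X_def)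
  then have "(\<lambda>_. \<bar>L\<bar> / 2) absolutely_integrable_on {X..}"
    by (rule set_integrable_bound) (use X in \<open>auto simp: set_borel_measurable_def intro!: borel_measurable_divide borel_measurable_times borel_measurable_indicator\<close>)
  then have "(\<lambda>_. (2 / \<bar>L\<bar>) * (\<bar>L\<bar> / 2)) absolutely_integrable_on {X..}"
    by (intro set_integrable_mult_right)
  then have "integrable lebesgue (\<lambda>x. (indicator {X..} x :: real))"
    using \<open>L \<noteq> 0\<close> by (simp add: set_integrable_def)
  then have "emeasure lebesgue {X..} < \<infinity>"
    by (subst (asm) integrable_indicator_iff) auto
  moreover have "ennreal (real n) \<le> emeasure lebesgue {X..}" for n
  proof -
    have "emeasure lebesgue {X..X + real n} \<le> emeasure lebesgue {X..}"
      by (rule emeasure_mono) auto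
    then show ?thesis by simp
  qed
  ultimately show False
    by (metis ennreal_Ex_less_of_nat ennreal_of_nat_eq_real_of_nat infinity_ennreal_def leD)
qed

text \<open>Integrability of \<open>k'\<close> makes \<open>k\<close> converge at infinity, and
  integrability of \<open>k\<close> forces the limit to be 0; only the boundary value at 0 survives.
  Every boundary term at the node originates here.\<close>

lemma half_line_integral_density:
  assumes k: "has_density k k'" and int: "integrable half_line k" "integrable half_line k'"
  shows "(LINT x|half_line. k' x) = - k 0"
proof -
  have "((\<lambda>y. LINT x:{0..y}|lebesgue. k' x) \<longlongrightarrow> (LINT x:{0..}|lebesgue. k' x)) at_top"
    using int(2) unfolding set_integrable_half_line_iff
    by (intro tendsto_set_lebesgue_integral_at_top) auto
  also have "(LINT x:{0..}|lebesgue. k' x) = (LINT x|half_line. k' x)"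
    using int(2) by (simp add: lebesgue_integral_half_line) (simp add: set_integrable_half_line_iff set_lebesgue_integral_eq_integral(2))
  finally have "((\<lambda>y. k 0 + (LINT x:{0..y}|lebesgue. k' x)) \<longlongrightarrow> k 0 + (LINT x|half_line. k' x)) at_top"
    by (intro tendsto_intros)
  moreover have "\<forall>\<^sub>F y in at_top. k 0 + (LINT x:{0..y}|lebesgue. k' x) = k y"
  proof (rule eventually_mono[OF eventually_ge_at_top[of 0]])
    fix y :: real assume "0 \<le> y"
    then have "k y = k 0 + integral {0..y} k'" by (rule has_densityD(2)[OF k])
    then show "k 0 + (LINT x:{0..y}|lebesgue. k' x) = k y"
      using has_density_integrable(1)[OF k, of 0 y] by (simp add: set_lebesgue_integral_eq_integral(2))
  qed
  ultimately have "(k \<longlongrightarrow> k 0 + (LINT x|half_line. k' x)) at_top"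
    by (rule Lim_transform_eventually)
  from integrable_half_line_limit_0[OF int(1) this] show ?thesis by simp
qed

section \<open>Weak derivatives and traces\<close>

lemma square_integrable_rep_L2 [simp]: "square_integrable (rep_L2 u)"
  using Quotient3_rep_reflp[OF Quotient3_L2] by (simp add: L2_rel_def)

lemma abs_rep_L2 [simp]: "abs_L2 (rep_L2 u) = u"
  by (rule Quotient3_abs_rep[OF Quotient3_L2])

lemma L2_rel_refl: "square_integrable f \<Longrightarrow> L2_rel f f"
  by (simp add: L2_rel_def)

lemma rep_abs_L2:
  assumes "square_integrable f"
  shows "AE x in half_line. rep_L2 (abs_L2 f) x = f x"
proof -
  have "L2_rel (rep_L2 (abs_L2 f)) f"
    by (rule Quotient3_rep_abs[OF Quotient3_L2]) (rule L2_rel_refl[OF assms])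
  then show ?thesis by (simp add: L2_rel_def)
qed

lemma abs_L2_eqI:
  "square_integrable f \<Longrightarrow> square_integrable g \<Longrightarrow> AE x in half_line. f x = g x \<Longrightarrow> abs_L2 f = abs_L2 g"
  using Quotient3_rel_abs[OF Quotient3_L2] by (simp add: L2_rel_def)

lemma L2_eqI:
  assumes "AE x in half_line. rep_L2 u x = rep_L2 v x"
  shows "u = v"
  using abs_L2_eqI[OF square_integrable_rep_L2 square_integrable_rep_L2 assms] by simp

lemma square_integrableD:
  assumes "square_integrable f"
  shows "f \<in> borel_measurable half_line" "integrable half_line (\<lambda>x. (f x)\<^sup>2)"
  using assms by (auto simp: square_integrable_def)

lemma inner_abs_L2:
  "square_integrable f \<Longrightarrow> square_integrable g \<Longrightarrow> inner (abs_L2 f) (abs_L2 g) = (LINT x|half_line. f x * g x)"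
  by (rule inner_L2.abs_eq) (auto simp: L2_rel_refl)

lemma inner_L2_rep: "inner u v = (LINT x|half_line. rep_L2 u x * rep_L2 v x)"
  using inner_abs_L2[OF square_integrable_rep_L2 square_integrable_rep_L2, of u v] by simp

lemma abs_L2_add: "square_integrable f \<Longrightarrow> square_integrable g \<Longrightarrow> abs_L2 f + abs_L2 g = abs_L2 (\<lambda>x. f x + g x)"
  by (rule plus_L2.abs_eq) (auto simp: L2_rel_refl)

lemma abs_L2_diff: "square_integrable f \<Longrightarrow> square_integrable g \<Longrightarrow> abs_L2 f - abs_L2 g = abs_L2 (\<lambda>x. f x - g x)"
  by (rule minus_L2.abs_eq) (auto simp: L2_rel_refl)

lemma abs_L2_scaleR: "square_integrable f \<Longrightarrow> r *\<^sub>R abs_L2 f = abs_L2 (\<lambda>x. r * f x)"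
  by (rule scaleR_L2.abs_eq) (auto simp: L2_rel_refl)

lemma rep_L2_add: "AE x in half_line. rep_L2 (u + v) x = rep_L2 u x + rep_L2 v x"
  using rep_abs_L2[OF square_integrable_add[OF square_integrable_rep_L2 square_integrable_rep_L2, of u v]]
  by (simp add: abs_L2_add[symmetric])

lemma integrable_half_line_supported:
  fixes f :: "real \<Rightarrow> real"
  assumes "f absolutely_integrable_on {0..N}" "\<And>x. x > N \<Longrightarrow> f x = 0"
  shows "integrable half_line f"
proof -
  have "(\<lambda>x. indicator {0..N} x *\<^sub>R f x) = (\<lambda>x. indicator {0..} x *\<^sub>R f x)"
    using assms(2) by (auto simp: fun_eq_iff split: split_indicator)
  then show ?thesis
    using assms(1) by (simp only: set_integrable_half_line_iff set_integrable_def)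
qed

lemma continuous_measurable_half_line:
  fixes f :: "real \<Rightarrow> real"
  shows "continuous_on {0..} f \<Longrightarrow> f \<in> borel_measurable half_line"
  by (rule continuous_imp_measurable_on_sets_lebesgue) (auto elim: continuous_on_subset)

lemma square_integrable_supported:
  assumes "continuous_on {0..} f" "\<And>x. x > N \<Longrightarrow> f x = 0"
  shows "square_integrable f"
  unfolding square_integrable_def
proof
  show "f \<in> borel_measurable half_line" by (rule continuous_measurable_half_line[OF assms(1)])
  show "integrable half_line (\<lambda>x. (f x)\<^sup>2)"
  proof (rule integrable_half_line_supported)
    show "(\<lambda>x. (f x)\<^sup>2) absolutely_integrable_on {0..N}"
      by (intro absolutely_integrable_continuous_real continuous_intros continuous_on_subset[OF assms(1)]) auto
  qed (use assms in auto)
qed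

lemma square_integrable_bounded_mult:
  assumes "square_integrable f" "g \<in> borel_measurable half_line" "\<And>x. x > 0 \<Longrightarrow> \<bar>g x\<bar> \<le> B"
  shows "square_integrable (\<lambda>x. g x * f x)"
  unfolding square_integrable_def
proof
  show m: "(\<lambda>x. g x * f x) \<in> borel_measurable half_line"
    using assms square_integrableD(1) by auto
  show "integrable half_line (\<lambda>x. (g x * f x)\<^sup>2)"
  proof (rule Bochner_Integration.integrable_bound)
    show "integrable half_line (\<lambda>x. B\<^sup>2 * (f x)\<^sup>2)"
      using square_integrableD(2)[OF assms(1)] by auto
    show "AE x in half_line. norm ((g x * f x)\<^sup>2) \<le> norm (B\<^sup>2 * (f x)\<^sup>2)"
    proof (rule AE_I2)
      fix x assume "x \<in> space half_line"
      then have "\<bar>g x\<bar> \<le> B" using assms(3) by simp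
      then have "(g x)\<^sup>2 \<le> B\<^sup>2" by (metis abs_ge_zero power2_abs power_mono)
      then show "norm ((g x * f x)\<^sup>2) \<le> norm (B\<^sup>2 * (f x)\<^sup>2)"
        by (simp add: power_mult_distrib mult_right_mono)
    qed
  qed (use m in auto)
qed

lemma square_integrable_indicator_Icc: "square_integrable (indicator {a..b :: real})"
proof -
  have m: "(indicator {a..b} :: real \<Rightarrow> real) \<in> borel_measurable half_line"
    by (intro measurable_restrict_space1 borel_measurable_indicator) auto
  have sq: "(\<lambda>x. (indicator {a..b} x :: real)\<^sup>2) = indicator {a..b}"
    by (auto simp: fun_eq_iff split: split_indicator)
  have "integrable lebesgue (indicator {a..b} :: real \<Rightarrow> real)"
    by (subst integrable_indicator_iff) (auto simp: emeasure_lborel_Icc_eq)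
  then have "integrable half_line (indicator {a..b} :: real \<Rightarrow> real)"
    by (subst integrable_restrict_space) (auto intro!: integrable_mult_indicator[where f="indicator {a..b} :: real \<Rightarrow> real", simplified])
  with m show ?thesis by (simp add: square_integrable_def sq)
qed

lemma square_integrable_local:
  assumes "square_integrable f"
  shows "f absolutely_integrable_on {0..N}"
proof -
  have "(\<lambda>x. indicator {0..N} x * f x) absolutely_integrable_on {0..}"
    using square_integrable_mult[OF square_integrable_indicator_Icc assms] by (simp add: set_integrable_half_line_iff)
  moreover have "(\<lambda>x. indicator {0..} x *\<^sub>R (indicator {0..N} x * f x)) = (\<lambda>x. indicator {0..N} x *\<^sub>R f x)"
    by (auto simp: fun_eq_iff split: split_indicator)
  ultimately show ?thesis by (simp add: set_integrable_def)
qed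

lemma test_function_square_integrable:
  assumes "test_function \<eta>"
  shows "square_integrable \<eta>" "square_integrable (deriv \<eta>)"
proof -
  obtain a b where "\<forall>x. x \<notin> {a..b} \<longrightarrow> \<eta> x = 0 \<and> deriv \<eta> x = 0"
    using test_functionD(4)[OF assms] by blast
  then show "square_integrable \<eta>" "square_integrable (deriv \<eta>)"
    using test_functionD(2,3)[OF assms] by (auto intro!: square_integrable_supported[where N=b])
qed

lemma test_function_0: "test_function \<eta> \<Longrightarrow> x \<le> 0 \<Longrightarrow> \<eta> x = 0"
  using test_functionD(4)[of \<eta>] by force

lemma has_density_test_function: "test_function \<eta> \<Longrightarrow> has_density \<eta> (deriv \<eta>)"
  by (rule has_density_C1) (auto simp: test_functionD)

text \<open>Two weak derivatives differ by a function orthogonal to all bumps. This gives the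
  \<open>THE\<close> in \<open>weak_deriv\<close> its meaning.\<close>

lemma weak_deriv_unique:
  assumes "has_weak_deriv u g" "has_weak_deriv u h"
  shows "g = h"
proof (rule L2_eqI)
  have "AE x in half_line. rep_L2 g x - rep_L2 h x = 0"
  proof (rule bump_orthogonal_imp_AE_zero)
    show "(\<lambda>x. rep_L2 g x - rep_L2 h x) absolutely_integrable_on {0<..<N}" for N
      using square_integrable_local[OF square_integrable_diff[OF square_integrable_rep_L2 square_integrable_rep_L2], where N=N]
      by (rule set_integrable_subset) auto
    fix n p q :: real assume "n > 0" "0 < p"
    then have t: "test_function (bump n p q)" by (rule test_function_bump)
    note int = square_integrable_mult[OF square_integrable_rep_L2 test_function_square_integrable(1)[OF t]]
    have "(LINT x|half_line. rep_L2 u x * deriv (bump n p q) x) = - (LINT x|half_line. rep_L2 g x * bump n p q x)"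
      "(LINT x|half_line. rep_L2 u x * deriv (bump n p q) x) = - (LINT x|half_line. rep_L2 h x * bump n p q x)"
      using assms t unfolding has_weak_deriv_def by blast+
    then have "(LINT x|half_line. rep_L2 g x * bump n p q x) = (LINT x|half_line. rep_L2 h x * bump n p q x)"
      by simp
    then show "(LINT x|half_line. (rep_L2 g x - rep_L2 h x) * bump n p q x) = 0"
      using int by (simp add: left_diff_distrib)
  qed
  then show "AE x in half_line. rep_L2 g x = rep_L2 h x" by eventually_elim simp
qed

lemma weak_deriv_eqI: "has_weak_deriv u g \<Longrightarrow> weak_deriv u = g"
  unfolding weak_deriv_def using weak_deriv_unique by blast

text \<open>Integration by parts for \<open>f x * \<eta> x\<close>; the boundary term is absent
  because test functions vanish near 0.\<close>

lemma has_density_imp_weak_deriv: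
  assumes d: "has_density f f'" and f: "square_integrable f" "square_integrable f'"
  shows "has_weak_deriv (abs_L2 f) (abs_L2 f')"
  unfolding has_weak_deriv_def
proof (intro allI impI)
  fix \<eta> assume t: "test_function \<eta>"
  note sq = test_function_square_integrable[OF t]
  note int = square_integrable_mult[OF f(1) sq(1)] square_integrable_mult[OF f(2) sq(1)] square_integrable_mult[OF f(1) sq(2)]
  have "(LINT x|half_line. f' x * \<eta> x + f x * deriv \<eta> x) = - (f 0 * \<eta> 0)"
    using int by (intro half_line_integral_density has_density_mult[OF d has_density_test_function[OF t]]) auto
  then have "(LINT x|half_line. f' x * \<eta> x) + (LINT x|half_line. f x * deriv \<eta> x) = 0"
    using int test_function_0[OF t, of 0] by simp
  moreover have "(LINT x|half_line. rep_L2 (abs_L2 f) x * deriv \<eta> x) = (LINT x|half_line. f x * deriv \<eta> x)"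
  proof (rule integral_cong_AE)
    show "AE x in half_line. rep_L2 (abs_L2 f) x * deriv \<eta> x = f x * deriv \<eta> x"
      using rep_abs_L2[OF f(1)] by eventually_elim simp
  qed (use f sq in \<open>auto intro!: borel_measurable_times intro: square_integrableD(1)\<close>)
  moreover have "(LINT x|half_line. rep_L2 (abs_L2 f') x * \<eta> x) = (LINT x|half_line. f' x * \<eta> x)"
  proof (rule integral_cong_AE)
    show "AE x in half_line. rep_L2 (abs_L2 f') x * \<eta> x = f' x * \<eta> x"
      using rep_abs_L2[OF f(2)] by eventually_elim simp
  qed (use f sq in \<open>auto intro!: borel_measurable_times intro: square_integrableD(1)\<close>)
  ultimately show "(LINT x|half_line. rep_L2 (abs_L2 f) x * deriv \<eta> x) = - (LINT x|half_line. rep_L2 (abs_L2 f') x * \<eta> x)"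
    by simp
qed

text \<open>Vanishing mean is what makes the primitive from 0 vanish again to the right of the
  support, so that it is a test function.\<close>

lemma test_function_antideriv_exists:
  assumes t: "test_function f" and mean: "(LINT x|half_line. f x) = 0"
  shows "\<exists>\<eta>. test_function \<eta> \<and> deriv \<eta> = f"
proof -
  obtain a b where ab: "0 < a" "a < b" "\<And>x. x \<notin> {a..b} \<Longrightarrow> f x = 0"
    using test_functionD(4)[OF t] by blast
  have cont: "continuous_on A f" for A by (rule test_functionD(2)[OF t])
  have fi: "f integrable_on {x..y}" for x y by (intro integrable_continuous_interval cont)
  define \<eta> where "\<eta> x = integral {0..x} f" for x
  have neg: "\<eta> x = 0" if "x < a" for x
  proof -
    have "integral {0..x} f = integral {0..x} (\<lambda>_. 0)"
      using ab that by (intro Henstock_Kurzweil_Integration.integral_cong) auto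
    then show ?thesis by (simp add: \<eta>_def)
  qed
  have pos: "\<eta> x = 0" if "x > b" for x
  proof -
    have "integrable half_line f"
      using ab by (intro integrable_half_line_supported[where N=b] absolutely_integrable_continuous_real cont) auto
    then have "0 = integral {0..} f" using mean by (simp add: lebesgue_integral_half_line)
    also have "\<dots> = integral {0..x} f"
      using ab that by (intro integral_unique has_integral_on_superset[OF integrable_integral[OF fi]]) auto
    finally show ?thesis by (simp add: \<eta>_def)
  qed
  have "(\<eta> has_real_derivative f x) (at x)" for x
  proof (cases "x < a")
    case True
    have "((\<lambda>_. 0) has_real_derivative 0) (at x)" by simp
    then have "(\<eta> has_real_derivative 0) (at x)"
      by (rule has_field_derivative_transform_within_open[where S="{..<a}"]) (auto simp: True neg)
    then show ?thesis using ab(3)[of x] True by simp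
  next
    case False
    then have x: "x \<in> {0<..<x+1}" using ab by auto
    have "((\<lambda>u. integral {0..u} f) has_vector_derivative f x) (at x within {0..x+1})"
      by (rule integral_has_vector_derivative[OF cont]) (use x in auto)
    then have "((\<lambda>u. integral {0..u} f) has_vector_derivative f x) (at x within {0<..<x+1})"
      by (rule has_vector_derivative_within_subset) auto
    then show ?thesis
      using x at_within_open[OF x] by (simp add: has_real_derivative_iff_has_vector_derivative \<eta>_def[abs_def])
  qed
  moreover have "\<eta> x = 0" if "x \<notin> {a..b}" for x
    using that neg pos by (cases "x < a") auto
  ultimately show ?thesis
    using test_function_antideriv[OF _ t ab(1)] by blast
qed

lemma test_function_integrable: "test_function \<eta> \<Longrightarrow> integrable half_line \<eta>"
proof -
  assume t: "test_function \<eta>"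
  obtain a b where "\<forall>x. x \<notin> {a..b} \<longrightarrow> \<eta> x = 0" using test_functionD(4)[OF t] by blast
  then show ?thesis
    by (intro integrable_half_line_supported[where N=b] absolutely_integrable_continuous_real test_functionD(2)[OF t]) auto
qed

lemma bump_integral_pos:
  assumes "n > 0" "0 < p" "p < q"
  shows "0 < (LINT x|half_line. bump n p q x)"
proof -
  have int: "integrable half_line (bump n p q)"
    by (intro test_function_integrable test_function_bump assms)
  have "(LINT x|half_line. bump n p q x) \<noteq> 0"
  proof
    assume "(LINT x|half_line. bump n p q x) = 0"
    then have "AE x in half_line. bump n p q x = 0"
      using integral_nonneg_eq_0_iff_AE[OF int] bump_nonneg by simp
    then have "AE x in lebesgue. x \<notin> {p<..<q}"
      unfolding AE_half_line_iff using bump_pos[OF assms(1), of p _ q] assms(2)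
      by (auto elim!: eventually_mono) (metis less_irrefl less_trans)
    then have "{p<..<q} \<in> null_sets lebesgue"
      by (subst AE_iff_null_sets) auto
    then show False using assms by (simp add: null_sets_def)
  qed
  moreover have "0 \<le> (LINT x|half_line. bump n p q x)"
    by (intro Bochner_Integration.integral_nonneg bump_nonneg)
  ultimately show ?thesis by simp
qed

text \<open>The difference of \<open>rep_L2 u\<close> and a primitive \<open>G\<close> of
  \<open>g\<close> annihilates derivatives of test functions, that is, all test functions of mean 0.
  Any bump becomes one of these after subtraction of a multiple of the fixed
  \<open>bump 1 1 2\<close>, so the difference acts on every bump like one constant.\<close>

lemma weak_deriv_imp_has_density:
  assumes wd: "has_weak_deriv u g"
  shows "\<exists>f. has_density f (rep_L2 g) \<and> (AE x in half_line. rep_L2 u x = f x)"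
proof -
  define G where "G x = integral {0..x} (rep_L2 g)" for x
  have dG: "has_density G (rep_L2 g)"
    by (rule has_densityI) (auto simp: G_def square_integrable_local)
  define w where "w = (\<lambda>x. rep_L2 u x - G x)"
  have G_loc: "G absolutely_integrable_on {0..N}" for N
    by (intro absolutely_integrable_continuous_real continuous_on_subset[OF has_density_continuous[OF dG]]) auto
  have w_loc: "w absolutely_integrable_on {0..N}" for N
    unfolding w_def by (intro set_integral_diff square_integrable_local G_loc) simp
  \<comment> \<open>The primitive \<open>G\<close> need not be square-integrable; its products are
    integrable because the other factor has compact support.\<close>
  have intG: "integrable half_line (\<lambda>x. G x * \<eta> x)" if c: "continuous_on {0..} \<eta>" and z: "\<forall>x. x \<notin> {a..b} \<longrightarrow> \<eta> x = 0" for \<eta> a b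
  proof (rule integrable_half_line_supported[where N=b])
    show "(\<lambda>x. G x * \<eta> x) absolutely_integrable_on {0..b}"
      by (intro absolutely_integrable_continuous_real continuous_intros continuous_on_subset[OF c]
          continuous_on_subset[OF has_density_continuous[OF dG]]) auto
  qed (use z in auto)
  have intw: "integrable half_line (\<lambda>x. w x * \<eta> x)" "integrable half_line (\<lambda>x. G x * \<eta> x)" if t: "test_function \<eta>" for \<eta>
  proof -
    obtain a b where ab: "0 < a" "\<forall>x. x \<notin> {a..b} \<longrightarrow> \<eta> x = 0"
      using test_functionD(4)[OF t] by blast
    show 1: "integrable half_line (\<lambda>x. G x * \<eta> x)"
      by (rule intG[OF test_functionD(2)[OF t] ab(2)])
    show "integrable half_line (\<lambda>x. w x * \<eta> x)"
      using 1 square_integrable_mult[OF square_integrable_rep_L2 test_function_square_integrable(1)[OF t]]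
      by (simp add: w_def left_diff_distrib)
  qed
  have w0: "(LINT x|half_line. w x * deriv \<eta> x) = 0" if t: "test_function \<eta>" for \<eta>
  proof -
    note sq = test_function_square_integrable[OF t]
    obtain a b where ab: "\<forall>x. x \<notin> {a..b} \<longrightarrow> \<eta> x = 0 \<and> deriv \<eta> x = 0"
      using test_functionD(4)[OF t] by blast
    have i: "integrable half_line (\<lambda>x. G x * deriv \<eta> x)"
      using ab by (intro intG[where a=a and b=b] test_functionD(3)[OF t]) auto
    have "(LINT x|half_line. rep_L2 g x * \<eta> x + G x * deriv \<eta> x) = - (G 0 * \<eta> 0)"
      using intw(2)[OF t] i square_integrable_mult[OF square_integrable_rep_L2 sq(1)]
      by (intro half_line_integral_density has_density_mult[OF dG has_density_test_function[OF t]]) auto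
    then have "(LINT x|half_line. G x * deriv \<eta> x) = - (LINT x|half_line. rep_L2 g x * \<eta> x)"
      using i square_integrable_mult[OF square_integrable_rep_L2 sq(1)] test_function_0[OF t, of 0] by simp
    moreover have "(LINT x|half_line. rep_L2 u x * deriv \<eta> x) = - (LINT x|half_line. rep_L2 g x * \<eta> x)"
      using wd t unfolding has_weak_deriv_def by blast
    ultimately show ?thesis
      using i square_integrable_mult[OF square_integrable_rep_L2 sq(2)] by (simp add: w_def left_diff_distrib)
  qed
  have b0: "test_function (bump 1 1 2)" by (rule test_function_bump) auto
  define I0 where "I0 = (LINT x|half_line. bump 1 1 2 x)"
  have "I0 \<noteq> 0" using bump_integral_pos[of 1 1 2] by (simp add: I0_def)
  \<comment> \<open>The only candidate for the constant: the mean of \<open>w\<close> with respect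
    to the normalised fixed bump.\<close>
  define k where "k = (LINT x|half_line. w x * bump 1 1 2 x) / I0"
  have "AE x in half_line. w x - k = 0"
  proof (rule bump_orthogonal_imp_AE_zero)
    show "(\<lambda>x. w x - k) absolutely_integrable_on {0<..<N}" if "N > 0" for N
    proof (rule set_integrable_subset)
      show "(\<lambda>x. w x - k) absolutely_integrable_on {0..N}"
        by (intro set_integral_diff w_loc absolutely_integrable_continuous_real continuous_intros)
    qed auto
    fix n p q :: real assume "n > 0" "0 < p"
    then have t: "test_function (bump n p q)" by (rule test_function_bump)
    define I where "I = (LINT x|half_line. bump n p q x)"
    define f where "f x = 1 * bump n p q x + (- I / I0) * bump 1 1 2 x" for x
    have "test_function f" unfolding f_def by (rule test_function_lincomb[OF t b0])
    moreover have "(LINT x|half_line. f x) = 0"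
      using test_function_integrable[OF t] test_function_integrable[OF b0] \<open>I0 \<noteq> 0\<close> by (simp add: f_def I_def I0_def)
    ultimately obtain \<eta> where "test_function \<eta>" "deriv \<eta> = f"
      using test_function_antideriv_exists by blast
    then have "(LINT x|half_line. w x * f x) = 0" using w0 by blast
    moreover have "(\<lambda>x. w x * f x) = (\<lambda>x. w x * bump n p q x - (I / I0) * (w x * bump 1 1 2 x))"
      by (auto simp: f_def algebra_simps)
    ultimately have "(LINT x|half_line. w x * bump n p q x) = I * k"
      using intw(1)[OF t] intw(1)[OF b0] by (simp add: k_def)
    then show "(LINT x|half_line. (w x - k) * bump n p q x) = 0"
      using intw(1)[OF t] test_function_integrable[OF t] by (simp add: left_diff_distrib I_def)
  qed
  then have "AE x in half_line. rep_L2 u x = G x + k"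
    by eventually_elim (simp add: w_def)
  moreover have "has_density (\<lambda>x. G x + k) (rep_L2 g)"
    by (rule has_densityI) (auto simp: G_def square_integrable_local)
  ultimately show ?thesis by blast
qed

text \<open>Two continuous functions that differ at 0 differ on some \<open>{0<..<e}\<close>, which
  has positive measure. So the value at the excluded end point is determined by the class, and the
  \<open>THE\<close> in \<open>trace0\<close> is justified.\<close>

lemma continuous_AE_eq_imp_eq_0:
  fixes f g :: "real \<Rightarrow> real"
  assumes "continuous_on {0..} f" "continuous_on {0..} g" "AE x in half_line. f x = g x"
  shows "f 0 = g 0"
proof (rule ccontr)
  define d where "d x = f x - g x" for x
  assume "f 0 \<noteq> g 0"
  then have d0: "\<bar>d 0\<bar> > 0" by (simp add: d_def)
  have "continuous_on {0..} d" unfolding d_def by (intro continuous_intros assms)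
  then obtain e where e: "e > 0" "\<And>x. x \<in> {0..} \<Longrightarrow> dist x 0 < e \<Longrightarrow> dist (d x) (d 0) < \<bar>d 0\<bar>"
    using d0 unfolding continuous_on_iff by (metis atLeast_iff order_refl)
  have "AE x in lebesgue. 0 < x \<longrightarrow> d x = 0"
    using assms(3) unfolding AE_half_line_iff by eventually_elim (simp add: d_def)
  then have "AE x in lebesgue. x \<notin> {0<..<e}"
  proof eventually_elim
    case (elim x)
    then show ?case using e(2)[of x] by (auto simp: dist_real_def)
  qed
  then have "{0<..<e} \<in> null_sets lebesgue"
    by (subst AE_iff_null_sets) auto
  then show False using e(1) by (simp add: null_sets_def)
qed

text \<open>Pointwise work takes place on functions, not on classes. Here \<open>f\<close> is the
  continuous representative, whose value at 0 is the trace, while \<open>f'\<close> is any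
  representative of the weak derivative.\<close>

definition H1_rep :: "L2 \<Rightarrow> (real \<Rightarrow> real) \<Rightarrow> (real \<Rightarrow> real) \<Rightarrow> bool" where
  "H1_rep u f f' \<longleftrightarrow> has_density f f' \<and> square_integrable f \<and> square_integrable f' \<and> u = abs_L2 f"

lemma H1_repD:
  assumes "H1_rep u f f'"
  shows "has_density f f'" "square_integrable f" "square_integrable f'" "u = abs_L2 f"
    "u \<in> H1" "weak_deriv u = abs_L2 f'" "trace0 u = f 0"
proof -
  show 1: "has_density f f'" "square_integrable f" "square_integrable f'" "u = abs_L2 f"
    using assms by (auto simp: H1_rep_def)
  have wd: "has_weak_deriv u (abs_L2 f')"
    unfolding 1(4) by (rule has_density_imp_weak_deriv[OF 1(1-3)])
  then show "u \<in> H1" "weak_deriv u = abs_L2 f'"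
    by (auto simp: H1_def weak_deriv_eqI)
  have AE: "AE x in half_line. rep_L2 u x = f x" unfolding 1(4) by (rule rep_abs_L2[OF 1(2)])
  show "trace0 u = f 0"
    unfolding trace0_def
  proof (rule the_equality)
    show "\<exists>fa. continuous_on {0..} fa \<and> (AE x in half_line. rep_L2 u x = fa x) \<and> fa 0 = f 0"
      using AE has_density_continuous[OF 1(1)] by blast
    fix l assume "\<exists>fa. continuous_on {0..} fa \<and> (AE x in half_line. rep_L2 u x = fa x) \<and> fa 0 = l"
    then obtain h where h: "continuous_on {0..} h" "AE x in half_line. rep_L2 u x = h x" "h 0 = l" by blast
    have "AE x in half_line. h x = f x" using h(2) AE by eventually_elim simp
    then show "l = f 0" using continuous_AE_eq_imp_eq_0[OF h(1) has_density_continuous[OF 1(1)]] h(3) by simp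
  qed
qed

lemma square_integrable_cong_AE:
  assumes "square_integrable f" "g \<in> borel_measurable half_line" "AE x in half_line. f x = g x"
  shows "square_integrable g"
  unfolding square_integrable_def
proof
  have "integrable half_line (\<lambda>x. (f x)\<^sup>2) \<longleftrightarrow> integrable half_line (\<lambda>x. (g x)\<^sup>2)"
    using assms by (intro integrable_cong_AE) (auto intro!: borel_measurable_power intro: square_integrableD(1))
  then show "integrable half_line (\<lambda>x. (g x)\<^sup>2)" using square_integrableD(2)[OF assms(1)] by blast
qed fact

lemma H1_obtain_rep:
  assumes "u \<in> H1"
  obtains f where "H1_rep u f (rep_L2 (weak_deriv u))"
proof -
  obtain g where g: "has_weak_deriv u g" using assms by (auto simp: H1_def)
  then have wd: "weak_deriv u = g" by (rule weak_deriv_eqI)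
  obtain f where f: "has_density f (rep_L2 g)" "AE x in half_line. rep_L2 u x = f x"
    using weak_deriv_imp_has_density[OF g] by blast
  have sq: "square_integrable f"
    by (rule square_integrable_cong_AE[OF square_integrable_rep_L2 continuous_measurable_half_line[OF has_density_continuous[OF f(1)]] f(2)])
  have "u = abs_L2 f"
    using abs_L2_eqI[OF square_integrable_rep_L2 sq f(2)] by simp
  then have "H1_rep u f (rep_L2 (weak_deriv u))"
    using f sq wd by (simp add: H1_rep_def)
  then show ?thesis by (rule that)
qed

section \<open>Calculus in \<open>H1\<close>\<close>

lemma has_density_lincomb:
  assumes "has_density f f'" "has_density g g'"
  shows "has_density (\<lambda>x. r * f x + s * g x) (\<lambda>x. r * f' x + s * g' x)"
proof (rule has_densityI)
  show "(\<lambda>x. r * f' x + s * g' x) absolutely_integrable_on {0..N}" for N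
    using assms by (intro set_integral_add set_integrable_mult_right has_densityD(1))
  fix x :: real assume x: "0 \<le> x"
  have "integral {0..x} (\<lambda>x. r * f' x + s * g' x) = r * integral {0..x} f' + s * integral {0..x} g'"
    using has_density_integrable(2)[OF assms(1) order_refl, of x] has_density_integrable(2)[OF assms(2) order_refl, of x]
    by (simp add: Henstock_Kurzweil_Integration.integral_add integrable_on_mult_right)
  moreover have "f x = f 0 + integral {0..x} f'" "g x = g 0 + integral {0..x} g'"
    using assms x by (auto intro: has_densityD(2))
  ultimately show "r * f x + s * g x = r * f 0 + s * g 0 + integral {0..x} (\<lambda>x. r * f' x + s * g' x)"
    by (simp add: algebra_simps)
qed

lemma H1_rep_lincomb:
  assumes "H1_rep u f f'" "H1_rep v g g'"
  shows "H1_rep (r *\<^sub>R u + s *\<^sub>R v) (\<lambda>x. r * f x + s * g x) (\<lambda>x. r * f' x + s * g' x)"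
  unfolding H1_rep_def
proof (intro conjI has_density_lincomb square_integrable_add square_integrable_scale)
  have "u = abs_L2 f" "v = abs_L2 g" "square_integrable f" "square_integrable g"
    using assms by (simp_all add: H1_rep_def)
  then show "r *\<^sub>R u + s *\<^sub>R v = abs_L2 (\<lambda>x. r * f x + s * g x)"
    by (simp add: abs_L2_scaleR abs_L2_add square_integrable_scale)
qed (use assms in \<open>simp_all add: H1_rep_def\<close>)

lemma H1_lincomb:
  assumes "u \<in> H1" "v \<in> H1"
  shows "r *\<^sub>R u + s *\<^sub>R v \<in> H1"
    "weak_deriv (r *\<^sub>R u + s *\<^sub>R v) = r *\<^sub>R weak_deriv u + s *\<^sub>R weak_deriv v"
    "trace0 (r *\<^sub>R u + s *\<^sub>R v) = r * trace0 u + s * trace0 v"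
proof -
  obtain f where f: "H1_rep u f (rep_L2 (weak_deriv u))" using H1_obtain_rep[OF assms(1)] .
  obtain g where g: "H1_rep v g (rep_L2 (weak_deriv v))" using H1_obtain_rep[OF assms(2)] .
  note fg = f g
  note h = H1_rep_lincomb[OF fg, of r s]
  show "r *\<^sub>R u + s *\<^sub>R v \<in> H1" by (rule H1_repD(5)[OF h])
  show "weak_deriv (r *\<^sub>R u + s *\<^sub>R v) = r *\<^sub>R weak_deriv u + s *\<^sub>R weak_deriv v"
    unfolding H1_repD(6)[OF h] by (subst (3 4) abs_rep_L2[symmetric])
      (simp add: abs_L2_scaleR abs_L2_add square_integrable_scale del: abs_rep_L2)
  show "trace0 (r *\<^sub>R u + s *\<^sub>R v) = r * trace0 u + s * trace0 v"
    using H1_repD(7)[OF h] H1_repD(7)[OF fg(1)] H1_repD(7)[OF fg(2)] by simp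
qed

lemma H1_diff:
  assumes "u \<in> H1" "v \<in> H1"
  shows "u - v \<in> H1" "weak_deriv (u - v) = weak_deriv u - weak_deriv v" "trace0 (u - v) = trace0 u - trace0 v"
  using H1_lincomb[OF assms, of 1 "-1"] by simp_all

lemma H1_add:
  assumes "u \<in> H1" "v \<in> H1"
  shows "u + v \<in> H1" "weak_deriv (u + v) = weak_deriv u + weak_deriv v" "trace0 (u + v) = trace0 u + trace0 v"
  using H1_lincomb[OF assms, of 1 1] by simp_all

lemma H1_rep_zero: "H1_rep 0 (\<lambda>_. 0) (\<lambda>_. 0)"
  unfolding H1_rep_def zero_L2_def by (intro conjI has_densityI square_integrable_zero refl) simp_all

lemma H1_zero: "0 \<in> H1" "weak_deriv 0 = 0" "trace0 0 = 0"
  using H1_repD(5-7)[OF H1_rep_zero] by (simp_all add: zero_L2_def)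

lemma H1_rep_integration_by_parts:
  assumes "H1_rep u f f'" "H1_rep v g g'"
  shows "(LINT x|half_line. f' x * g x + f x * g' x) = - (f 0 * g 0)"
proof (intro half_line_integral_density has_density_mult Bochner_Integration.integrable_add)
  show "has_density f f'" "has_density g g'" by (rule H1_repD(1)[OF assms(1)], rule H1_repD(1)[OF assms(2)])
qed (intro square_integrable_mult H1_repD(2,3)[OF assms(1)] H1_repD(2,3)[OF assms(2)])+

lemma integration_by_parts_H1:
  assumes "u \<in> H1" "v \<in> H1"
  shows "inner (weak_deriv u) v + inner u (weak_deriv v) = - (trace0 u * trace0 v)"
proof -
  obtain f where f: "H1_rep u f (rep_L2 (weak_deriv u))" using H1_obtain_rep[OF assms(1)] .
  obtain g where g: "H1_rep v g (rep_L2 (weak_deriv v))" using H1_obtain_rep[OF assms(2)] .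
  note fg = f g
  let ?f' = "rep_L2 (weak_deriv u)" and ?g' = "rep_L2 (weak_deriv v)"
  have eq: "u = abs_L2 f" "v = abs_L2 g" and sq: "square_integrable f" "square_integrable g"
    using H1_repD[OF fg(1)] H1_repD[OF fg(2)] by auto
  have "inner (weak_deriv u) v = inner (abs_L2 ?f') (abs_L2 g)" "inner u (weak_deriv v) = inner (abs_L2 f) (abs_L2 ?g')"
    using eq by auto
  then have "inner (weak_deriv u) v = (LINT x|half_line. ?f' x * g x)" "inner u (weak_deriv v) = (LINT x|half_line. f x * ?g' x)"
    using sq by (auto simp: inner_abs_L2 simp del: abs_rep_L2)
  then have "inner (weak_deriv u) v + inner u (weak_deriv v) = (LINT x|half_line. ?f' x * g x + f x * ?g' x)"
    using sq by (simp add: square_integrable_mult)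
  then show ?thesis
    using H1_rep_integration_by_parts[OF fg] H1_repD(7)[OF fg(1)] H1_repD(7)[OF fg(2)] by simp
qed

lemma norm_abs_L2_sq: "square_integrable f \<Longrightarrow> (norm (abs_L2 f))\<^sup>2 = (LINT x|half_line. (f x)\<^sup>2)"
  by (simp only: power2_norm_eq_inner inner_abs_L2) (simp add: power2_eq_square)

text \<open>Since f vanishes at infinity, f(x)^2 is minus the integral of 2 f f' over the ray from
  x, and 2 |f f'| is at most f^2 + f'^2. The tail integral is a difference of the integral over the
  half line, where \<open>H1_rep_integration_by_parts\<close> has already settled infinity, and the
  one over \<open>{0..x}\<close>.\<close>

lemma H1_rep_sup_bound:
  assumes "H1_rep u f f'" "0 \<le> x"
  shows "(f x)\<^sup>2 \<le> (norm u)\<^sup>2 + (norm (weak_deriv u))\<^sup>2"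
proof -
  note h = H1_repD[OF assms(1)]
  note int = square_integrable_mult[OF h(3) h(2)] square_integrable_mult[OF h(2) h(3)]
  define w where "w = (\<lambda>x. f' x * f x + f x * f' x)"
  have w_int: "integrable half_line w" using int by (simp add: w_def)
  have wd: "has_density (\<lambda>x. f x * f x) w" unfolding w_def by (rule has_density_mult[OF h(1) h(1)])
  have w_tail: "w absolutely_integrable_on {x..}"
    using w_int unfolding set_integrable_half_line_iff by (rule set_integrable_subset) (use assms(2) in auto)
  have e_int: "integrable half_line (\<lambda>x. (f x)\<^sup>2 + (f' x)\<^sup>2)"
    using square_integrableD(2)[OF h(2)] square_integrableD(2)[OF h(3)] by simp
  then have e_abs: "(\<lambda>x. (f x)\<^sup>2 + (f' x)\<^sup>2) absolutely_integrable_on {0..}"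
    by (simp add: set_integrable_half_line_iff)
  then have e_tail: "(\<lambda>x. (f x)\<^sup>2 + (f' x)\<^sup>2) absolutely_integrable_on {x..}"
    by (rule set_integrable_subset) (use assms(2) in auto)
  have "integral {0..} w = integral {0..x} w + integral {x..} w"
  proof -
    have "integral ({0..x} \<union> {x..}) w = integral {0..x} w + integral {x..} w"
    proof (rule integral_Un)
      show "w integrable_on {0..x}" by (rule has_density_integrable(2)[OF wd order_refl])
      show "w integrable_on {x..}" by (rule set_lebesgue_integral_eq_integral(1)[OF w_tail])
      have "{0..x} \<inter> {x..} = {x}" using assms(2) by auto
      then show "negligible ({0..x} \<inter> {x..})" by simp
    qed
    moreover have "{0..x} \<union> {x..} = {0..}" using assms(2) by auto
    ultimately show ?thesis by simp
  qed
  moreover have "integral {0..} w = - (f 0 * f 0)"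
    using H1_rep_integration_by_parts[OF assms(1) assms(1)] lebesgue_integral_half_line[OF w_int] by (simp add: w_def)
  moreover have "f x * f x = f 0 * f 0 + integral {0..x} w"
    by (rule has_densityD(2)[OF wd assms(2)])
  ultimately have "(f x)\<^sup>2 = - integral {x..} w" by (simp add: power2_eq_square)
  also have "\<dots> = integral {x..} (\<lambda>x. - w x)"
    by simp
  also have "\<dots> \<le> integral {x..} (\<lambda>x. (f x)\<^sup>2 + (f' x)\<^sup>2)"
  proof (rule integral_le)
    show "(\<lambda>x. - w x) integrable_on {x..}"
      by (intro integrable_neg set_lebesgue_integral_eq_integral(1)[OF w_tail])
    show "(\<lambda>x. (f x)\<^sup>2 + (f' x)\<^sup>2) integrable_on {x..}" by (rule set_lebesgue_integral_eq_integral(1)[OF e_tail])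
    show "- w y \<le> (f y)\<^sup>2 + (f' y)\<^sup>2" for y
      using zero_le_power2[of "f y + f' y"] by (simp add: w_def power2_sum algebra_simps)
  qed
  also have "\<dots> \<le> integral {0..} (\<lambda>x. (f x)\<^sup>2 + (f' x)\<^sup>2)"
    using assms(2) set_lebesgue_integral_eq_integral(1)[OF e_tail] set_lebesgue_integral_eq_integral(1)[OF e_abs]
    by (intro integral_subset_le) auto
  also have "\<dots> = (LINT x|half_line. (f x)\<^sup>2 + (f' x)\<^sup>2)"
    by (rule lebesgue_integral_half_line[OF e_int, symmetric])
  also have "\<dots> = (norm u)\<^sup>2 + (norm (weak_deriv u))\<^sup>2"
    using square_integrableD(2)[OF h(2)] square_integrableD(2)[OF h(3)] h by (simp add: norm_abs_L2_sq)
  finally show ?thesis .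
qed

lemma H1_sup_bound:
  assumes "u \<in> H1"
  shows "AE x in half_line. (rep_L2 u x)\<^sup>2 \<le> (norm u)\<^sup>2 + (norm (weak_deriv u))\<^sup>2"
proof -
  obtain f where f: "H1_rep u f (rep_L2 (weak_deriv u))" using H1_obtain_rep[OF assms] by blast
  have "AE x in half_line. rep_L2 u x = f x"
    using rep_abs_L2[OF H1_repD(2)[OF f]] H1_repD(4)[OF f] by simp
  then show ?thesis
    unfolding AE_half_line_iff by eventually_elim (use H1_rep_sup_bound[OF f] in auto)
qed

section \<open>Multiplication of classes by bounded weights\<close>

definition bounded_weight :: "(real \<Rightarrow> real) \<Rightarrow> bool" where
  "bounded_weight \<theta> \<longleftrightarrow> \<theta> \<in> borel_measurable half_line \<and> (\<exists>B. \<forall>x>0. \<bar>\<theta> x\<bar> \<le> B)"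

definition mult_L2 :: "(real \<Rightarrow> real) \<Rightarrow> L2 \<Rightarrow> L2" where
  "mult_L2 \<theta> u = abs_L2 (\<lambda>x. \<theta> x * rep_L2 u x)"

lemma square_integrable_weight:
  assumes "bounded_weight \<theta>" "square_integrable f"
  shows "square_integrable (\<lambda>x. \<theta> x * f x)"
proof -
  obtain B where "\<forall>x>0. \<bar>\<theta> x\<bar> \<le> B" using assms(1) unfolding bounded_weight_def by blast
  then show ?thesis
    using assms by (intro square_integrable_bounded_mult[where B=B]) (simp_all add: bounded_weight_def)
qed

lemma bounded_weight_continuous:
  "continuous_on {0..} \<theta> \<Longrightarrow> (\<And>x. x > 0 \<Longrightarrow> \<bar>\<theta> x\<bar> \<le> B) \<Longrightarrow> bounded_weight \<theta>"
  unfolding bounded_weight_def by (intro conjI exI[of _ B] continuous_measurable_half_line) simp_all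

lemma mult_L2_abs:
  assumes "bounded_weight \<theta>" "square_integrable f"
  shows "mult_L2 \<theta> (abs_L2 f) = abs_L2 (\<lambda>x. \<theta> x * f x)"
  unfolding mult_L2_def
proof (rule abs_L2_eqI)
  show "AE x in half_line. \<theta> x * rep_L2 (abs_L2 f) x = \<theta> x * f x"
    using rep_abs_L2[OF assms(2)] by eventually_elim simp
qed (use assms in \<open>auto intro: square_integrable_weight\<close>)

lemma rep_mult_L2: "bounded_weight \<theta> \<Longrightarrow> AE x in half_line. rep_L2 (mult_L2 \<theta> u) x = \<theta> x * rep_L2 u x"
  unfolding mult_L2_def by (intro rep_abs_L2 square_integrable_weight) auto

lemma inner_mult_L2:
  assumes "bounded_weight \<theta>"
  shows "inner u (mult_L2 \<theta> v) = (LINT x|half_line. \<theta> x * (rep_L2 u x * rep_L2 v x))"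
    "integrable half_line (\<lambda>x. \<theta> x * (rep_L2 u x * rep_L2 v x))"
proof -
  have sq: "square_integrable (\<lambda>x. \<theta> x * rep_L2 v x)" using assms by (intro square_integrable_weight) auto
  have "inner (abs_L2 (rep_L2 u)) (mult_L2 \<theta> v) = (LINT x|half_line. rep_L2 u x * (\<theta> x * rep_L2 v x))"
    unfolding mult_L2_def using sq by (intro inner_abs_L2) auto
  then show "inner u (mult_L2 \<theta> v) = (LINT x|half_line. \<theta> x * (rep_L2 u x * rep_L2 v x))"
    by (simp add: algebra_simps)
  show "integrable half_line (\<lambda>x. \<theta> x * (rep_L2 u x * rep_L2 v x))"
    using square_integrable_mult[OF square_integrable_rep_L2[of u] sq] by (simp add: algebra_simps)
qed

lemma inner_mult_L2_commute:
  assumes "bounded_weight \<theta>"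
  shows "inner (mult_L2 \<theta> u) v = inner u (mult_L2 \<theta> v)"
proof -
  have "\<theta> x * (rep_L2 v x * rep_L2 u x) = \<theta> x * (rep_L2 u x * rep_L2 v x)" for x by simp
  then have "inner v (mult_L2 \<theta> u) = inner u (mult_L2 \<theta> v)"
    unfolding inner_mult_L2(1)[OF assms] by presburger
  then show ?thesis by (simp add: inner_commute)
qed

lemma mult_L2_add: "bounded_weight \<theta> \<Longrightarrow> mult_L2 \<theta> (u + v) = mult_L2 \<theta> u + mult_L2 \<theta> v"
proof (rule L2_eqI)
  assume \<theta>: "bounded_weight \<theta>"
  show "AE x in half_line. rep_L2 (mult_L2 \<theta> (u + v)) x = rep_L2 (mult_L2 \<theta> u + mult_L2 \<theta> v) x"
    using rep_mult_L2[OF \<theta>, of u] rep_mult_L2[OF \<theta>, of v] rep_mult_L2[OF \<theta>, of "u + v"]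
      rep_L2_add[of u v] rep_L2_add[of "mult_L2 \<theta> u" "mult_L2 \<theta> v"]
    by eventually_elim (simp add: algebra_simps)
qed

lemma mult_L2_scaleR:
  assumes "bounded_weight \<theta>"
  shows "mult_L2 \<theta> (r *\<^sub>R u) = r *\<^sub>R mult_L2 \<theta> u"
proof -
  have "mult_L2 \<theta> (r *\<^sub>R abs_L2 (rep_L2 u)) = r *\<^sub>R mult_L2 \<theta> (abs_L2 (rep_L2 u))"
    using assms by (simp add: abs_L2_scaleR mult_L2_abs square_integrable_scale square_integrable_weight
      mult.left_commute del: abs_rep_L2)
  then show ?thesis by simp
qed

lemma norm_mult_L2:
  assumes "bounded_weight \<theta>" "\<And>x. x > 0 \<Longrightarrow> \<bar>\<theta> x\<bar> \<le> B"
  shows "norm (mult_L2 \<theta> u) \<le> norm u * B"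
proof -
  have B: "0 \<le> B" using assms(2)[of 1] by simp
  have "(norm (mult_L2 \<theta> u))\<^sup>2 = (LINT x|half_line. (\<theta> x * rep_L2 u x)\<^sup>2)"
    unfolding mult_L2_def using assms(1) by (intro norm_abs_L2_sq square_integrable_weight) auto
  also have "\<dots> \<le> (LINT x|half_line. B\<^sup>2 * (rep_L2 u x)\<^sup>2)"
  proof (rule integral_mono_AE)
    show "integrable half_line (\<lambda>x. (\<theta> x * rep_L2 u x)\<^sup>2)"
      using assms(1) by (intro square_integrableD(2) square_integrable_weight) auto
    show "integrable half_line (\<lambda>x. B\<^sup>2 * (rep_L2 u x)\<^sup>2)"
      by (intro integrable_mult_right square_integrableD(2)) auto
    show "AE x in half_line. (\<theta> x * rep_L2 u x)\<^sup>2 \<le> B\<^sup>2 * (rep_L2 u x)\<^sup>2"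
    proof (rule AE_I2)
      fix x assume "x \<in> space half_line"
      then have "\<bar>\<theta> x\<bar> \<le> B" using assms(2) by simp
      then have "(\<theta> x)\<^sup>2 \<le> B\<^sup>2" by (metis abs_ge_zero power2_abs power_mono)
      then show "(\<theta> x * rep_L2 u x)\<^sup>2 \<le> B\<^sup>2 * (rep_L2 u x)\<^sup>2"
        by (simp add: power_mult_distrib mult_right_mono)
    qed
  qed
  also have "\<dots> = (norm u * B)\<^sup>2"
    using norm_abs_L2_sq[of "rep_L2 u"] by (simp add: power_mult_distrib)
  finally show ?thesis by (rule power2_le_imp_le) (use B in simp)
qed

lemma bounded_linear_mult_L2:
  assumes "bounded_weight \<theta>"
  shows "bounded_linear (mult_L2 \<theta>)"
proof -
  obtain B where B: "\<forall>x>0. \<bar>\<theta> x\<bar> \<le> B" using assms unfolding bounded_weight_def by blast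
  have "norm (mult_L2 \<theta> u) \<le> norm u * B" for u
    by (rule norm_mult_L2[OF assms]) (use B in simp)
  then show ?thesis
    by (intro bounded_linear_intro[where K=B] mult_L2_add mult_L2_scaleR assms)
qed

lemma mult_L2_1: "mult_L2 (\<lambda>_. 1) u = u" "mult_L2 (\<lambda>_. 0) u = 0"
  by (simp_all add: mult_L2_def zero_L2_def)

lemma mult_L2_H1:
  assumes \<theta>: "has_density \<theta> \<theta>'" "bounded_weight \<theta>" "bounded_weight \<theta>'" and u: "u \<in> H1"
  shows "mult_L2 \<theta> u \<in> H1" "weak_deriv (mult_L2 \<theta> u) = mult_L2 \<theta>' u + mult_L2 \<theta> (weak_deriv u)"
    "trace0 (mult_L2 \<theta> u) = \<theta> 0 * trace0 u"
proof -
  obtain f where f: "H1_rep u f (rep_L2 (weak_deriv u))" using H1_obtain_rep[OF u] by blast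
  note h = H1_repD[OF f]
  have "H1_rep (mult_L2 \<theta> u) (\<lambda>x. \<theta> x * f x) (\<lambda>x. \<theta>' x * f x + \<theta> x * rep_L2 (weak_deriv u) x)"
    unfolding H1_rep_def
  proof (intro conjI has_density_mult \<theta> h square_integrable_add square_integrable_weight)
    show "mult_L2 \<theta> u = abs_L2 (\<lambda>x. \<theta> x * f x)"
      unfolding h(4) by (rule mult_L2_abs[OF \<theta>(2) h(2)])
  qed
  note k = H1_repD[OF this]
  show "mult_L2 \<theta> u \<in> H1" by (rule k)
  show "trace0 (mult_L2 \<theta> u) = \<theta> 0 * trace0 u" using k(7) h(7) by simp
  have "mult_L2 \<theta>' (abs_L2 f) + mult_L2 \<theta> (abs_L2 (rep_L2 (weak_deriv u))) =
     abs_L2 (\<lambda>x. \<theta>' x * f x + \<theta> x * rep_L2 (weak_deriv u) x)"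
    unfolding mult_L2_abs[OF \<theta>(3) h(2)] mult_L2_abs[OF \<theta>(2) square_integrable_rep_L2]
    by (intro abs_L2_add square_integrable_weight \<theta> h)
  then show "weak_deriv (mult_L2 \<theta> u) = mult_L2 \<theta>' u + mult_L2 \<theta> (weak_deriv u)"
    using k(6) h(4) by simp
qed

lemma inner_mult_L2_nonneg:
  assumes "bounded_weight \<theta>" "\<And>x. x > 0 \<Longrightarrow> 0 \<le> \<theta> x"
  shows "0 \<le> inner u (mult_L2 \<theta> u)"
  unfolding inner_mult_L2(1)[OF assms(1)]
  by (rule integral_nonneg_AE) (use assms(2) in \<open>auto intro!: AE_I2\<close>)

text \<open>Young's inequality 2 a b \<le> a^2 + b^2 under the weight. Separate \<rho>,
  \<open>w\<close> and \<open>u\<close> cover two uses: the nonlinear term, where \<rho> is \<theta>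
  and \<open>w\<close> is dominated by \<open>u\<close>, and the term with the derivative of the
  weight, where \<open>w\<close> is \<open>u\<close> and \<rho> is dominated by \<theta>.\<close>

lemma inner_mult_L2_le:
  assumes \<theta>: "bounded_weight \<theta>" and \<rho>: "bounded_weight \<rho>"
    and le: "AE x in half_line. \<bar>\<rho> x\<bar> * \<bar>rep_L2 w x\<bar> \<le> K * \<theta> x * \<bar>rep_L2 u x\<bar>"
    and pos: "\<And>x. x > 0 \<Longrightarrow> 0 \<le> \<theta> x" "0 \<le> K"
  shows "\<bar>inner v (mult_L2 \<rho> w)\<bar> \<le> K / 2 * (inner v (mult_L2 \<theta> v) + inner u (mult_L2 \<theta> u))"
proof -
  have "\<bar>inner v (mult_L2 \<rho> w)\<bar> \<le> (LINT x|half_line. \<bar>\<rho> x * (rep_L2 v x * rep_L2 w x)\<bar>)"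
    unfolding inner_mult_L2(1)[OF \<rho>] by (rule integral_abs_bound)
  also have "\<dots> \<le> (LINT x|half_line. K / 2 * (\<theta> x * (rep_L2 v x * rep_L2 v x) + \<theta> x * (rep_L2 u x * rep_L2 u x)))"
  proof (rule integral_mono_AE)
    show "integrable half_line (\<lambda>x. \<bar>\<rho> x * (rep_L2 v x * rep_L2 w x)\<bar>)"
      by (intro integrable_abs inner_mult_L2(2)[OF \<rho>])
    show "integrable half_line (\<lambda>x. K / 2 * (\<theta> x * (rep_L2 v x * rep_L2 v x) + \<theta> x * (rep_L2 u x * rep_L2 u x)))"
      by (intro integrable_mult_right Bochner_Integration.integrable_add inner_mult_L2(2)[OF \<theta>])
    show "AE x in half_line. \<bar>\<rho> x * (rep_L2 v x * rep_L2 w x)\<bar> \<le> K / 2 * (\<theta> x * (rep_L2 v x * rep_L2 v x) + \<theta> x * (rep_L2 u x * rep_L2 u x))"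
      using le AE_space
    proof eventually_elim
      case (elim x)
      then have x: "x > 0" by simp
      have "\<bar>\<rho> x * (rep_L2 v x * rep_L2 w x)\<bar> = \<bar>rep_L2 v x\<bar> * (\<bar>\<rho> x\<bar> * \<bar>rep_L2 w x\<bar>)"
        by (simp add: abs_mult)
      also have "\<dots> \<le> \<bar>rep_L2 v x\<bar> * (K * \<theta> x * \<bar>rep_L2 u x\<bar>)"
        using elim by (intro mult_left_mono) auto
      also have "\<dots> = K * \<theta> x / 2 * (2 * \<bar>rep_L2 v x\<bar> * \<bar>rep_L2 u x\<bar>)" by simp
      also have "\<dots> \<le> K * \<theta> x / 2 * (\<bar>rep_L2 v x\<bar>\<^sup>2 + \<bar>rep_L2 u x\<bar>\<^sup>2)"
        using pos(1)[OF x] pos(2) by (intro mult_left_mono sum_squares_bound) auto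
      also have "\<dots> = K / 2 * (\<theta> x * (rep_L2 v x * rep_L2 v x) + \<theta> x * (rep_L2 u x * rep_L2 u x))"
        by (simp add: power2_eq_square algebra_simps)
      finally show ?case .
    qed
  qed
  also have "\<dots> = K / 2 * (inner v (mult_L2 \<theta> v) + inner u (mult_L2 \<theta> u))"
    using inner_mult_L2[OF \<theta>, of v v] inner_mult_L2[OF \<theta>, of u u] by simp
  finally show ?thesis .
qed

section \<open>The operator on the network\<close>

lemma integrable_exp_half_line:
  assumes "k > (0 :: real)"
  shows "integrable half_line (\<lambda>x. exp (- (k * x)))"
proof -
  have "(\<lambda>x. exp (- k * x)) integrable_on {0..}"
    by (rule integrable_on_exp_minus_to_infinity[OF assms])
  then have "(\<lambda>x. exp (- (k * x))) absolutely_integrable_on {0..}"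
    by (intro nonnegative_absolutely_integrable_1) auto
  then show ?thesis by (simp add: set_integrable_half_line_iff)
qed

lemma square_integrable_exp:
  assumes "k > 0"
  shows "square_integrable (\<lambda>x. exp (- (k * x)))"
  unfolding square_integrable_def
proof
  show "(\<lambda>x. exp (- (k * x))) \<in> borel_measurable half_line"
    by (intro continuous_measurable_half_line continuous_intros)
  have "(\<lambda>x. (exp (- (k * x)))\<^sup>2) = (\<lambda>x. exp (- (2 * k * x)))"
    by (auto simp: exp_double[symmetric] algebra_simps)
  then show "integrable half_line (\<lambda>x. (exp (- (k * x)))\<^sup>2)"
    using integrable_exp_half_line[of "2 * k"] assms by simp
qed

lemma has_density_exp: "has_density (\<lambda>x. exp (r * x)) (\<lambda>x. r * exp (r * x))"
  by (rule has_density_C1) (auto intro!: derivative_eq_intros continuous_intros)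

text \<open>The equation factors into \<open>p' = k p - \<zeta>\<close> and \<open>z' = p - k z\<close>; as \<open>\<zeta>\<close> vanishes beyond \<open>N\<close>,
  so does the solution \<open>p\<close> of the first equation that is taken here, and \<open>z\<close> decays exponentially.\<close>

lemma half_line_ode:
  assumes k: "k > 0" and \<zeta>: "square_integrable \<zeta>" "\<And>x. x > N \<Longrightarrow> \<zeta> x = 0" and N: "N \<ge> 0"
  obtains Q where "\<And>m. \<exists>z\<in>H2. trace0 z = m \<and> trace0 (weak_deriv z) = Q - k * m \<and>
      weak_deriv (weak_deriv z) = k\<^sup>2 *\<^sub>R z - abs_L2 \<zeta>"
proof -
  have dw: "(\<lambda>y. exp (- k * y) * \<zeta> y) absolutely_integrable_on {0..M}" for M
    by (intro absolutely_integrable_bounded_measurable_product_real square_integrable_local[OF \<zeta>(1)]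
        has_density_measurable[OF has_density_exp] has_density_bounded[OF has_density_exp]) auto
  define q where "q x = integral {0..x} (\<lambda>y. exp (- k * y) * \<zeta> y)" for x
  have dq: "has_density q (\<lambda>y. exp (- k * y) * \<zeta> y)"
    by (rule has_densityI[OF dw]) (simp add: q_def)
  have q_const: "q x = q N" if "x \<ge> N" for x
  proof -
    have "q x - q N = integral {N..x} (\<lambda>y. exp (- k * y) * \<zeta> y)"
      by (rule has_density_diff[OF dq N that])
    also have "\<dots> = 0"
    proof (rule integral_unique[OF has_integral_spike_finite[where S="{N}"]])
      show "((\<lambda>_. 0 :: real) has_integral 0) {N..x}" by simp
      show "exp (- k * y) * \<zeta> y = 0" if "y \<in> {N..x} - {N}" for y
        using \<zeta>(2)[of y] that by auto
    qed simp
    finally show ?thesis by simp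
  qed
  \<comment> \<open>Up to \<open>N\<close> this is \<open>exp (k * x)\<close> times the integral of
    \<open>exp (- k * y) * \<zeta> y\<close> over \<open>{x..N}\<close>: the solution of the first
    factor without the growing mode.\<close>
  define p where "p x = exp (k * x) * (q N - q x)" for x
  have d1: "has_density (\<lambda>_. 1) (\<lambda>_. 0)"
    by (rule has_density_C1) auto
  have "has_density p (\<lambda>x. (k * exp (k * x)) * (q N * 1 + (-1) * q x) + exp (k * x) * (q N * 0 + (-1) * (exp (- k * x) * \<zeta> x)))"
    using has_density_mult[OF has_density_exp[of k] has_density_lincomb[OF d1 dq, of "q N" "-1"]]
    by (simp add: p_def[abs_def])
  moreover have "(\<lambda>x. (k * exp (k * x)) * (q N * 1 + (-1) * q x) + exp (k * x) * (q N * 0 + (-1) * (exp (- k * x) * \<zeta> x))) = (\<lambda>x. k * p x - \<zeta> x)"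
    by (auto simp: p_def fun_eq_iff exp_minus field_simps)
  ultimately have dp: "has_density p (\<lambda>x. k * p x - \<zeta> x)" by simp
  have p0: "p x = 0" if "x \<ge> N" for x using q_const[OF that] by (simp add: p_def)
  have p_sq: "square_integrable p"
    using has_density_continuous[OF dp] p0 by (intro square_integrable_supported[where N=N]) auto
  define r where "r x = integral {0..x} (\<lambda>y. exp (k * y) * p y)" for x
  have "(\<lambda>y. exp (k * y) * p y) absolutely_integrable_on {0..M}" for M
    by (intro absolutely_integrable_continuous_real continuous_intros continuous_on_subset[OF has_density_continuous[OF dp]]) auto
  then have dr: "has_density r (\<lambda>y. exp (k * y) * p y)"
    by (rule has_densityI) (simp add: r_def)
  have r_const: "r x = r N" if "x \<ge> N" for x
  proof -
    have "r x - r N = integral {N..x} (\<lambda>y. exp (k * y) * p y)"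
      by (rule has_density_diff[OF dr N that])
    also have "\<dots> = integral {N..x} (\<lambda>y. 0)"
      using p0 by (intro Henstock_Kurzweil_Integration.integral_cong) auto
    finally show ?thesis by simp
  qed
  \<comment> \<open>The witness for \<open>Q\<close> is \<open>p 0\<close>, read off from z' = p - k
    z at 0. It does not depend on \<open>m\<close>, so the boundary value remains free for matching
    two half lines.\<close>
  have "\<exists>z\<in>H2. trace0 z = m \<and> trace0 (weak_deriv z) = p 0 - k * m \<and>
      weak_deriv (weak_deriv z) = k\<^sup>2 *\<^sub>R z - abs_L2 \<zeta>" for m
  proof -
    define g where "g x = m * 1 + 1 * r x" for x
    have dg: "has_density g (\<lambda>x. m * 0 + 1 * (exp (k * x) * p x))"
      unfolding g_def by (rule has_density_lincomb[OF d1 dr])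
    define z where "z x = exp (- k * x) * g x" for x
    have "has_density z (\<lambda>x. (- k * exp (- k * x)) * g x + exp (- k * x) * (m * 0 + 1 * (exp (k * x) * p x)))"
      unfolding z_def by (rule has_density_mult[OF has_density_exp dg])
    moreover have "(\<lambda>x. (- k * exp (- k * x)) * g x + exp (- k * x) * (m * 0 + 1 * (exp (k * x) * p x))) = (\<lambda>x. 1 * p x + (- k) * z x)"
      by (auto simp: z_def fun_eq_iff exp_minus field_simps)
    ultimately have dz: "has_density z (\<lambda>x. 1 * p x + (- k) * z x)" by simp
    have dz': "has_density (\<lambda>x. 1 * p x + (- k) * z x) (\<lambda>x. 1 * (k * p x - \<zeta> x) + (- k) * (1 * p x + (- k) * z x))"
      by (rule has_density_lincomb[OF dp dz])
    moreover have "(\<lambda>x. 1 * (k * p x - \<zeta> x) + (- k) * (1 * p x + (- k) * z x)) = (\<lambda>x. k\<^sup>2 * z x - \<zeta> x)"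
      by (auto simp: power2_eq_square algebra_simps)
    ultimately have dz': "has_density (\<lambda>x. 1 * p x + (- k) * z x) (\<lambda>x. k\<^sup>2 * z x - \<zeta> x)" by simp
    obtain B where B: "\<And>y. y \<in> g ` {0..N} \<Longrightarrow> \<bar>y\<bar> \<le> B"
      using has_density_bounded[OF dg, of N] unfolding bounded_iff by auto
    \<comment> \<open>Beyond \<open>N\<close> the factor \<open>g\<close> is constant, so its bound
      on \<open>{0..N}\<close> is global and \<open>z\<close> decays like
      \<open>exp (- k * x)\<close>.\<close>
    have gB: "\<bar>g x\<bar> \<le> B" if "x > 0" for x
    proof (cases "x \<le> N")
      case True
      then show ?thesis using that by (intro B imageI) auto
    next
      case False
      then have "g x = g N" using r_const[of x] by (simp add: g_def)
      then show ?thesis using N by (auto intro!: B)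
    qed
    have "square_integrable (\<lambda>x. g x * exp (- (k * x)))"
      by (rule square_integrable_bounded_mult[OF square_integrable_exp[OF k] continuous_measurable_half_line[OF has_density_continuous[OF dg]] gB])
    then have z_sq: "square_integrable z" by (simp add: z_def[abs_def] mult.commute)
    have z'_sq: "square_integrable (\<lambda>x. 1 * p x + (- k) * z x)"
      by (intro square_integrable_add square_integrable_scale p_sq z_sq)
    have z''_sq: "square_integrable (\<lambda>x. k\<^sup>2 * z x - \<zeta> x)"
      by (intro square_integrable_diff square_integrable_scale \<zeta>(1) z_sq)
    have h1: "H1_rep (abs_L2 z) z (\<lambda>x. 1 * p x + (- k) * z x)"
      unfolding H1_rep_def using dz z_sq z'_sq by blast
    have h2: "H1_rep (abs_L2 (\<lambda>x. 1 * p x + (- k) * z x)) (\<lambda>x. 1 * p x + (- k) * z x) (\<lambda>x. k\<^sup>2 * z x - \<zeta> x)"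
      unfolding H1_rep_def using dz' z'_sq z''_sq by blast
    note k1 = H1_repD(5-7)[OF h1] and k2 = H1_repD(5-7)[OF h2]
    show ?thesis
    proof (intro bexI[of _ "abs_L2 z"] conjI)
      show "abs_L2 z \<in> H2" unfolding H2_def using k1 k2 by simp
      have r0: "r 0 = 0" by (simp add: r_def)
      have z0: "z 0 = m" by (simp add: z_def g_def r0)
      show "trace0 (abs_L2 z) = m" using k1(3) z0 by simp
      show "trace0 (weak_deriv (abs_L2 z)) = p 0 - k * m" using k1(2) k2(3) z0 by simp
      have "weak_deriv (weak_deriv (abs_L2 z)) = abs_L2 (\<lambda>x. k\<^sup>2 * z x - \<zeta> x)"
        unfolding k1(2) by (rule k2(2))
      also have "\<dots> = k\<^sup>2 *\<^sub>R abs_L2 z - abs_L2 \<zeta>"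
        using z_sq \<zeta>(1) by (simp add: abs_L2_scaleR abs_L2_diff square_integrable_scale)
      finally show "weak_deriv (weak_deriv (abs_L2 z)) = k\<^sup>2 *\<^sub>R abs_L2 z - abs_L2 \<zeta>" .
    qed
  qed
  then show ?thesis by (rule that)
qed

text \<open>A sharp cutoff is enough: the explicit solution asks of its data only
  square-integrability and bounded support.\<close>

definition cutoff :: "real \<Rightarrow> real \<Rightarrow> real" where
  "cutoff N = indicator {0..N}"

lemma cutoff_weight: "bounded_weight (cutoff N)"
  unfolding bounded_weight_def cutoff_def
proof
  show "indicator {0..N} \<in> borel_measurable half_line"
    by (intro measurable_restrict_space1 borel_measurable_indicator) auto
  show "\<exists>B. \<forall>x>0. \<bar>indicator {0..N} x :: real\<bar> \<le> B" by (intro exI[of _ 1]) (auto split: split_indicator)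
qed

lemma inner_cutoff_tendsto:
  "(\<lambda>n. inner u (mult_L2 (cutoff (real n)) u)) \<longlonglongrightarrow> (norm u)\<^sup>2"
proof -
  have "(\<lambda>n. LINT x|half_line. cutoff (real n) x * (rep_L2 u x * rep_L2 u x)) \<longlonglongrightarrow> (LINT x|half_line. rep_L2 u x * rep_L2 u x)"
  proof (rule integral_dominated_convergence)
    show "integrable half_line (\<lambda>x. rep_L2 u x * rep_L2 u x)"
      by (rule square_integrable_mult) simp_all
    then show "(\<lambda>x. rep_L2 u x * rep_L2 u x) \<in> borel_measurable half_line" by blast
    show "(\<lambda>x. cutoff (real n) x * (rep_L2 u x * rep_L2 u x)) \<in> borel_measurable half_line" for n
      using inner_mult_L2(2)[OF cutoff_weight] by blast
    show "AE x in half_line. norm (cutoff (real n) x * (rep_L2 u x * rep_L2 u x)) \<le> rep_L2 u x * rep_L2 u x" for n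
      by (intro AE_I2) (auto simp: cutoff_def split: split_indicator)
    show "AE x in half_line. (\<lambda>n. cutoff (real n) x * (rep_L2 u x * rep_L2 u x)) \<longlonglongrightarrow> rep_L2 u x * rep_L2 u x"
    proof (rule AE_I2)
      fix x :: real assume x: "x \<in> space half_line"
      obtain m :: nat where m: "x < real m" using reals_Archimedean2 by blast
      have "\<forall>\<^sub>F n in sequentially. cutoff (real n) x * (rep_L2 u x * rep_L2 u x) = rep_L2 u x * rep_L2 u x"
        using eventually_ge_at_top[of m] by eventually_elim (use x m in \<open>auto simp: cutoff_def\<close>)
      then show "(\<lambda>n. cutoff (real n) x * (rep_L2 u x * rep_L2 u x)) \<longlonglongrightarrow> rep_L2 u x * rep_L2 u x"
        by (rule tendsto_eventually)
    qed
  qed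
  then show ?thesis
    by (simp only: inner_mult_L2(1)[OF cutoff_weight] power2_norm_eq_inner inner_L2_rep[of u u])
qed

lemma dom_A_subset: "dom_A \<subseteq> dom_sqrt_A"
  by (auto simp: dom_A_def dom_sqrt_A_def H2_def)

text \<open>All knowledge about \<open>S\<close> is in \<open>root\<close>. No formula for
  \<open>S\<close> is at hand, so everything concrete has to be reached through pairings with
  elements of \<open>dom_A\<close>.\<close>

locale network =
  fixes c a1 a2 :: real and S :: "H \<Rightarrow> H"
  assumes c: "0 < c" and a1: "0 < a1" and a12: "a1 < a2"
    and root: "is_positive_sqrt dom_sqrt_A S dom_A (op_A c a1 a2)"
begin

abbreviation "A \<equiv> op_A c a1 a2"

lemma a2: "0 < a2" using a1 a12 by simp

lemma sqrt_linear:
  shows "subspace dom_sqrt_A"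
    "x \<in> dom_sqrt_A \<Longrightarrow> y \<in> dom_sqrt_A \<Longrightarrow> S (x + y) = S x + S y"
    "x \<in> dom_sqrt_A \<Longrightarrow> S (r *\<^sub>R x) = r *\<^sub>R S x"
  using root unfolding is_positive_sqrt_def self_adjoint_def by blast+

lemma sqrt_zero: "S 0 = 0"
  using sqrt_linear(3)[of 0 0] subspace_0[OF sqrt_linear(1)] by simp

lemma sqrt_diff: "x \<in> dom_sqrt_A \<Longrightarrow> y \<in> dom_sqrt_A \<Longrightarrow> S (x - y) = S x - S y"
  using sqrt_linear(2)[of x "(-1) *\<^sub>R y"] sqrt_linear(3)[of y "-1"] subspace_scale[OF sqrt_linear(1), of y "-1"] by simp

lemma dom_A_subspace: "subspace dom_A"
proof -
  have eq: "dom_A = {x \<in> dom_sqrt_A. S x \<in> dom_sqrt_A}"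
    using root by (simp add: is_positive_sqrt_def)
  show ?thesis
    unfolding subspace_def eq
    using sqrt_linear subspace_0[OF sqrt_linear(1)] subspace_add[OF sqrt_linear(1)] subspace_scale[OF sqrt_linear(1)] sqrt_zero
    by auto
qed

text \<open>For \<open>z\<close> in \<open>dom_A\<close> the vector \<open>S z\<close> lies in the
  domain of \<open>S\<close> again, so \<open>S\<close> may be moved across the inner product. That
  \<open>w\<close> ranges over the whole form domain is what the duality argument in
  \<open>norm_le_sqrt\<close> relies on.\<close>

lemma sqrt_form:
  assumes "w \<in> dom_sqrt_A" "z \<in> dom_A"
  shows "inner w (A z) = inner (S w) (S z)"
proof -
  have z: "z \<in> dom_sqrt_A" "S z \<in> dom_sqrt_A" "S (S z) = A z"
    using root assms(2) unfolding is_positive_sqrt_def by blast+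
  have "\<forall>x y. (\<forall>z\<in>dom_sqrt_A. inner (S z) x = inner z y) \<longleftrightarrow> x \<in> dom_sqrt_A \<and> S x = y"
    using root unfolding is_positive_sqrt_def self_adjoint_def by blast
  then have "inner (S w) (S z) = inner w (S (S z))"
    using z assms(1) by blast
  then show ?thesis using z by simp
qed

text \<open>The quadratic form of the operator with a weight inserted. It is built from weak
  derivatives because a weight cannot be inserted into \<open>inner (S x) (S y)\<close>.\<close>

definition form :: "(real \<Rightarrow> real) \<Rightarrow> H \<Rightarrow> H \<Rightarrow> real" where
  "form \<theta> x y =
     c\<^sup>2 * inner (weak_deriv (fst x)) (mult_L2 \<theta> (weak_deriv (fst y)))
   + c\<^sup>2 * inner (weak_deriv (snd x)) (mult_L2 \<theta> (weak_deriv (snd y)))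
   + a1 * inner (fst x) (mult_L2 \<theta> (fst y)) + a2 * inner (snd x) (mult_L2 \<theta> (snd y))"

text \<open>The operator that belongs to \<open>form \<theta>\<close>, namely - c^2 (\<theta> y')' +
  a \<theta> y on each half line, with the outer derivative carried out.\<close>

definition weighted_A :: "(real \<Rightarrow> real) \<Rightarrow> (real \<Rightarrow> real) \<Rightarrow> H \<Rightarrow> H" where
  "weighted_A \<theta> \<theta>' y =
     (mult_L2 \<theta> (fst (A y)) - c\<^sup>2 *\<^sub>R mult_L2 \<theta>' (weak_deriv (fst y)),
      mult_L2 \<theta> (snd (A y)) - c\<^sup>2 *\<^sub>R mult_L2 \<theta>' (weak_deriv (snd y)))"

text \<open>The boundary terms of the two integrations by parts cancel by the transmission conditions.\<close>

lemma form_eq: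
  assumes \<theta>: "has_density \<theta> \<theta>'" "bounded_weight \<theta>" "bounded_weight \<theta>'"
    and x: "x \<in> dom_sqrt_A" and y: "y \<in> dom_A"
  shows "form \<theta> x y = inner x (weighted_A \<theta> \<theta>' y)"
proof -
  obtain x1 x2 where xe: "x = (x1, x2)" by force
  obtain y1 y2 where ye: "y = (y1, y2)" by force
  have X: "x1 \<in> H1" "x2 \<in> H1" "trace0 x1 = trace0 x2" using x by (auto simp: xe dom_sqrt_A_def)
  have Y: "weak_deriv y1 \<in> H1" "weak_deriv y2 \<in> H1" "trace0 (weak_deriv y1) + trace0 (weak_deriv y2) = 0"
    using y by (auto simp: ye dom_A_def H2_def)
  have bp: "inner (weak_deriv u) (mult_L2 \<theta> v) = - inner u (mult_L2 \<theta>' v + mult_L2 \<theta> (weak_deriv v)) - trace0 u * (\<theta> 0 * trace0 v)"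
    if "u \<in> H1" "v \<in> H1" for u v
    using integration_by_parts_H1[OF that(1) mult_L2_H1(1)[OF \<theta> that(2)]]
    by (simp add: mult_L2_H1(2,3)[OF \<theta> that(2)])
  note M = bounded_linear.linear[OF bounded_linear_mult_L2[OF \<theta>(2)]]
  have lin: "mult_L2 \<theta> (s *\<^sub>R v - r *\<^sub>R u) = s *\<^sub>R mult_L2 \<theta> v - r *\<^sub>R mult_L2 \<theta> u" for r s u v
    by (simp add: linear_diff[OF M] linear_cmul[OF M])
  have "c\<^sup>2 * (trace0 x1 * (\<theta> 0 * trace0 (weak_deriv y1))) + c\<^sup>2 * (trace0 x2 * (\<theta> 0 * trace0 (weak_deriv y2)))
      = c\<^sup>2 * trace0 x2 * \<theta> 0 * (trace0 (weak_deriv y1) + trace0 (weak_deriv y2))"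
    unfolding X(3) by (simp add: algebra_simps)
  \<comment> \<open>Continuity of \<open>x\<close> at the node and the flux condition on
    \<open>y\<close> combine because both half lines carry the same weight at 0.\<close>
  then have bd: "c\<^sup>2 * (trace0 x1 * (\<theta> 0 * trace0 (weak_deriv y1))) + c\<^sup>2 * (trace0 x2 * (\<theta> 0 * trace0 (weak_deriv y2))) = 0"
    using Y(3) by simp
  show ?thesis
    unfolding xe ye form_def weighted_A_def op_A_def
    using bd by (simp add: bp[OF X(1) Y(1)] bp[OF X(2) Y(2)] inner_Pair lin inner_diff_right inner_add_right algebra_simps)
qed

lemma form_1_diag: "form (\<lambda>_. 1) x x =
    c\<^sup>2 * (norm (weak_deriv (fst x)))\<^sup>2 + c\<^sup>2 * (norm (weak_deriv (snd x)))\<^sup>2 + a1 * (norm (fst x))\<^sup>2 + a2 * (norm (snd x))\<^sup>2"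
  by (simp add: form_def mult_L2_1 power2_norm_eq_inner)

text \<open>The bridge from the abstract \<open>S\<close> to weak derivatives: with weight 1 the
  form is represented by \<open>A\<close> itself, and \<open>form_eq\<close> meets
  \<open>sqrt_form\<close>.\<close>

lemma norm_sqrt_sq:
  assumes "z \<in> dom_A"
  shows "(norm (S z))\<^sup>2 = form (\<lambda>_. 1) z z"
proof -
  have z: "z \<in> dom_sqrt_A" using assms dom_A_subset by blast
  have "has_density (\<lambda>_. 1) (\<lambda>_. 0)" by (rule has_density_C1) auto
  moreover have "bounded_weight (\<lambda>_. 1)" "bounded_weight (\<lambda>_. 0)"
    by (rule bounded_weight_continuous[where B=1], auto)+
  ultimately have "form (\<lambda>_. 1) z z = inner z (weighted_A (\<lambda>_. 1) (\<lambda>_. 0) z)"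
    using z assms by (intro form_eq)
  also have "weighted_A (\<lambda>_. 1) (\<lambda>_. 0) z = A z"
    by (simp add: weighted_A_def mult_L2_1)
  also have "inner z (A z) = inner (S z) (S z)" by (rule sqrt_form[OF z assms])
  finally show ?thesis by (simp add: power2_norm_eq_inner)
qed

lemma norm_le_sqrt_dom_A:
  assumes "z \<in> dom_A"
  shows "a1 * (norm z)\<^sup>2 \<le> (norm (S z))\<^sup>2"
    "c\<^sup>2 * (norm (weak_deriv (fst z)))\<^sup>2 \<le> (norm (S z))\<^sup>2" "c\<^sup>2 * (norm (weak_deriv (snd z)))\<^sup>2 \<le> (norm (S z))\<^sup>2"
proof -
  have n: "(norm z)\<^sup>2 = (norm (fst z))\<^sup>2 + (norm (snd z))\<^sup>2"
    by (simp add: power2_norm_eq_inner inner_prod_def)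
  have "a1 * (norm (snd z))\<^sup>2 \<le> a2 * (norm (snd z))\<^sup>2" using a12 by (intro mult_right_mono) auto
  moreover have "0 \<le> c\<^sup>2 * (norm (weak_deriv (fst z)))\<^sup>2" "0 \<le> c\<^sup>2 * (norm (weak_deriv (snd z)))\<^sup>2"
     "0 \<le> a1 * (norm (fst z))\<^sup>2" "0 \<le> a1 * (norm (snd z))\<^sup>2"
    using a1 by auto
  ultimately show "a1 * (norm z)\<^sup>2 \<le> (norm (S z))\<^sup>2"
    "c\<^sup>2 * (norm (weak_deriv (fst z)))\<^sup>2 \<le> (norm (S z))\<^sup>2" "c\<^sup>2 * (norm (weak_deriv (snd z)))\<^sup>2 \<le> (norm (S z))\<^sup>2"
    unfolding norm_sqrt_sq[OF assms] form_1_diag n distrib_left by linarith+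
qed

text \<open>Solve on each half line with a common boundary value \<open>m\<close>. Continuity at the
  node is then built in, and the flux condition becomes the linear equation
  \<open>(k1 + k2) * m = Q1 + Q2\<close>, solvable because \<open>k1 + k2\<close> is
  positive.\<close>

lemma range_A:
  assumes "square_integrable \<zeta>1" "square_integrable \<zeta>2" "\<And>x. x > N \<Longrightarrow> \<zeta>1 x = 0" "\<And>x. x > N \<Longrightarrow> \<zeta>2 x = 0" "N \<ge> 0"
  shows "\<exists>z\<in>dom_A. A z = (abs_L2 \<zeta>1, abs_L2 \<zeta>2)"
proof -
  \<comment> \<open>Divided by c^2, the equation - c^2 z'' + a z = \<zeta> reads z'' = k^2 z -
    \<zeta> / c^2 with k = sqrt a / c.\<close>
  define k1 k2 where "k1 = sqrt a1 / c" and "k2 = sqrt a2 / c"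
  have k: "k1 > 0" "k2 > 0" "c\<^sup>2 * k1\<^sup>2 = a1" "c\<^sup>2 * k2\<^sup>2 = a2"
    using a1 a2 c by (auto simp: k1_def k2_def power_divide)
  have sq: "square_integrable (\<lambda>x. (1 / c\<^sup>2) * \<zeta>1 x)" "square_integrable (\<lambda>x. (1 / c\<^sup>2) * \<zeta>2 x)"
    by (intro square_integrable_scale assms)+
  obtain Q1 where Q1: "\<And>m. \<exists>z\<in>H2. trace0 z = m \<and> trace0 (weak_deriv z) = Q1 - k1 * m \<and>
      weak_deriv (weak_deriv z) = k1\<^sup>2 *\<^sub>R z - abs_L2 (\<lambda>x. (1 / c\<^sup>2) * \<zeta>1 x)"
    by (rule half_line_ode[OF k(1) sq(1), of N]) (use assms in auto)
  obtain Q2 where Q2: "\<And>m. \<exists>z\<in>H2. trace0 z = m \<and> trace0 (weak_deriv z) = Q2 - k2 * m \<and>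
      weak_deriv (weak_deriv z) = k2\<^sup>2 *\<^sub>R z - abs_L2 (\<lambda>x. (1 / c\<^sup>2) * \<zeta>2 x)"
    by (rule half_line_ode[OF k(2) sq(2), of N]) (use assms in auto)
  define m where "m = (Q1 + Q2) / (k1 + k2)"
  have "(k1 + k2) * m = Q1 + Q2" using k by (simp add: m_def)
  then have m: "k1 * m + k2 * m = Q1 + Q2" by (simp only: distrib_right)
  obtain z1 where z1: "z1 \<in> H2" "trace0 z1 = m" "trace0 (weak_deriv z1) = Q1 - k1 * m"
    "weak_deriv (weak_deriv z1) = k1\<^sup>2 *\<^sub>R z1 - abs_L2 (\<lambda>x. (1 / c\<^sup>2) * \<zeta>1 x)" using Q1[of m] by blast
  obtain z2 where z2: "z2 \<in> H2" "trace0 z2 = m" "trace0 (weak_deriv z2) = Q2 - k2 * m"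
    "weak_deriv (weak_deriv z2) = k2\<^sup>2 *\<^sub>R z2 - abs_L2 (\<lambda>x. (1 / c\<^sup>2) * \<zeta>2 x)" using Q2[of m] by blast
  have "(z1, z2) \<in> dom_A" using z1 z2 m by (simp add: dom_A_def)
  moreover have "A (z1, z2) = (abs_L2 \<zeta>1, abs_L2 \<zeta>2)"
  proof -
    have "abs_L2 (\<lambda>x. (1 / c\<^sup>2) * \<zeta>1 x) = (1 / c\<^sup>2) *\<^sub>R abs_L2 \<zeta>1" "abs_L2 (\<lambda>x. (1 / c\<^sup>2) * \<zeta>2 x) = (1 / c\<^sup>2) *\<^sub>R abs_L2 \<zeta>2"
      using assms by (simp_all only: abs_L2_scaleR)
    then show ?thesis
      unfolding op_A_def using z1(4) z2(4) k c by (simp add: scaleR_diff_right)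
  qed
  ultimately show ?thesis by blast
qed

text \<open>Since the range of \<open>A\<close> contains all compactly supported data, the lower bound of \<open>A\<close> on its
  domain extends to the form domain, without an appeal to the spectral theorem.\<close>

lemma norm_le_sqrt:
  assumes w: "w \<in> dom_sqrt_A"
  shows "sqrt a1 * norm w \<le> norm (S w)"
proof -
  have cut: "a1 * (inner (fst w) (mult_L2 (cutoff (real n)) (fst w)) + inner (snd w) (mult_L2 (cutoff (real n)) (snd w))) \<le> (norm (S w))\<^sup>2" for n
  proof -
    \<comment> \<open>Duality: solve A z = \<zeta> for the truncation \<zeta> of \<open>w\<close>.
      Then \<open>(norm \<zeta>)\<^sup>2 = inner w (A z) = inner (S w) (S z)\<close>, and the bound
      known on \<open>dom_A\<close> gives
      \<open>a1 * (norm (S z))\<^sup>2 \<le> (norm \<zeta>)\<^sup>2\<close>; Cauchy-Schwarz combines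
      the two.\<close>
    define \<zeta> where "\<zeta> = (mult_L2 (cutoff (real n)) (fst w), mult_L2 (cutoff (real n)) (snd w))"
    have "\<exists>z\<in>dom_A. A z = \<zeta>"
      unfolding \<zeta>_def mult_L2_def
      by (rule range_A[where N="real n"]) (auto simp: cutoff_def intro!: square_integrable_weight[OF cutoff_weight, unfolded cutoff_def])
    then obtain z where z: "z \<in> dom_A" "A z = \<zeta>" by blast
    have idem: "mult_L2 (cutoff (real n)) (mult_L2 (cutoff (real n)) u) = mult_L2 (cutoff (real n)) u" for u
    proof (rule L2_eqI)
      show "AE x in half_line. rep_L2 (mult_L2 (cutoff (real n)) (mult_L2 (cutoff (real n)) u)) x = rep_L2 (mult_L2 (cutoff (real n)) u) x"
        using rep_mult_L2[OF cutoff_weight[of "real n"], of u] rep_mult_L2[OF cutoff_weight[of "real n"], of "mult_L2 (cutoff (real n)) u"]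
        by eventually_elim (auto simp: cutoff_def split: split_indicator)
    qed
    have self: "inner (mult_L2 (cutoff (real n)) u) (mult_L2 (cutoff (real n)) u) = inner u (mult_L2 (cutoff (real n)) u)" for u
      using inner_mult_L2_commute[OF cutoff_weight, of "real n" u "mult_L2 (cutoff (real n)) u"] idem by simp
    have w\<zeta>: "inner w \<zeta> = (norm \<zeta>)\<^sup>2"
      by (simp add: \<zeta>_def power2_norm_eq_inner inner_prod_def self)
    have "(norm (S z))\<^sup>2 = inner z \<zeta>"
      using sqrt_form[OF _ z(1), of z] z dom_A_subset by (auto simp: power2_norm_eq_inner)
    also have "\<dots> \<le> norm z * norm \<zeta>" by (rule norm_cauchy_schwarz)
    finally have "(norm (S z))\<^sup>2 \<le> norm z * norm \<zeta>" .
    then have "a1 * (norm (S z))\<^sup>2 * (norm (S z))\<^sup>2 \<le> a1 * (norm z * norm \<zeta>) * (norm z * norm \<zeta>)"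
      using a1 by (intro mult_mono) auto
    also have "\<dots> = (a1 * (norm z)\<^sup>2) * (norm \<zeta>)\<^sup>2" by (simp add: power2_eq_square)
    also have "\<dots> \<le> (norm (S z))\<^sup>2 * (norm \<zeta>)\<^sup>2"
      using norm_le_sqrt_dom_A(1)[OF z(1)] by (intro mult_right_mono) auto
    finally have "a1 * (norm (S z))\<^sup>2 * (norm (S z))\<^sup>2 \<le> (norm \<zeta>)\<^sup>2 * (norm (S z))\<^sup>2"
      by (simp only: mult.commute)
    then have Sz: "a1 * (norm (S z))\<^sup>2 \<le> (norm \<zeta>)\<^sup>2"
      by (cases "norm (S z) = 0") simp_all
    have "(norm \<zeta>)\<^sup>2 = inner (S w) (S z)"
      using sqrt_form[OF w z(1)] z w\<zeta> by simp
    also have "\<dots> \<le> norm (S w) * norm (S z)" by (rule norm_cauchy_schwarz)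
    finally have "a1 * ((norm \<zeta>)\<^sup>2 * (norm \<zeta>)\<^sup>2) \<le> a1 * ((norm (S w) * norm (S z)) * (norm (S w) * norm (S z)))"
      using a1 by (intro mult_left_mono mult_mono) auto
    also have "\<dots> = (norm (S w))\<^sup>2 * (a1 * (norm (S z))\<^sup>2)" by (simp add: power2_eq_square)
    also have "\<dots> \<le> (norm (S w))\<^sup>2 * (norm \<zeta>)\<^sup>2" using Sz by (intro mult_left_mono) auto
    finally have "(a1 * (norm \<zeta>)\<^sup>2) * (norm \<zeta>)\<^sup>2 \<le> (norm (S w))\<^sup>2 * (norm \<zeta>)\<^sup>2" by (simp add: mult.assoc)
    then have "a1 * (norm \<zeta>)\<^sup>2 \<le> (norm (S w))\<^sup>2"
      by (cases "norm \<zeta> = 0") auto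
    then show ?thesis
      by (simp add: \<zeta>_def power2_norm_eq_inner inner_prod_def self)
  qed
  \<comment> \<open>The bound is uniform in the truncation and survives its removal.\<close>
  have "(\<lambda>n. a1 * (inner (fst w) (mult_L2 (cutoff (real n)) (fst w)) + inner (snd w) (mult_L2 (cutoff (real n)) (snd w)))) \<longlonglongrightarrow> a1 * ((norm (fst w))\<^sup>2 + (norm (snd w))\<^sup>2)"
    by (intro tendsto_intros inner_cutoff_tendsto)
  then have "a1 * ((norm (fst w))\<^sup>2 + (norm (snd w))\<^sup>2) \<le> (norm (S w))\<^sup>2"
    by (rule LIMSEQ_le_const2) (use cut in auto)
  then have "(sqrt a1 * norm w)\<^sup>2 \<le> (norm (S w))\<^sup>2"
    using a1 by (simp add: power_mult_distrib power2_norm_eq_inner inner_prod_def)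
  then show ?thesis by (rule power2_le_imp_le) simp
qed

end

section \<open>Weighted energy\<close>

lemma test_function_deriv:
  assumes "test_function \<eta>"
  shows "test_function (deriv \<eta>)"
proof -
  obtain a b where ab: "0 < a" "\<forall>x. x \<notin> {a..b} \<longrightarrow> \<eta> x = 0 \<and> deriv \<eta> x = 0"
    using test_functionD(4)[OF assms] by blast
  have "(deriv ^^ n) (deriv \<eta>) differentiable (at x)" for n x
  proof -
    have "(deriv ^^ Suc n) \<eta> differentiable (at x)" using assms unfolding test_function_def by blast
    then show ?thesis by (simp only: funpow_Suc_right o_apply)
  qed
  then show ?thesis unfolding test_function_def using ab by blast
qed

lemma H1_rep_test_function: "test_function \<eta> \<Longrightarrow> H1_rep (abs_L2 \<eta>) \<eta> (deriv \<eta>)"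
  unfolding H1_rep_def by (intro conjI has_density_test_function test_function_square_integrable refl)

lemma test_function_H2:
  assumes "test_function \<eta>"
  shows "abs_L2 \<eta> \<in> H2" "trace0 (abs_L2 \<eta>) = 0" "trace0 (weak_deriv (abs_L2 \<eta>)) = 0"
  using H1_repD(5-7)[OF H1_rep_test_function[OF assms]]
    H1_repD(5-7)[OF H1_rep_test_function[OF test_function_deriv[OF assms]]]
    test_function_0[OF assms, of 0] test_function_0[OF test_function_deriv[OF assms], of 0]
  by (simp_all add: H2_def)

text \<open>Take the primitive of a bump on (1, 2) minus a bump on (3, 4), each multiplied by the
  integral of the other. It climbs, is constant on [2, 3], and returns to 0 because the mean
  vanishes.\<close>

lemma plateau_test_function: "\<exists>\<eta>. test_function \<eta> \<and> (\<forall>x\<in>{2..3}. \<eta> x = 1)"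
proof -
  define I J where "I = (LINT x|half_line. bump 1 1 2 x)" and "J = (LINT x|half_line. bump 1 3 4 x)"
  have pos: "I > 0" "J > 0" unfolding I_def J_def by (rule bump_integral_pos; simp)+
  have t: "test_function (bump 1 1 2)" "test_function (bump 1 3 4)" by (rule test_function_bump; simp)+
  define f where "f x = J * bump 1 1 2 x + (- I) * bump 1 3 4 x" for x
  have "test_function f" unfolding f_def by (rule test_function_lincomb[OF t])
  moreover have "(LINT x|half_line. f x) = 0"
    using t[THEN test_function_integrable] by (simp add: f_def I_def J_def)
  ultimately obtain g where g: "test_function g" "deriv g = f"
    using test_function_antideriv_exists by blast
  have dg: "(g has_real_derivative f x) (at x)" for x using test_functionD(1)[OF g(1)] g(2) by simp
  have const: "g y = g x" if "x < y" "\<And>z. x < z \<Longrightarrow> z < y \<Longrightarrow> f z = 0" for x y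
  proof (rule DERIV_isconst_end[OF that(1) test_functionD(2)[OF g(1)]])
    fix z assume "x < z" "z < y"
    then show "DERIV g z :> 0" using dg[of z] that(2)[of z] by simp
  qed
  have "g 1 < g 2"
  proof (rule DERIV_pos_imp_increasing_open[where f=g and a=1 and b=2])
    show "\<exists>y. DERIV g x :> y \<and> 0 < y" if "1 < x" "x < 2" for x
      using dg[of x] bump_pos[of 1 1 x 2] bump_support[of 1 x 3 4] pos that by (intro exI[of _ "f x"]) (simp add: f_def)
  qed (auto intro: test_functionD(2)[OF g(1)])
  moreover have "g 1 = g 0"
    by (rule const) (simp_all add: f_def bump_support)
  ultimately have g2: "g 2 > 0" using test_function_0[OF g(1), of 0] by simp
  have const2: "g x = g 2" if "x \<in> {2..3}" for x
  proof (cases "x = 2")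
    case False
    then show ?thesis using that by (intro const) (simp_all add: f_def bump_support)
  qed simp
  have "1 / g 2 * g x + 0 * g x = 1" if "x \<in> {2..3}" for x
    unfolding const2[OF that] using g2 by simp
  then show ?thesis using test_function_lincomb[OF g(1) g(1), of "1 / g 2" 0] by blast
qed

lemma energy_norm_eq: "energy_norm S (u, v) = norm (S u, v)"
  by (simp add: energy_norm_def norm_Pair)

lemma H0L_E:
  assumes "H0L S F"
  obtains C :: "real \<Rightarrow> real \<Rightarrow> real" where
    "\<And>p p' q q'. 0 \<le> p \<Longrightarrow> p \<le> p' \<Longrightarrow> 0 \<le> q \<Longrightarrow> q \<le> q' \<Longrightarrow> C p q \<le> C p' q'"
    "\<And>\<phi> \<psi>. \<phi> \<in> dom_gen \<Longrightarrow> \<psi> \<in> dom_gen \<Longrightarrow>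
         energy_norm S (J F \<phi> - J F \<psi>) \<le> C (energy_norm S \<phi>) (energy_norm S \<psi>) * energy_norm S (\<phi> - \<psi>)"
proof -
  obtain C :: "real \<Rightarrow> real \<Rightarrow> real" where
    C: "\<forall>p p' q q'. 0 \<le> p \<and> p \<le> p' \<and> 0 \<le> q \<and> q \<le> q' \<longrightarrow> C p q \<le> C p' q'"
      "\<forall>\<phi>\<in>dom_gen. \<forall>\<psi>\<in>dom_gen.
         energy_norm S (J F \<phi> - J F \<psi>) \<le> C (energy_norm S \<phi>) (energy_norm S \<psi>) * energy_norm S (\<phi> - \<psi>)"
    using assms unfolding H0L_def by (elim exE conjE)
  show ?thesis by (rule that[of C]) (use C in \<open>simp_all\<close>)
qed

lemma quotient_tendsto_imp_tendsto:
  fixes f :: "real \<Rightarrow> 'a::real_normed_vector"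
  assumes "((\<lambda>s. (f s - f t) /\<^sub>R (s - t)) \<longlongrightarrow> d) (at t within I)"
  shows "(f \<longlongrightarrow> f t) (at t within I)"
proof -
  have "((\<lambda>s. f t + (s - t) *\<^sub>R ((f s - f t) /\<^sub>R (s - t))) \<longlongrightarrow> f t + (t - t) *\<^sub>R d) (at t within I)"
    by (intro tendsto_intros assms)
  moreover have "\<forall>\<^sub>F s in at t within I. f t + (s - t) *\<^sub>R ((f s - f t) /\<^sub>R (s - t)) = f s"
    unfolding eventually_at_filter by (intro always_eventually) auto
  ultimately have "(f \<longlongrightarrow> f t + (t - t) *\<^sub>R d) (at t within I)"
    by (rule Lim_transform_eventually)
  then show ?thesis by simp
qed

definition mult_H :: "(real \<Rightarrow> real) \<Rightarrow> H \<Rightarrow> H" where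
  "mult_H \<theta> x = (mult_L2 \<theta> (fst x), mult_L2 \<theta> (snd x))"

lemma bounded_linear_mult_H: "bounded_weight \<theta> \<Longrightarrow> bounded_linear (mult_H \<theta>)"
  unfolding mult_H_def[abs_def]
  by (intro bounded_linear_Pair bounded_linear_compose[OF bounded_linear_mult_L2] bounded_linear_fst bounded_linear_snd)

lemma inner_mult_H_commute: "bounded_weight \<theta> \<Longrightarrow> inner (mult_H \<theta> x) y = inner x (mult_H \<theta> y)"
  by (simp add: mult_H_def inner_prod_def inner_mult_L2_commute)

definition deriv_H :: "H \<Rightarrow> H" where
  "deriv_H x = (weak_deriv (fst x), weak_deriv (snd x))"

context network
begin

text \<open>Compare \<open>J F\<close> at 0 and at \<open>a\<close> times a plateau function. On the
  plateau, which has length 1, the composition is constantly \<open>F a\<close>, so its L2 norm is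
  at least \<open>\<bar>F a\<bar>\<close>; the energy norm of the argument is
  \<open>\<bar>a\<bar> * K\<close>, which supplies the factor \<open>\<bar>a\<bar>\<close>.\<close>

lemma nonlinearity_linear_bound:
  assumes J_dom: "J_maps_domain F" and J0: "J F 0 = 0" and H0: "H0L S F"
  shows "\<exists>L\<ge>0. \<forall>a. \<bar>a\<bar> \<le> M \<longrightarrow> \<bar>F a\<bar> \<le> L * \<bar>a\<bar>"
proof -
  obtain C :: "real \<Rightarrow> real \<Rightarrow> real" where
    C_mono: "\<And>p p' q q'. 0 \<le> p \<Longrightarrow> p \<le> p' \<Longrightarrow> 0 \<le> q \<Longrightarrow> q \<le> q' \<Longrightarrow> C p q \<le> C p' q'" and
    C: "\<And>\<phi> \<psi>. \<phi> \<in> dom_gen \<Longrightarrow> \<psi> \<in> dom_gen \<Longrightarrow>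
         energy_norm S (J F \<phi> - J F \<psi>) \<le> C (energy_norm S \<phi>) (energy_norm S \<psi>) * energy_norm S (\<phi> - \<psi>)"
    using H0L_E[OF H0] by blast
  obtain \<eta> where t: "test_function \<eta>" and \<eta>1: "\<forall>x\<in>{2..3}. \<eta> x = 1" using plateau_test_function by blast
  define e where "e = (abs_L2 \<eta>, 0 :: L2)"
  have e_dom: "e \<in> dom_A"
    using test_function_H2[OF t] by (simp add: e_def dom_A_def H2_def H1_zero)
  define K where "K = norm (S e)"
  \<comment> \<open>Energy norms up to \<open>M * K\<close> occur, so monotonicity of
    \<open>C\<close> gives one constant for all \<open>a\<close>. The absolute value is there
    because \<open>C\<close> may be negative.\<close>
  define L where "L = \<bar>C (M * K) 0\<bar> * K"
  have "\<bar>F a\<bar> \<le> L * \<bar>a\<bar>" if a: "\<bar>a\<bar> \<le> M" for a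
  proof -
    define \<phi> where "\<phi> = (a *\<^sub>R e, 0 :: H)"
    have ae: "a *\<^sub>R e \<in> dom_A" by (rule subspace_scale[OF dom_A_subspace e_dom])
    have dom0: "0 \<in> dom_sqrt_A" "0 \<in> dom_A"
      using subspace_0 sqrt_linear(1) dom_A_subspace by auto
    have \<phi>: "\<phi> \<in> dom_gen" "0 \<in> dom_gen" using ae dom0 by (auto simp: \<phi>_def dom_gen_def zero_prod_def)
    have S_ae: "norm (S (a *\<^sub>R e)) = \<bar>a\<bar> * K"
      using sqrt_linear(3)[of e a] e_dom dom_A_subset by (auto simp: K_def)
    have en: "energy_norm S \<phi> = \<bar>a\<bar> * K" "energy_norm S 0 = 0"
    proof -
      show "energy_norm S \<phi> = \<bar>a\<bar> * K"
        by (simp add: \<phi>_def energy_norm_def S_ae) (simp add: K_def abs_mult)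
      show "energy_norm S 0 = 0" by (simp add: energy_norm_def case_prod_beta sqrt_zero)
    qed
    have sq: "square_integrable (F \<circ> rep_L2 (a *\<^sub>R abs_L2 \<eta>))"
      using J_dom \<phi>(1) unfolding J_maps_domain_def by (auto simp: \<phi>_def e_def zero_prod_def dest!: bspec)
    have J\<phi>: "J F \<phi> = (0, (comp_L2 F (a *\<^sub>R abs_L2 \<eta>), comp_L2 F 0))"
      by (simp add: J_def \<phi>_def e_def)
    have AE_F: "AE x in half_line. x \<in> {2..3} \<longrightarrow> (F (rep_L2 (a *\<^sub>R abs_L2 \<eta>) x))\<^sup>2 = (F a)\<^sup>2"
    proof -
      have "AE x in half_line. rep_L2 (abs_L2 (\<lambda>x. a * \<eta> x)) x = a * \<eta> x"
        by (intro rep_abs_L2 square_integrable_scale test_function_square_integrable[OF t])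
      then show ?thesis
        unfolding abs_L2_scaleR[OF test_function_square_integrable(1)[OF t]]
        by eventually_elim (use \<eta>1 in simp)
    qed
    have idem: "indicator {2<..<3} x * indicator {2<..<3} x = (indicator {2<..<3} x :: real)" for x :: real
      by (simp split: split_indicator)
    have "(F a)\<^sup>2 = (LINT x|half_line. indicator {2<..<3} x * (F a)\<^sup>2)"
      by (subst set_integral_half_line[where A="{2<..<3}"]) (auto simp: set_lebesgue_integral_def idem)
    also have "\<dots> \<le> (LINT x|half_line. ((F \<circ> rep_L2 (a *\<^sub>R abs_L2 \<eta>)) x)\<^sup>2)"
    proof (rule integral_mono_AE')
      show "integrable half_line (\<lambda>x. ((F \<circ> rep_L2 (a *\<^sub>R abs_L2 \<eta>)) x)\<^sup>2)"
        by (rule square_integrableD(2)[OF sq])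
      show "AE x in half_line. indicator {2<..<3} x * (F a)\<^sup>2 \<le> ((F \<circ> rep_L2 (a *\<^sub>R abs_L2 \<eta>)) x)\<^sup>2"
        using AE_F by eventually_elim (auto split: split_indicator)
    qed auto
    also have "\<dots> = (norm (comp_L2 F (a *\<^sub>R abs_L2 \<eta>)))\<^sup>2"
      unfolding comp_L2_def by (rule norm_abs_L2_sq[OF sq, symmetric])
    finally have "\<bar>F a\<bar>\<^sup>2 \<le> (norm (comp_L2 F (a *\<^sub>R abs_L2 \<eta>)))\<^sup>2" by simp
    then have "\<bar>F a\<bar> \<le> norm (comp_L2 F (a *\<^sub>R abs_L2 \<eta>))" by (rule power2_le_imp_le) simp
    also have "\<dots> \<le> norm (S 0, (comp_L2 F (a *\<^sub>R abs_L2 \<eta>), comp_L2 F 0))"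
      by (rule order_trans[OF norm_fst_le norm_snd_le])
    also have "\<dots> = energy_norm S (J F \<phi> - J F 0)"
      by (simp add: J\<phi> J0 energy_norm_eq)
    also have "\<dots> \<le> C (energy_norm S \<phi>) (energy_norm S 0) * energy_norm S (\<phi> - 0)"
      by (rule C[OF \<phi>])
    also have "\<dots> = C (\<bar>a\<bar> * K) 0 * (\<bar>a\<bar> * K)" by (simp add: en)
    also have "\<dots> \<le> C (M * K) 0 * (\<bar>a\<bar> * K)"
    proof (rule mult_right_mono)
      have "\<bar>a\<bar> * K \<le> M * K" using a by (intro mult_right_mono) (simp_all add: K_def)
      then show "C (\<bar>a\<bar> * K) 0 \<le> C (M * K) 0" by (intro C_mono) (simp_all add: K_def)
    qed (simp add: K_def)
    also have "\<dots> \<le> \<bar>C (M * K) 0\<bar> * (\<bar>a\<bar> * K)"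
      by (intro mult_right_mono) (auto simp: K_def)
    also have "\<dots> = L * \<bar>a\<bar>" by (simp add: L_def)
    finally show ?thesis .
  qed
  moreover have "L \<ge> 0" by (simp add: L_def K_def)
  ultimately show ?thesis by blast
qed

lemma weighted_A_eq: "weighted_A \<theta> \<theta>' y = mult_H \<theta> (A y) - c\<^sup>2 *\<^sub>R mult_H \<theta>' (deriv_H y)"
  by (simp add: weighted_A_def mult_H_def deriv_H_def)

lemma form_mult_H: "form \<theta> x y = c\<^sup>2 * inner (deriv_H x) (mult_H \<theta> (deriv_H y))
    + a1 * inner (fst x) (mult_L2 \<theta> (fst y)) + a2 * inner (snd x) (mult_L2 \<theta> (snd y))"
  by (simp add: form_def deriv_H_def mult_H_def inner_prod_def algebra_simps)

lemma deriv_H_linear: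
  assumes "x \<in> dom_sqrt_A" "y \<in> dom_sqrt_A"
  shows "deriv_H (x + y) = deriv_H x + deriv_H y" "deriv_H (x - y) = deriv_H x - deriv_H y"
proof -
  have "fst x \<in> H1" "snd x \<in> H1" "fst y \<in> H1" "snd y \<in> H1"
    using assms by (auto simp: dom_sqrt_A_def)
  then show "deriv_H (x + y) = deriv_H x + deriv_H y" "deriv_H (x - y) = deriv_H x - deriv_H y"
    by (simp_all add: deriv_H_def H1_add H1_diff)
qed

text \<open>The difference of two states goes into one slot and their sum into the other. In
  \<open>form_eq\<close> the slot of the sum asks for \<open>dom_A\<close>, where the solution
  lives; the slot of the difference asks only for \<open>dom_sqrt_A\<close>, and after
  \<open>form_eq\<close> it suffices that the difference quotient converges in L2.\<close>

lemma form_diff_square: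
  assumes \<theta>: "bounded_weight \<theta>" and x: "x \<in> dom_sqrt_A" and y: "y \<in> dom_sqrt_A"
  shows "form \<theta> x x - form \<theta> y y = form \<theta> (x - y) (x + y)"
proof -
  note M = bounded_linear.linear[OF bounded_linear_mult_L2[OF \<theta>]] and MH = bounded_linear.linear[OF bounded_linear_mult_H[OF \<theta>]]
  have s: "inner u (mult_L2 \<theta> v) = inner v (mult_L2 \<theta> u)" for u v
    using inner_mult_L2_commute[OF \<theta>, of u v] by (simp add: inner_commute)
  have sH: "inner u (mult_H \<theta> v) = inner v (mult_H \<theta> u)" for u v
    using inner_mult_H_commute[OF \<theta>, of u v] by (simp add: inner_commute)
  show ?thesis
    unfolding form_mult_H deriv_H_linear[OF x y]
    by (simp add: linear_add[OF M] linear_add[OF MH] inner_add_right inner_diff_left algebra_simps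
        s[of "fst y" "fst x"] s[of "snd y" "snd x"] sH[of "deriv_H y" "deriv_H x"])
qed

definition energy :: "(real \<Rightarrow> real) \<Rightarrow> H \<times> H \<Rightarrow> real" where
  "energy \<theta> \<phi> = (inner (snd \<phi>) (mult_H \<theta> (snd \<phi>)) + form \<theta> (fst \<phi>) (fst \<phi>)) / 2"

lemma A_add:
  assumes "x \<in> dom_A" "y \<in> dom_A"
  shows "A (x + y) = A x + A y"
proof -
  have "x \<in> dom_sqrt_A" "S x \<in> dom_sqrt_A" "S (S x) = A x" "y \<in> dom_sqrt_A" "S y \<in> dom_sqrt_A" "S (S y) = A y"
    using root assms unfolding is_positive_sqrt_def by blast+
  moreover have "S (S (x + y)) = A (x + y)"
    using root subspace_add[OF dom_A_subspace assms] unfolding is_positive_sqrt_def by blast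
  ultimately show ?thesis by (simp add: sqrt_linear(2))
qed

end

section \<open>Time regularity of a solution and of its weighted energy\<close>

locale wave_solution = network +
  fixes F :: "real \<Rightarrow> real" and T :: ereal and \<phi>\<^sub>0 :: "H \<times> H" and \<phi> :: "real \<Rightarrow> H \<times> H"
  assumes J_dom: "J_maps_domain F" and J0: "J F 0 = 0" and H0: "H0L S F"
    and sol: "is_solution S c a1 a2 F T \<phi>\<^sub>0 \<phi>"
begin

abbreviation "I \<equiv> time_interval T"

definition u :: "real \<Rightarrow> H" where "u t = fst (\<phi> t)"
definition v :: "real \<Rightarrow> H" where "v t = snd (\<phi> t)"
definition N :: "real \<Rightarrow> H" where "N t = snd (J F (\<phi> t))"
text \<open>By the equation this is the time derivative of \<open>v\<close>.\<close>

definition w :: "real \<Rightarrow> H" where "w t = N t - A (u t)"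

lemma \<phi>_eq: "\<phi> t = (u t, v t)"
  by (simp add: u_def v_def)

lemma solution_dom:
  assumes "t \<in> I"
  shows "u t \<in> dom_A" "u t \<in> dom_sqrt_A" "v t \<in> dom_sqrt_A" "\<phi> t \<in> dom_gen"
proof -
  have "\<phi> \<in> I \<rightarrow> dom_gen" using sol unfolding is_solution_def by blast
  then show *: "\<phi> t \<in> dom_gen" using assms by (rule funcset_mem)
  then show "u t \<in> dom_A" "v t \<in> dom_sqrt_A" by (auto simp: dom_gen_def \<phi>_eq)
  then show "u t \<in> dom_sqrt_A" using dom_A_subset by blast
qed

lemma solution_tendsto:
  assumes t: "t \<in> I"
  shows "((\<lambda>s. norm (S ((u s - u t) /\<^sub>R (s - t) - v t))) \<longlongrightarrow> 0) (at t within I)"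
    "((\<lambda>s. (v s - v t) /\<^sub>R (s - t)) \<longlongrightarrow> w t) (at t within I)"
    "(w \<longlongrightarrow> w t) (at t within I)"
proof -
  obtain \<phi>' where \<phi>': "\<And>t. t \<in> I \<Longrightarrow> ((\<lambda>s. energy_norm S ((\<phi> s - \<phi> t) /\<^sub>R (s - t) - \<phi>' t)) \<longlongrightarrow> 0) (at t within I)"
    "\<And>t. t \<in> I \<Longrightarrow> ((\<lambda>s. energy_norm S (\<phi>' s - \<phi>' t)) \<longlongrightarrow> 0) (at t within I)"
    "\<And>t. t \<in> I \<Longrightarrow> \<phi>' t = gen c a1 a2 (\<phi> t) + J F (\<phi> t)"
    using sol unfolding is_solution_def by blast
  have \<phi>'_eq: "\<phi>' s = (v s, w s)" if "s \<in> I" for s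
  proof -
    have "fst (J F (\<phi> s)) = 0" by (simp add: J_def split: prod.splits)
    then show ?thesis
      using \<phi>'(3)[OF that] by (simp add: prod_eq_iff gen_def \<phi>_eq[of s] w_def N_def)
  qed
  have q: "(\<phi> s - \<phi> t) /\<^sub>R (s - t) - \<phi>' t = ((u s - u t) /\<^sub>R (s - t) - v t, (v s - v t) /\<^sub>R (s - t) - w t)" for s
    by (simp add: \<phi>_eq \<phi>'_eq[OF t])
  have lim: "((\<lambda>s. norm (S ((u s - u t) /\<^sub>R (s - t) - v t), (v s - v t) /\<^sub>R (s - t) - w t)) \<longlongrightarrow> 0) (at t within I)"
    using \<phi>'(1)[OF t] unfolding q energy_norm_eq .
  show "((\<lambda>s. norm (S ((u s - u t) /\<^sub>R (s - t) - v t))) \<longlongrightarrow> 0) (at t within I)"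
    by (rule tendsto_sandwich[OF _ _ tendsto_const lim]) (auto intro!: always_eventually norm_fst_le)
  have "((\<lambda>s. norm ((v s - v t) /\<^sub>R (s - t) - w t)) \<longlongrightarrow> 0) (at t within I)"
    by (rule tendsto_sandwich[OF _ _ tendsto_const lim]) (auto intro!: always_eventually norm_snd_le)
  then show "((\<lambda>s. (v s - v t) /\<^sub>R (s - t)) \<longlongrightarrow> w t) (at t within I)"
    by (simp only: tendsto_norm_zero_iff LIM_zero_iff)
  have "((\<lambda>s. norm (w s - w t)) \<longlongrightarrow> 0) (at t within I)"
  proof (rule tendsto_sandwich[OF _ _ tendsto_const \<phi>'(2)[OF t]])
    show "\<forall>\<^sub>F s in at t within I. norm (w s - w t) \<le> energy_norm S (\<phi>' s - \<phi>' t)"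
      unfolding eventually_at_filter
      by (intro always_eventually allI impI) (simp add: \<phi>'_eq t energy_norm_eq norm_snd_le)
  qed auto
  then show "(w \<longlongrightarrow> w t) (at t within I)"
    by (simp only: tendsto_norm_zero_iff LIM_zero_iff)
qed

text \<open>The velocity \<open>v t\<close> is only known to be in \<open>dom_sqrt_A\<close>, and so
  is its difference from the quotient; here the lower bound \<open>norm_le_sqrt\<close> on the whole
  form domain turns energy convergence into L2 convergence.\<close>

lemma u_quotient_tendsto:
  assumes t: "t \<in> I"
  shows "((\<lambda>s. (u s - u t) /\<^sub>R (s - t)) \<longlongrightarrow> v t) (at t within I)"
    "((\<lambda>s. S (u s)) \<longlongrightarrow> S (u t)) (at t within I)"
proof -
  let ?q = "\<lambda>s. (u s - u t) /\<^sub>R (s - t)"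
  have dom: "u s - u t \<in> dom_sqrt_A" "?q s \<in> dom_sqrt_A" "?q s - v t \<in> dom_sqrt_A" if "s \<in> I" for s
    using solution_dom[OF that] solution_dom[OF t] sqrt_linear(1)
    by (auto intro!: subspace_diff subspace_scale)
  have lim: "((\<lambda>s. norm (S (?q s - v t)) / sqrt a1) \<longlongrightarrow> 0 / sqrt a1) (at t within I)"
    using a1 by (intro tendsto_intros solution_tendsto(1)[OF t]) auto
  have "((\<lambda>s. norm (?q s - v t)) \<longlongrightarrow> 0) (at t within I)"
  proof (rule tendsto_sandwich[OF _ _ tendsto_const])
    show "\<forall>\<^sub>F s in at t within I. norm (?q s - v t) \<le> norm (S (?q s - v t)) / sqrt a1"
      unfolding eventually_at_filter
    proof (intro always_eventually allI impI)
      fix s assume "s \<in> I"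
      from norm_le_sqrt[OF dom(3)[OF this]] a1
      show "norm (?q s - v t) \<le> norm (S (?q s - v t)) / sqrt a1" by (simp add: field_simps)
    qed
  qed (use lim in auto)
  then show "(?q \<longlongrightarrow> v t) (at t within I)"
    by (simp only: tendsto_norm_zero_iff LIM_zero_iff)
  have "((\<lambda>s. S (?q s - v t)) \<longlongrightarrow> 0) (at t within I)"
    using solution_tendsto(1)[OF t] by (simp only: tendsto_norm_zero_iff)
  then have "((\<lambda>s. S (u t) + (s - t) *\<^sub>R (S (?q s - v t) + S (v t))) \<longlongrightarrow> S (u t) + (t - t) *\<^sub>R (0 + S (v t))) (at t within I)"
    by (intro tendsto_intros)
  moreover have "\<forall>\<^sub>F s in at t within I. S (u t) + (s - t) *\<^sub>R (S (?q s - v t) + S (v t)) = S (u s)"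
    unfolding eventually_at_filter
  proof (intro always_eventually allI impI)
    fix s assume s: "s \<noteq> t" "s \<in> I"
    have "S (?q s - v t) + S (v t) = S (?q s)"
      using sqrt_diff[OF dom(2)[OF s(2)] solution_dom(3)[OF t]] by simp
    also have "\<dots> = (S (u s) - S (u t)) /\<^sub>R (s - t)"
      using sqrt_linear(3)[OF dom(1)[OF s(2)]] sqrt_diff[OF solution_dom(2)[OF s(2)] solution_dom(2)[OF t]] by simp
    finally show "S (u t) + (s - t) *\<^sub>R (S (?q s - v t) + S (v t)) = S (u s)" using s by simp
  qed
  ultimately have "((\<lambda>s. S (u s)) \<longlongrightarrow> S (u t) + (t - t) *\<^sub>R (0 + S (v t))) (at t within I)"
    by (rule Lim_transform_eventually)
  then show "((\<lambda>s. S (u s)) \<longlongrightarrow> S (u t)) (at t within I)" by simp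
qed

lemma v_tendsto: "t \<in> I \<Longrightarrow> (v \<longlongrightarrow> v t) (at t within I)"
  by (rule quotient_tendsto_imp_tendsto[OF solution_tendsto(2)])

lemma deriv_u_tendsto:
  assumes t: "t \<in> I"
  shows "((\<lambda>s. deriv_H (u s)) \<longlongrightarrow> deriv_H (u t)) (at t within I)"
proof -
  \<comment> \<open>The 2 counts the half lines: each component of the derivative has norm at most
    \<open>norm (S (u s) - S (u t)) / c\<close>.\<close>
  have "((\<lambda>s. norm (S (u s) - S (u t)) * (2 / c)) \<longlongrightarrow> norm (S (u t) - S (u t)) * (2 / c)) (at t within I)"
    by (intro tendsto_intros u_quotient_tendsto(2)[OF t])
  then have lim: "((\<lambda>s. norm (S (u s) - S (u t)) * (2 / c)) \<longlongrightarrow> 0) (at t within I)" by simp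
  have "((\<lambda>s. norm (deriv_H (u s) - deriv_H (u t))) \<longlongrightarrow> 0) (at t within I)"
  proof (rule tendsto_sandwich[OF _ _ tendsto_const lim])
    show "\<forall>\<^sub>F s in at t within I. norm (deriv_H (u s) - deriv_H (u t)) \<le> norm (S (u s) - S (u t)) * (2 / c)"
      unfolding eventually_at_filter
    proof (intro always_eventually allI impI)
      fix s assume s: "s \<in> I"
      define z where "z = u s - u t"
      have z: "z \<in> dom_A" using subspace_diff[OF dom_A_subspace] solution_dom(1)[OF s] solution_dom(1)[OF t] by (simp add: z_def)
      have Sz: "S z = S (u s) - S (u t)" using sqrt_diff solution_dom(2)[OF s] solution_dom(2)[OF t] by (simp add: z_def)
      have "(c * norm (weak_deriv (fst z)))\<^sup>2 \<le> (norm (S z))\<^sup>2" "(c * norm (weak_deriv (snd z)))\<^sup>2 \<le> (norm (S z))\<^sup>2"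
        using norm_le_sqrt_dom_A(2,3)[OF z] by (simp_all add: power_mult_distrib)
      then have "c * norm (weak_deriv (fst z)) \<le> norm (S z)" "c * norm (weak_deriv (snd z)) \<le> norm (S z)"
        by (auto intro: power2_le_imp_le)
      moreover have "norm (deriv_H z) \<le> norm (weak_deriv (fst z)) + norm (weak_deriv (snd z))"
        unfolding deriv_H_def by (rule norm_Pair_le)
      ultimately have "c * norm (deriv_H z) \<le> 2 * norm (S z)"
        using c by (smt (verit) distrib_left mult_left_mono)
      then show "norm (deriv_H (u s) - deriv_H (u t)) \<le> norm (S (u s) - S (u t)) * (2 / c)"
        using c unfolding Sz[symmetric] deriv_H_linear(2)[OF solution_dom(2)[OF s] solution_dom(2)[OF t], symmetric] z_def[symmetric]
        by (simp add: field_simps)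
    qed
  qed auto
  then show ?thesis by (simp only: tendsto_norm_zero_iff LIM_zero_iff)
qed

lemma N_tendsto:
  assumes t: "t \<in> I"
  shows "(N \<longlongrightarrow> N t) (at t within I)"
proof -
  obtain C :: "real \<Rightarrow> real \<Rightarrow> real" where
    C_mono: "\<And>p p' q q'. 0 \<le> p \<Longrightarrow> p \<le> p' \<Longrightarrow> 0 \<le> q \<Longrightarrow> q \<le> q' \<Longrightarrow> C p q \<le> C p' q'" and
    C: "\<And>\<phi> \<psi>. \<phi> \<in> dom_gen \<Longrightarrow> \<psi> \<in> dom_gen \<Longrightarrow>
         energy_norm S (J F \<phi> - J F \<psi>) \<le> C (energy_norm S \<phi>) (energy_norm S \<psi>) * energy_norm S (\<phi> - \<psi>)"
    using H0L_E[OF H0] by blast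
  define p where "p s = norm (S (u s), v s)" for s
  have pt: "(p \<longlongrightarrow> p t) (at t within I)"
    unfolding p_def by (intro tendsto_intros u_quotient_tendsto(2)[OF t] v_tendsto[OF t])
  \<comment> \<open>Near \<open>t\<close> the energy norm \<open>p s\<close> stays below
    \<open>p t + 1\<close>, so the monotone factor in the Lipschitz condition can be frozen
    there.\<close>
  have "((\<lambda>s. \<bar>C (p t + 1) (p t)\<bar> * norm (S (u s) - S (u t), v s - v t)) \<longlongrightarrow> \<bar>C (p t + 1) (p t)\<bar> * norm (S (u t) - S (u t), v t - v t)) (at t within I)"
    by (intro tendsto_intros u_quotient_tendsto(2)[OF t] v_tendsto[OF t])
  then have lim: "((\<lambda>s. \<bar>C (p t + 1) (p t)\<bar> * norm (S (u s) - S (u t), v s - v t)) \<longlongrightarrow> 0) (at t within I)"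
    by (simp add: norm_Pair)
  have "((\<lambda>s. norm (N s - N t)) \<longlongrightarrow> 0) (at t within I)"
  proof (rule tendsto_sandwich[OF _ _ tendsto_const lim])
    have "\<forall>\<^sub>F s in at t within I. p s < p t + 1"
      using order_tendstoD(2)[OF pt, of "p t + 1"] by simp
    moreover have "\<forall>\<^sub>F s in at t within I. s \<in> I" by (simp add: eventually_at_filter)
    ultimately show "\<forall>\<^sub>F s in at t within I. norm (N s - N t) \<le> \<bar>C (p t + 1) (p t)\<bar> * norm (S (u s) - S (u t), v s - v t)"
    proof eventually_elim
      case (elim s)
      have en: "energy_norm S (\<phi> r) = p r" for r by (simp add: \<phi>_eq[of r] energy_norm_eq p_def)
      have "fst (J F (\<phi> s) - J F (\<phi> t)) = 0" "snd (J F (\<phi> s) - J F (\<phi> t)) = N s - N t"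
        by (auto simp: J_def N_def split: prod.splits)
      then have "J F (\<phi> s) - J F (\<phi> t) = (0, N s - N t)" by (simp add: prod_eq_iff)
      then have "norm (N s - N t) \<le> energy_norm S (J F (\<phi> s) - J F (\<phi> t))"
        by (simp add: energy_norm_eq norm_snd_le)
      also have "\<dots> \<le> C (p s) (p t) * energy_norm S (\<phi> s - \<phi> t)"
        using C[OF solution_dom(4) solution_dom(4)] elim t by (simp add: en)
      also have "energy_norm S (\<phi> s - \<phi> t) = norm (S (u s) - S (u t), v s - v t)"
        using sqrt_diff[OF solution_dom(2) solution_dom(2)] elim t by (simp add: \<phi>_eq[of s] \<phi>_eq[of t] energy_norm_eq)
      also have "C (p s) (p t) * \<dots> \<le> \<bar>C (p t + 1) (p t)\<bar> * \<dots>"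
      proof (rule mult_right_mono)
        have "C (p s) (p t) \<le> C (p t + 1) (p t)" using elim by (intro C_mono) (auto simp: p_def)
        then show "C (p s) (p t) \<le> \<bar>C (p t + 1) (p t)\<bar>" by simp
      qed simp
      finally show ?case .
    qed
  qed auto
  then show ?thesis by (simp only: tendsto_norm_zero_iff LIM_zero_iff)
qed

text \<open>The energy norm of the solution does not control \<open>A\<close>; continuity is read
  off from the equation, \<open>A (u s)\<close> being the difference of the continuous
  \<open>N\<close> and \<open>w\<close>.\<close>

lemma A_u_tendsto:
  assumes t: "t \<in> I"
  shows "((\<lambda>s. A (u s)) \<longlongrightarrow> A (u t)) (at t within I)"
proof -
  have "((\<lambda>s. N s - w s) \<longlongrightarrow> N t - w t) (at t within I)"
    by (intro tendsto_intros N_tendsto[OF t] solution_tendsto(3)[OF t])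
  then show ?thesis by (simp add: w_def)
qed

text \<open>The equation for \<open>v\<close> contributes - <v, \<theta> A u> and the form
  contributes <v, \<theta> A u> - c^2 <v, \<theta>' u'>, so only the nonlinear term and the one with
  \<theta>' remain. Passing to \<open>weighted_A\<close> before the limit keeps boundary terms out
  of it.\<close>

lemma energy_has_derivative:
  assumes \<theta>: "has_density \<theta> \<theta>'" "bounded_weight \<theta>" "bounded_weight \<theta>'" and t: "t \<in> I"
  shows "((\<lambda>s. energy \<theta> (\<phi> s)) has_real_derivative
      (inner (v t) (mult_H \<theta> (N t)) - c\<^sup>2 * inner (v t) (mult_H \<theta>' (deriv_H (u t))))) (at t within I)"
  unfolding has_field_derivative_iff
proof -
  note M = bounded_linear_mult_H[OF \<theta>(2)] and M' = bounded_linear_mult_H[OF \<theta>(3)]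
  note linM = bounded_linear.linear[OF M] and linM' = bounded_linear.linear[OF M']
  define K where "K = weighted_A \<theta> \<theta>'"
  have K_add: "K (x + y) = K x + K y" if "x \<in> dom_A" "y \<in> dom_A" for x y
  proof -
    have "x \<in> dom_sqrt_A" "y \<in> dom_sqrt_A" using that dom_A_subset by blast+
    then show ?thesis
      unfolding K_def weighted_A_eq
      by (simp add: A_add that deriv_H_linear(1) linear_add[OF linM] linear_add[OF linM'] scaleR_add_right)
  qed
  have K_lim: "((\<lambda>s. K (u s)) \<longlongrightarrow> K (u t)) (at t within I)"
    unfolding K_def weighted_A_eq
    by (intro tendsto_intros bounded_linear.tendsto[OF M] bounded_linear.tendsto[OF M'] A_u_tendsto[OF t] deriv_u_tendsto[OF t])
  have alg: "(inverse q * X + inverse q * Y) / 2 = (X + Y) / 2 / q" for q X Y :: real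
    by (simp add: inverse_eq_divide add_divide_distrib mult.commute)
  \<comment> \<open>The difference quotient of the energy, with the differences of squares factored;
    every factor converges in the norm of \<open>H\<close>.\<close>
  let ?D = "\<lambda>s. (inner ((v s - v t) /\<^sub>R (s - t)) (mult_H \<theta> (v s) + mult_H \<theta> (v t)) + inner ((u s - u t) /\<^sub>R (s - t)) (K (u s) + K (u t))) / 2"
  have "(?D \<longlongrightarrow> (inner (w t) (mult_H \<theta> (v t) + mult_H \<theta> (v t)) + inner (v t) (K (u t) + K (u t))) / 2) (at t within I)"
    by (intro tendsto_intros bounded_linear.tendsto[OF M] v_tendsto[OF t] K_lim u_quotient_tendsto(1)[OF t] solution_tendsto(2)[OF t]) auto
  also have "(inner (w t) (mult_H \<theta> (v t) + mult_H \<theta> (v t)) + inner (v t) (K (u t) + K (u t))) / 2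
     = inner (v t) (mult_H \<theta> (N t)) - c\<^sup>2 * inner (v t) (mult_H \<theta>' (deriv_H (u t)))"
  proof -
    have "inner (w t) (mult_H \<theta> (v t)) = inner (v t) (mult_H \<theta> (w t))"
      using inner_mult_H_commute[OF \<theta>(2), of "w t" "v t"] by (simp add: inner_commute)
    also have "\<dots> = inner (v t) (mult_H \<theta> (N t)) - inner (v t) (mult_H \<theta> (A (u t)))"
      by (simp add: w_def linear_diff[OF linM] inner_diff_right)
    finally show ?thesis
      by (simp add: K_def weighted_A_eq inner_add_right inner_diff_right)
  qed
  finally have "(?D \<longlongrightarrow> inner (v t) (mult_H \<theta> (N t)) - c\<^sup>2 * inner (v t) (mult_H \<theta>' (deriv_H (u t)))) (at t within I)" .
  moreover have "\<forall>\<^sub>F s in at t within I. ?D s = (energy \<theta> (\<phi> s) - energy \<theta> (\<phi> t)) / (s - t)"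
    unfolding eventually_at_filter
  proof (intro always_eventually allI impI)
    fix s assume s: "s \<noteq> t" "s \<in> I"
    have us: "u s - u t \<in> dom_sqrt_A" "u s + u t \<in> dom_A"
      using subspace_diff[OF sqrt_linear(1)] subspace_add[OF dom_A_subspace] solution_dom[OF s(2)] solution_dom[OF t] by auto
    have "form \<theta> (u s) (u s) - form \<theta> (u t) (u t) = inner (u s - u t) (K (u s) + K (u t))"
      unfolding form_diff_square[OF \<theta>(2) solution_dom(2)[OF s(2)] solution_dom(2)[OF t]] form_eq[OF \<theta> us] K_def[symmetric]
        K_add[OF solution_dom(1)[OF s(2)] solution_dom(1)[OF t]] ..
    moreover have "inner (v s) (mult_H \<theta> (v s)) - inner (v t) (mult_H \<theta> (v t)) = inner (v s - v t) (mult_H \<theta> (v s) + mult_H \<theta> (v t))"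
      using inner_mult_H_commute[OF \<theta>(2), of "v s" "v t"]
      by (simp add: inner_diff_left inner_add_right inner_commute algebra_simps)
    ultimately have "energy \<theta> (\<phi> s) - energy \<theta> (\<phi> t) =
       (inner (v s - v t) (mult_H \<theta> (v s) + mult_H \<theta> (v t)) + inner (u s - u t) (K (u s) + K (u t))) / 2"
      by (simp add: energy_def \<phi>_eq[of s] \<phi>_eq[of t] diff_divide_distrib[symmetric] add_divide_distrib[symmetric])
    then show "?D s = (energy \<theta> (\<phi> s) - energy \<theta> (\<phi> t)) / (s - t)"
      by (simp only: inner_scaleR_left alg)
  qed
  ultimately show "((\<lambda>s. (energy \<theta> (\<phi> s) - energy \<theta> (\<phi> t)) / (s - t)) \<longlongrightarrow>
      inner (v t) (mult_H \<theta> (N t)) - c\<^sup>2 * inner (v t) (mult_H \<theta>' (deriv_H (u t)))) (at t within I)"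
    by (rule Lim_transform_eventually)
qed

end

section \<open>Finite speed of propagation\<close>

text \<open>The weight has to be small only where \<open>u\<close> lives. This is how its decay away
  from the centre reaches the initial energy.\<close>

lemma inner_mult_L2_abs_bound:
  assumes \<rho>: "bounded_weight \<rho>" and le: "AE x in half_line. rep_L2 u x \<noteq> 0 \<longrightarrow> \<bar>\<rho> x\<bar> \<le> B"
  shows "\<bar>inner u (mult_L2 \<rho> w)\<bar> \<le> B * (LINT x|half_line. \<bar>rep_L2 u x * rep_L2 w x\<bar>)"
proof -
  have "\<bar>inner u (mult_L2 \<rho> w)\<bar> \<le> (LINT x|half_line. \<bar>\<rho> x * (rep_L2 u x * rep_L2 w x)\<bar>)"
    unfolding inner_mult_L2(1)[OF \<rho>] by (rule integral_abs_bound)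
  also have "\<dots> \<le> (LINT x|half_line. B * \<bar>rep_L2 u x * rep_L2 w x\<bar>)"
  proof (rule integral_mono_AE)
    show "integrable half_line (\<lambda>x. \<bar>\<rho> x * (rep_L2 u x * rep_L2 w x)\<bar>)"
      by (intro integrable_abs inner_mult_L2(2)[OF \<rho>])
    show "integrable half_line (\<lambda>x. B * \<bar>rep_L2 u x * rep_L2 w x\<bar>)"
      by (intro integrable_mult_right integrable_abs square_integrable_mult) simp_all
    show "AE x in half_line. \<bar>\<rho> x * (rep_L2 u x * rep_L2 w x)\<bar> \<le> B * \<bar>rep_L2 u x * rep_L2 w x\<bar>"
      using le
    proof eventually_elim
      case (elim x)
      then show ?case by (cases "rep_L2 u x = 0") (auto simp: abs_mult intro!: mult_right_mono)
    qed
  qed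
  also have "\<dots> = B * (LINT x|half_line. \<bar>rep_L2 u x * rep_L2 w x\<bar>)" by simp
  finally show ?thesis .
qed

lemma time_interval_Icc: "t \<in> time_interval T \<Longrightarrow> {0..t} \<subseteq> time_interval T"
  by (auto simp: time_interval_def) (meson ereal_less_eq(3) order_le_less_trans)

context wave_solution
begin

text \<open>Being continuous, \<open>S (u s)\<close> is bounded on the compact
  \<open>{0..t}\<close>. On \<open>dom_A\<close> its norm dominates the H1 norms of both components,
  and these dominate the suprema.\<close>

lemma sup_bound:
  assumes t: "t \<in> I"
  obtains M where "\<And>s. s \<in> {0..t} \<Longrightarrow> AE x in half_line. \<bar>rep_L2 (fst (u s)) x\<bar> \<le> M"
    "\<And>s. s \<in> {0..t} \<Longrightarrow> AE x in half_line. \<bar>rep_L2 (snd (u s)) x\<bar> \<le> M"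
proof -
  have "continuous_on I (\<lambda>s. S (u s))"
    unfolding continuous_on_def using u_quotient_tendsto(2) by blast
  then have "continuous_on {0..t} (\<lambda>s. S (u s))"
    using time_interval_Icc[OF t] by (rule continuous_on_subset)
  then have "bounded ((\<lambda>s. S (u s)) ` {0..t})"
    by (intro compact_imp_bounded compact_continuous_image) auto
  then obtain B where "\<forall>y\<in>(\<lambda>s. S (u s)) ` {0..t}. norm y \<le> B"
    unfolding bounded_iff by blast
  then have B: "norm (S (u s)) \<le> B" if "s \<in> {0..t}" for s using that by blast
  define M where "M = sqrt (1 / a1 + 1 / c\<^sup>2) * B"
  have pos: "0 \<le> 1 / a1 + 1 / c\<^sup>2" using a1 by simp
  have bd: "AE x in half_line. \<bar>rep_L2 y x\<bar> \<le> M"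
    if s: "s \<in> {0..t}" and y: "y \<in> H1" "(norm y)\<^sup>2 \<le> (norm (u s))\<^sup>2" "c\<^sup>2 * (norm (weak_deriv y))\<^sup>2 \<le> (norm (S (u s)))\<^sup>2" for s y
  proof -
    have dom: "u s \<in> dom_A" using solution_dom(1) time_interval_Icc[OF t] s by blast
    have "a1 * (norm y)\<^sup>2 \<le> (norm (S (u s)))\<^sup>2"
      using norm_le_sqrt_dom_A(1)[OF dom] y(2) a1 by (meson mult_left_mono less_imp_le order_trans)
    then have "(norm y)\<^sup>2 \<le> 1 / a1 * (norm (S (u s)))\<^sup>2" using a1 by (simp add: field_simps)
    moreover have "(norm (weak_deriv y))\<^sup>2 \<le> 1 / c\<^sup>2 * (norm (S (u s)))\<^sup>2" using c y(3) by (simp add: field_simps)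
    ultimately have "(norm y)\<^sup>2 + (norm (weak_deriv y))\<^sup>2 \<le> (1 / a1 + 1 / c\<^sup>2) * (norm (S (u s)))\<^sup>2"
      unfolding distrib_right by (rule add_mono)
    also have "\<dots> \<le> (1 / a1 + 1 / c\<^sup>2) * B\<^sup>2"
      using B[OF s] pos by (intro mult_left_mono power_mono) auto
    also have "\<dots> = M\<^sup>2" using pos by (simp add: M_def power_mult_distrib)
    finally have le: "(norm y)\<^sup>2 + (norm (weak_deriv y))\<^sup>2 \<le> M\<^sup>2" .
    have "0 \<le> B" using B[OF s] norm_ge_zero order_trans by blast
    then have M0: "0 \<le> M" using pos by (simp add: M_def)
    show ?thesis
      using H1_sup_bound[OF y(1)]
    proof eventually_elim
      case (elim x)
      then have "\<bar>rep_L2 y x\<bar>\<^sup>2 \<le> M\<^sup>2" using le by simp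
      then show ?case using M0 by (rule power2_le_imp_le)
    qed
  qed
  have "AE x in half_line. \<bar>rep_L2 (fst (u s)) x\<bar> \<le> M" "AE x in half_line. \<bar>rep_L2 (snd (u s)) x\<bar> \<le> M" if s: "s \<in> {0..t}" for s
  proof -
    have dom: "u s \<in> dom_A" using solution_dom(1) time_interval_Icc[OF t] s by blast
    then have "fst (u s) \<in> H1" "snd (u s) \<in> H1" by (auto simp: dom_A_def H2_def)
    moreover have "(norm (fst (u s)))\<^sup>2 \<le> (norm (u s))\<^sup>2" "(norm (snd (u s)))\<^sup>2 \<le> (norm (u s))\<^sup>2"
      by (simp_all add: power2_norm_eq_inner inner_prod_def)
    ultimately show "AE x in half_line. \<bar>rep_L2 (fst (u s)) x\<bar> \<le> M" "AE x in half_line. \<bar>rep_L2 (snd (u s)) x\<bar> \<le> M"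
      using norm_le_sqrt_dom_A(2,3)[OF dom] by (auto intro: bd[OF s])
  qed
  then show ?thesis by (rule that)
qed

lemma nonlinearity_bound:
  assumes t: "t \<in> I"
  obtains L where "L \<ge> 0"
    "\<And>s. s \<in> {0..t} \<Longrightarrow> AE x in half_line. \<bar>rep_L2 (fst (N s)) x\<bar> \<le> L * \<bar>rep_L2 (fst (u s)) x\<bar>"
    "\<And>s. s \<in> {0..t} \<Longrightarrow> AE x in half_line. \<bar>rep_L2 (snd (N s)) x\<bar> \<le> L * \<bar>rep_L2 (snd (u s)) x\<bar>"
proof -
  obtain M where M: "\<And>s. s \<in> {0..t} \<Longrightarrow> AE x in half_line. \<bar>rep_L2 (fst (u s)) x\<bar> \<le> M"
    "\<And>s. s \<in> {0..t} \<Longrightarrow> AE x in half_line. \<bar>rep_L2 (snd (u s)) x\<bar> \<le> M"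
    using sup_bound[OF t] by blast
  obtain L where L: "L \<ge> 0" "\<And>a. \<bar>a\<bar> \<le> M \<Longrightarrow> \<bar>F a\<bar> \<le> L * \<bar>a\<bar>"
    using nonlinearity_linear_bound[OF J_dom J0 H0] by blast
  have "AE x in half_line. \<bar>rep_L2 (fst (N s)) x\<bar> \<le> L * \<bar>rep_L2 (fst (u s)) x\<bar>"
    "AE x in half_line. \<bar>rep_L2 (snd (N s)) x\<bar> \<le> L * \<bar>rep_L2 (snd (u s)) x\<bar>" if s: "s \<in> {0..t}" for s
  proof -
    obtain u1 u2 where u12: "u s = (u1, u2)" by force
    have "s \<in> I" using time_interval_Icc[OF t] s by blast
    from solution_dom(4)[OF this] have "((u1, u2), v s) \<in> dom_gen"
      by (simp add: \<phi>_eq[of s] u12)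
    then have sq: "square_integrable (F \<circ> rep_L2 u1)" "square_integrable (F \<circ> rep_L2 u2)"
      using J_dom unfolding J_maps_domain_def by (auto dest!: bspec)
    have N: "N s = (abs_L2 (F \<circ> rep_L2 u1), abs_L2 (F \<circ> rep_L2 u2))"
      by (simp add: N_def J_def \<phi>_eq u12 comp_L2_def)
    show "AE x in half_line. \<bar>rep_L2 (fst (N s)) x\<bar> \<le> L * \<bar>rep_L2 (fst (u s)) x\<bar>"
      using rep_abs_L2[OF sq(1)] M(1)[OF s] unfolding N u12 fst_conv by eventually_elim (simp add: L)
    show "AE x in half_line. \<bar>rep_L2 (snd (N s)) x\<bar> \<le> L * \<bar>rep_L2 (snd (u s)) x\<bar>"
      using rep_abs_L2[OF sq(2)] M(2)[OF s] unfolding N u12 snd_conv by eventually_elim (simp add: L)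
  qed
  then show ?thesis using L(1) that by blast
qed

text \<open>The term with \<theta>' costs exactly \<open>c * l\<close>, the number that fixes the
  speed: c^2 |v \<theta>' u'| \<le> c l \<theta> (v^2 + c^2 u'^2) / 2. The nonlinear term costs a
  constant free of \<open>l\<close>; in it \<open>1 / a1\<close> appears because \<open>u\<close>
  itself enters the energy with coefficients at least \<open>a1\<close>.\<close>

lemma energy_derivative_le:
  assumes \<theta>: "bounded_weight \<theta>" "bounded_weight \<theta>'" "\<And>x. x > 0 \<Longrightarrow> 0 \<le> \<theta> x" "\<And>x. x > 0 \<Longrightarrow> \<bar>\<theta>' x\<bar> \<le> l * \<theta> x"
    and l: "0 \<le> l" and L: "0 \<le> L"
    "AE x in half_line. \<bar>rep_L2 (fst (N s)) x\<bar> \<le> L * \<bar>rep_L2 (fst (u s)) x\<bar>"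
    "AE x in half_line. \<bar>rep_L2 (snd (N s)) x\<bar> \<le> L * \<bar>rep_L2 (snd (u s)) x\<bar>"
  shows "inner (v s) (mult_H \<theta> (N s)) - c\<^sup>2 * inner (v s) (mult_H \<theta>' (deriv_H (u s))) \<le> (L * (1 + 1 / a1) + c * l) * energy \<theta> (\<phi> s)"
proof -
  define V1 V2 U1 U2 D1 D2 where "V1 = inner (fst (v s)) (mult_L2 \<theta> (fst (v s)))" and "V2 = inner (snd (v s)) (mult_L2 \<theta> (snd (v s)))"
    and "U1 = inner (fst (u s)) (mult_L2 \<theta> (fst (u s)))" and "U2 = inner (snd (u s)) (mult_L2 \<theta> (snd (u s)))"
    and "D1 = inner (weak_deriv (fst (u s))) (mult_L2 \<theta> (weak_deriv (fst (u s))))"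
    and "D2 = inner (weak_deriv (snd (u s))) (mult_L2 \<theta> (weak_deriv (snd (u s))))"
  have nn: "0 \<le> V1" "0 \<le> V2" "0 \<le> U1" "0 \<le> U2" "0 \<le> D1" "0 \<le> D2"
    unfolding V1_def V2_def U1_def U2_def D1_def D2_def by (rule inner_mult_L2_nonneg[OF \<theta>(1,3)], assumption)+
  have E: "2 * energy \<theta> (\<phi> s) = V1 + V2 + c\<^sup>2 * D1 + c\<^sup>2 * D2 + a1 * U1 + a2 * U2"
    by (simp add: energy_def \<phi>_eq form_def mult_H_def inner_prod_def V1_def V2_def U1_def U2_def D1_def D2_def)
  have nl: "\<bar>inner y (mult_L2 \<theta> n)\<bar> \<le> L / 2 * (inner y (mult_L2 \<theta> y) + inner z (mult_L2 \<theta> z))"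
    if n: "AE x in half_line. \<bar>rep_L2 n x\<bar> \<le> L * \<bar>rep_L2 z x\<bar>" for y n z
  proof (rule inner_mult_L2_le[OF \<theta>(1) \<theta>(1) _ \<theta>(3) L(1)])
    show "AE x in half_line. \<bar>\<theta> x\<bar> * \<bar>rep_L2 n x\<bar> \<le> L * \<theta> x * \<bar>rep_L2 z x\<bar>"
      using n AE_space
    proof eventually_elim
      case (elim x)
      then have "0 \<le> \<theta> x" using \<theta>(3)[of x] by simp
      with elim have "\<theta> x * \<bar>rep_L2 n x\<bar> \<le> \<theta> x * (L * \<bar>rep_L2 z x\<bar>)" by (intro mult_left_mono) auto
      with \<open>0 \<le> \<theta> x\<close> show ?case by (simp add: algebra_simps)
    qed
  qed
  have dr: "c\<^sup>2 * \<bar>inner y (mult_L2 \<theta>' d)\<bar> \<le> c * l / 2 * (inner y (mult_L2 \<theta> y) + c\<^sup>2 * inner d (mult_L2 \<theta> d))" for y d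
  proof -
    \<comment> \<open>One factor \<open>c\<close> is attached to the derivative before Young's
      inequality, so that both squares carry the coefficients they have in the energy.\<close>
    have "\<bar>inner y (mult_L2 \<theta>' (c *\<^sub>R d))\<bar> \<le> l / 2 * (inner y (mult_L2 \<theta> y) + inner (c *\<^sub>R d) (mult_L2 \<theta> (c *\<^sub>R d)))"
    proof (rule inner_mult_L2_le[OF \<theta>(1,2) _ \<theta>(3) l])
      show "AE x in half_line. \<bar>\<theta>' x\<bar> * \<bar>rep_L2 (c *\<^sub>R d) x\<bar> \<le> l * \<theta> x * \<bar>rep_L2 (c *\<^sub>R d) x\<bar>"
        using AE_space
      proof eventually_elim
        case (elim x)
        then show ?case using \<theta>(4)[of x] by (intro mult_right_mono) auto
      qed
    qed
    then have "c * (c * \<bar>inner y (mult_L2 \<theta>' d)\<bar>) \<le> c * (l / 2 * (inner y (mult_L2 \<theta> y) + c\<^sup>2 * inner d (mult_L2 \<theta> d)))"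
      using c by (intro mult_left_mono) (auto simp: mult_L2_scaleR \<theta> abs_mult power2_eq_square mult.assoc)
    then show ?thesis by (simp add: power2_eq_square mult.assoc)
  qed
  have "inner (v s) (mult_H \<theta> (N s)) - c\<^sup>2 * inner (v s) (mult_H \<theta>' (deriv_H (u s)))
     \<le> L / 2 * (V1 + U1) + L / 2 * (V2 + U2) + c * l / 2 * (V1 + c\<^sup>2 * D1) + c * l / 2 * (V2 + c\<^sup>2 * D2)"
  proof -
    have abs_c: "- c\<^sup>2 * x \<le> c\<^sup>2 * \<bar>x\<bar>" for x :: real
      using mult_left_mono[of "- x" "\<bar>x\<bar>" "c\<^sup>2"] by simp
    have "inner (v s) (mult_H \<theta> (N s)) - c\<^sup>2 * inner (v s) (mult_H \<theta>' (deriv_H (u s)))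
      = inner (fst (v s)) (mult_L2 \<theta> (fst (N s))) + inner (snd (v s)) (mult_L2 \<theta> (snd (N s)))
        + (- c\<^sup>2 * inner (fst (v s)) (mult_L2 \<theta>' (weak_deriv (fst (u s))))) + (- c\<^sup>2 * inner (snd (v s)) (mult_L2 \<theta>' (weak_deriv (snd (u s)))))"
      by (simp add: mult_H_def deriv_H_def inner_prod_def algebra_simps)
    also have "\<dots> \<le> L / 2 * (V1 + U1) + L / 2 * (V2 + U2) + c * l / 2 * (V1 + c\<^sup>2 * D1) + c * l / 2 * (V2 + c\<^sup>2 * D2)"
      unfolding V1_def V2_def U1_def U2_def D1_def D2_def
      by (intro add_mono order_trans[OF abs_c dr] order_trans[OF abs_ge_self nl] L)
    finally show ?thesis .
  qed
  also have "\<dots> = L * ((V1 + V2) / 2) + L * ((U1 + U2) / 2) + c * l * ((V1 + V2 + c\<^sup>2 * D1 + c\<^sup>2 * D2) / 2)"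
    by (simp add: field_simps)
  also have "\<dots> \<le> L * energy \<theta> (\<phi> s) + L * (1 / a1 * energy \<theta> (\<phi> s)) + c * l * energy \<theta> (\<phi> s)"
  proof (intro add_mono mult_left_mono L(1))
    have nn': "0 \<le> c\<^sup>2 * D1" "0 \<le> c\<^sup>2 * D2" "0 \<le> a1 * U1" "0 \<le> a2 * U2" "a1 * U2 \<le> a2 * U2"
      using nn a1 a2 a12 by (simp_all add: mult_right_mono)
    have e: "X / 2 \<le> energy \<theta> (\<phi> s)" if "X \<le> 2 * energy \<theta> (\<phi> s)" for X using that by simp
    show "(V1 + V2) / 2 \<le> energy \<theta> (\<phi> s)"
      by (rule e) (unfold E, intro add_increasing2 nn' order_refl)
    show "(V1 + V2 + c\<^sup>2 * D1 + c\<^sup>2 * D2) / 2 \<le> energy \<theta> (\<phi> s)"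
      by (rule e) (unfold E, intro add_increasing2 nn' order_refl)
    have "0 + a1 * U1 + a1 * U2 \<le> (V1 + V2 + c\<^sup>2 * D1 + c\<^sup>2 * D2) + a1 * U1 + a2 * U2"
      by (intro add_mono nn' order_refl add_nonneg_nonneg nn)
    then have "a1 * (U1 + U2) \<le> 2 * energy \<theta> (\<phi> s)" unfolding E distrib_left by simp
    then show "(U1 + U2) / 2 \<le> 1 / a1 * energy \<theta> (\<phi> s)" using a1 by (simp add: field_simps)
    show "0 \<le> c * l" using c l by simp
  qed
  finally show ?thesis by (simp add: algebra_simps)
qed

text \<open>Gronwall's inequality. The point is the order of the quantifiers: \<kappa> is chosen
  before the weight and before \<open>l\<close>, so it stays fixed when \<open>l\<close> tends to
  infinity.\<close>

lemma energy_growth: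
  assumes t: "t \<in> I"
  obtains \<kappa> where "\<And>\<theta> \<theta>' l. has_density \<theta> \<theta>' \<Longrightarrow> bounded_weight \<theta> \<Longrightarrow> bounded_weight \<theta>' \<Longrightarrow> (\<And>x. x > 0 \<Longrightarrow> 0 \<le> \<theta> x) \<Longrightarrow>
      (\<And>x. x > 0 \<Longrightarrow> \<bar>\<theta>' x\<bar> \<le> l * \<theta> x) \<Longrightarrow> 0 \<le> l \<Longrightarrow>
      energy \<theta> (\<phi> t) \<le> exp (\<kappa> + c * l * t) * energy \<theta> (\<phi> 0)"
proof -
  obtain L where L: "L \<ge> 0"
    "\<And>s. s \<in> {0..t} \<Longrightarrow> AE x in half_line. \<bar>rep_L2 (fst (N s)) x\<bar> \<le> L * \<bar>rep_L2 (fst (u s)) x\<bar>"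
    "\<And>s. s \<in> {0..t} \<Longrightarrow> AE x in half_line. \<bar>rep_L2 (snd (N s)) x\<bar> \<le> L * \<bar>rep_L2 (snd (u s)) x\<bar>"
    using nonlinearity_bound[OF t] by blast
  have "energy \<theta> (\<phi> t) \<le> exp (L * (1 + 1 / a1) * t + c * l * t) * energy \<theta> (\<phi> 0)"
    if \<theta>: "has_density \<theta> \<theta>'" "bounded_weight \<theta>" "bounded_weight \<theta>'" "\<And>x. x > 0 \<Longrightarrow> 0 \<le> \<theta> x"
      "\<And>x. x > 0 \<Longrightarrow> \<bar>\<theta>' x\<bar> \<le> l * \<theta> x" "0 \<le> l" for \<theta> \<theta>' l
  proof -
    define k where "k = L * (1 + 1 / a1) + c * l"
    define d where "d s = inner (v s) (mult_H \<theta> (N s)) - c\<^sup>2 * inner (v s) (mult_H \<theta>' (deriv_H (u s)))" for s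
    define g where "g s = exp (- k * s) * energy \<theta> (\<phi> s)" for s
    have "0 \<le> t" using t by (simp add: time_interval_def)
    have dg: "(g has_real_derivative (exp (- k * s) * (d s - k * energy \<theta> (\<phi> s)))) (at s within I)" if "s \<in> I" for s
      unfolding g_def
      by (rule derivative_eq_intros energy_has_derivative[OF \<theta>(1-3) that] refl)+ (simp add: d_def algebra_simps)
    have "g t \<le> g 0"
    proof (rule DERIV_nonpos_imp_decreasing_open[OF \<open>0 \<le> t\<close>])
      fix s assume s: "0 < s" "s < t"
      then have sI: "s \<in> I" using time_interval_Icc[OF t] by auto
      have "{0<..<t} \<subseteq> I" using time_interval_Icc[OF t] by auto
      then have "at s within I = at s"
        using s by (intro at_within_interior interiorI[of "{0<..<t}"]) auto
      then have "DERIV g s :> exp (- k * s) * (d s - k * energy \<theta> (\<phi> s))" using dg[OF sI] by simp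
      moreover have "d s \<le> k * energy \<theta> (\<phi> s)"
        unfolding d_def k_def using s by (intro energy_derivative_le \<theta> L) auto
      ultimately show "\<exists>y. DERIV g s :> y \<and> y \<le> 0"
        by (intro exI conjI) (auto simp: mult_nonneg_nonpos)
    next
      have "continuous_on I g"
        unfolding continuous_on_eq_continuous_within using dg DERIV_continuous by blast
      then show "continuous_on {0..t} g" using time_interval_Icc[OF t] by (rule continuous_on_subset)
    qed
    then have "exp (k * t) * g t \<le> exp (k * t) * g 0" by (intro mult_left_mono) auto
    moreover have gt: "exp (k * t) * g t = energy \<theta> (\<phi> t)"
      by (simp add: g_def mult.assoc[symmetric] exp_add[symmetric])
    moreover have g0: "g 0 = energy \<theta> (\<phi> 0)" by (simp add: g_def)
    ultimately have "energy \<theta> (\<phi> t) \<le> exp (k * t) * energy \<theta> (\<phi> 0)" by (simp only: gt g0)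
    then show ?thesis by (simp only: k_def distrib_right)
  qed
  then show ?thesis by (rule that)
qed

lemma energy_lower_bound:
  assumes \<theta>: "bounded_weight \<theta>" "\<And>x. x > 0 \<Longrightarrow> 0 \<le> \<theta> x"
  shows "a1 * inner (fst (u s)) (mult_L2 \<theta> (fst (u s))) \<le> 2 * energy \<theta> (\<phi> s)"
    "a1 * inner (snd (u s)) (mult_L2 \<theta> (snd (u s))) \<le> 2 * energy \<theta> (\<phi> s)"
proof -
  note nn = inner_mult_L2_nonneg[OF \<theta>]
  define V U1 U2 D1 D2 where "V = inner (v s) (mult_H \<theta> (v s))"
    and "U1 = inner (fst (u s)) (mult_L2 \<theta> (fst (u s)))" and "U2 = inner (snd (u s)) (mult_L2 \<theta> (snd (u s)))"
    and "D1 = inner (weak_deriv (fst (u s))) (mult_L2 \<theta> (weak_deriv (fst (u s))))"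
    and "D2 = inner (weak_deriv (snd (u s))) (mult_L2 \<theta> (weak_deriv (snd (u s))))"
  have "0 \<le> V" using nn by (simp add: V_def mult_H_def inner_prod_def)
  have "0 \<le> U1" "0 \<le> U2" "0 \<le> D1" "0 \<le> D2" by (simp_all add: U1_def U2_def D1_def D2_def nn)
  then have nn': "0 \<le> V + c\<^sup>2 * D1 + c\<^sup>2 * D2" "0 \<le> a1 * U1" "0 \<le> a2 * U2" "a1 * U2 \<le> a2 * U2"
    using \<open>0 \<le> V\<close> a1 a2 a12 by (simp_all add: mult_right_mono)
  have E: "2 * energy \<theta> (\<phi> s) = V + c\<^sup>2 * D1 + c\<^sup>2 * D2 + a1 * U1 + a2 * U2"
    by (simp add: energy_def \<phi>_eq form_def V_def U1_def U2_def D1_def D2_def)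
  show "a1 * inner (fst (u s)) (mult_L2 \<theta> (fst (u s))) \<le> 2 * energy \<theta> (\<phi> s)"
    "a1 * inner (snd (u s)) (mult_L2 \<theta> (snd (u s))) \<le> 2 * energy \<theta> (\<phi> s)"
    unfolding U1_def[symmetric] U2_def[symmetric] E
    by (rule add_increasing2[OF nn'(3) add_increasing[OF nn'(1) order_refl]])
      (rule add_increasing[OF add_nonneg_nonneg[OF nn'(1,2)] nn'(4)])
qed

text \<open>With the weights \<open>exp (- l * sqrt (d\<^sup>2 + (x - x0)\<^sup>2))\<close> the initial energy is of order
  \<open>exp (- l * r)\<close>, it grows by a factor \<open>exp (c * l * t)\<close> at most, and the mass in the ball of radius
  \<open>d\<close> is counted with weight at least \<open>exp (- 2 * l * d)\<close>. Let \<open>l\<close> tend to infinity.\<close>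

lemma vanishes_near:
  assumes init: "\<phi>\<^sub>0 = ((f1, 0), 0)" and t: "t \<in> I" and r: "c * t < r"
    and f1: "AE x in half_line. \<bar>x - x0\<bar> < r \<longrightarrow> rep_L2 f1 x = 0"
  obtains d where "d > 0" "AE x in half_line. x \<in> ball x0 d \<longrightarrow> rep_L2 (fst (u t)) x = 0"
    "AE x in half_line. x \<in> ball x0 d \<longrightarrow> rep_L2 (snd (u t)) x = 0"
proof -
  have t0: "0 \<le> t" "0 \<in> I" using t time_interval_Icc[OF t] by (auto simp: time_interval_def)
  have r0: "0 \<le> r" using r c t0(1) by (meson less_imp_le mult_nonneg_nonneg order_trans)
  \<comment> \<open>Decay \<open>l * r\<close> at the data, growth \<open>c * l * t\<close> and the
    loss \<open>2 * d * l\<close> near \<open>x0\<close> leave the exponent - (r - c t - 2 d) l.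
    With a quarter of the gap for \<open>d\<close> this is \<open>- (2 * d * l)\<close>.\<close>
  define d where "d = (r - c * t) / 4"
  have d: "d > 0" "r = c * t + 4 * d" using r by (auto simp: d_def field_simps)
  \<comment> \<open>A smooth substitute for \<open>\<bar>x - x0\<bar>\<close> with slope at most 1:
    nowhere below the distance, and at most \<open>2 * d\<close> on the ball.\<close>
  define h where "h x = sqrt (d\<^sup>2 + (x - x0)\<^sup>2)" for x
  define \<theta> where "\<theta> l x = exp (- (l * h x))" for l x
  define \<theta>' where "\<theta>' l x = - (l * ((x - x0) / h x)) * \<theta> l x" for l x
  have arg_pos: "0 < d\<^sup>2 + (x - x0)\<^sup>2" for x using d(1) by (simp add: add_pos_nonneg)
  have h_pos: "0 < h x" for x unfolding h_def using arg_pos[of x] by simp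
  have h_abs: "\<bar>x - x0\<bar> \<le> h x" for x
    unfolding h_def by (rule real_le_rsqrt) simp
  have h_deriv: "(h has_real_derivative (x - x0) / h x) (at x)" for x
  proof -
    have g: "((\<lambda>x. d\<^sup>2 + (x - x0)\<^sup>2) has_real_derivative 2 * (x - x0)) (at x)"
      by (auto intro!: derivative_eq_intros)
    have "(h has_real_derivative inverse (sqrt (d\<^sup>2 + (x - x0)\<^sup>2)) / 2 * (2 * (x - x0))) (at x)"
      unfolding h_def
      by (rule DERIV_chain2[where f=sqrt and g="\<lambda>x. d\<^sup>2 + (x - x0)\<^sup>2", OF DERIV_real_sqrt g]) (rule arg_pos)
    moreover have "inverse q / 2 * (2 * y) = y / q" for q y :: real by (simp add: inverse_eq_divide)
    ultimately show ?thesis by (simp only: h_def)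
  qed
  have h_cont: "continuous_on A h" for A :: "real set"
    using h_deriv by (meson DERIV_isCont continuous_at_imp_continuous_on)
  have \<theta>_pos: "0 < \<theta> l x" for l x by (simp add: \<theta>_def)
  have \<theta>_le_1: "\<theta> l x \<le> 1" if "0 \<le> l" for l x using that h_pos[of x] by (simp add: \<theta>_def)
  have \<theta>'_le: "\<bar>\<theta>' l x\<bar> \<le> l * \<theta> l x" if "0 \<le> l" for l x
  proof -
    have "\<bar>(x - x0) / h x\<bar> \<le> 1" using h_abs[of x] h_pos[of x] by (simp add: divide_le_eq)
    then have "l * \<bar>(x - x0) / h x\<bar> * \<theta> l x \<le> l * 1 * \<theta> l x"
      using that \<theta>_pos[of l x] by (intro mult_right_mono mult_left_mono) auto
    then show ?thesis using that \<theta>_pos[of l x] by (simp add: \<theta>'_def abs_mult)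
  qed
  have c\<theta>': "continuous_on {0..} (\<theta>' l)" for l
    unfolding \<theta>'_def \<theta>_def by (intro continuous_intros h_cont) (simp add: less_imp_neq[OF h_pos, symmetric])
  have d\<theta>: "has_density (\<theta> l) (\<theta>' l)" for l
  proof (rule has_density_C1)
    show "(\<theta> l has_real_derivative \<theta>' l x) (at x)" for x
      unfolding \<theta>_def \<theta>'_def by (rule derivative_eq_intros h_deriv refl)+ simp
    show "continuous_on {0..} (\<theta>' l)" by (rule c\<theta>')
  qed
  have w\<theta>: "bounded_weight (\<theta> l)" if "0 \<le> l" for l
    using \<theta>_le_1[OF that] \<theta>_pos[of l]
    by (intro bounded_weight_continuous[where B=1] has_density_continuous[OF d\<theta>]) (simp add: abs_of_pos)
  have w\<theta>': "bounded_weight (\<theta>' l)" if "0 \<le> l" for l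
  proof (rule bounded_weight_continuous[where B=l, OF c\<theta>'])
    show "\<bar>\<theta>' l x\<bar> \<le> l" for x
      using \<theta>'_le[OF that, of x] mult_left_mono[OF \<theta>_le_1[OF that, of x] that] by simp
  qed
  obtain \<kappa> where \<kappa>: "\<And>l. 0 \<le> l \<Longrightarrow> energy (\<theta> l) (\<phi> t) \<le> exp (\<kappa> + c * l * t) * energy (\<theta> l) (\<phi> 0)"
  proof (rule energy_growth[OF t])
    fix \<kappa> assume *: "\<And>\<theta> \<theta>' l. has_density \<theta> \<theta>' \<Longrightarrow> bounded_weight \<theta> \<Longrightarrow> bounded_weight \<theta>' \<Longrightarrow> (\<And>x. x > 0 \<Longrightarrow> 0 \<le> \<theta> x) \<Longrightarrow>
      (\<And>x. x > 0 \<Longrightarrow> \<bar>\<theta>' x\<bar> \<le> l * \<theta> x) \<Longrightarrow> 0 \<le> l \<Longrightarrow> energy \<theta> (\<phi> t) \<le> exp (\<kappa> + c * l * t) * energy \<theta> (\<phi> 0)"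
    show ?thesis
      by (rule that[of \<kappa>], rule *[OF d\<theta> w\<theta> w\<theta>']) (auto intro: less_imp_le[OF \<theta>_pos] \<theta>'_le)
  qed
  have \<phi>0: "u 0 = (f1, 0)" "v 0 = 0"
    using sol init by (auto simp: is_solution_def u_def v_def)
  define g1 where "g1 = fst (A (u 0))"
  define D D' where "D = (LINT x|half_line. \<bar>rep_L2 f1 x * rep_L2 g1 x\<bar>)"
    and "D' = (LINT x|half_line. \<bar>rep_L2 f1 x * rep_L2 (weak_deriv f1) x\<bar>)"
  \<comment> \<open>By \<open>form_eq\<close> the initial form is written with an undifferentiated
    factor \<open>f1\<close>, so it is the vanishing of \<open>f1\<close> itself that makes it
    small; derivatives enter only the constants \<open>D\<close> and \<open>D'\<close>. The price is
    a factor linear in \<open>l\<close>.\<close>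
  have init_energy: "2 * energy (\<theta> l) (\<phi> 0) \<le> exp (- (l * r)) * (D + c\<^sup>2 * l * D')" if l: "0 \<le> l" for l
  proof -
    have far: "\<theta> l x \<le> exp (- (l * r))" if "\<not> \<bar>x - x0\<bar> < r" for x
      using that h_abs[of x] l by (auto simp: \<theta>_def intro!: mult_left_mono)
    have "2 * energy (\<theta> l) (\<phi> 0) = form (\<theta> l) (u 0) (u 0)"
      by (simp add: energy_def \<phi>_eq \<phi>0 mult_H_def inner_prod_def)
    also have "\<dots> = inner (u 0) (weighted_A (\<theta> l) (\<theta>' l) (u 0))"
      by (rule form_eq[OF d\<theta> w\<theta>[OF l] w\<theta>'[OF l] solution_dom(2,1)[OF t0(2)]])
    also have "\<dots> = inner f1 (mult_L2 (\<theta> l) g1) - c\<^sup>2 * inner f1 (mult_L2 (\<theta>' l) (weak_deriv f1))"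
      by (simp add: weighted_A_def inner_prod_def \<phi>0 g1_def inner_diff_right)
    also have "\<dots> \<le> \<bar>inner f1 (mult_L2 (\<theta> l) g1)\<bar> + c\<^sup>2 * \<bar>inner f1 (mult_L2 (\<theta>' l) (weak_deriv f1))\<bar>"
    proof -
      have "c\<^sup>2 * (- inner f1 (mult_L2 (\<theta>' l) (weak_deriv f1))) \<le> c\<^sup>2 * \<bar>inner f1 (mult_L2 (\<theta>' l) (weak_deriv f1))\<bar>"
        by (intro mult_left_mono) auto
      then show ?thesis by simp
    qed
    also have "\<dots> \<le> exp (- (l * r)) * D + c\<^sup>2 * ((l * exp (- (l * r))) * D')"
      unfolding D_def D'_def
    proof (intro add_mono mult_left_mono inner_mult_L2_abs_bound w\<theta>[OF l] w\<theta>'[OF l])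
      show "AE x in half_line. rep_L2 f1 x \<noteq> 0 \<longrightarrow> \<bar>\<theta> l x\<bar> \<le> exp (- (l * r))"
        using f1 by eventually_elim (use far \<theta>_pos[of l] in \<open>auto simp: abs_of_pos\<close>)
      show "AE x in half_line. rep_L2 f1 x \<noteq> 0 \<longrightarrow> \<bar>\<theta>' l x\<bar> \<le> l * exp (- (l * r))"
        using f1
      proof eventually_elim
        case (elim x)
        show ?case
        proof
          assume "rep_L2 f1 x \<noteq> 0"
          then have "l * \<theta> l x \<le> l * exp (- (l * r))" using elim l by (intro mult_left_mono far) auto
          then show "\<bar>\<theta>' l x\<bar> \<le> l * exp (- (l * r))" using \<theta>'_le[OF l, of x] by linarith
        qed
      qed
    qed simp
    finally show ?thesis by (simp add: algebra_simps)
  qed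
  have near: "exp (- (2 * d * l)) \<le> \<theta> l x" if "x \<in> ball x0 d" "0 \<le> l" for l x
  proof -
    have "(x - x0)\<^sup>2 \<le> d\<^sup>2"
      using that(1) d(1) by (intro abs_le_square_iff[THEN iffD1]) (auto simp: dist_real_def)
    moreover have "(2 * d)\<^sup>2 = 4 * d\<^sup>2" by (simp add: power_mult_distrib)
    ultimately have "d\<^sup>2 + (x - x0)\<^sup>2 \<le> (2 * d)\<^sup>2" using zero_le_power2[of d] by linarith
    then have "h x \<le> 2 * d" unfolding h_def using d(1) by (intro real_le_lsqrt) auto
    then have "l * h x \<le> l * (2 * d)" using that by (intro mult_left_mono) auto
    then show ?thesis by (simp add: \<theta>_def algebra_simps)
  qed
  have zero: "AE x in half_line. x \<in> ball x0 d \<longrightarrow> rep_L2 y x = 0"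
    if y: "\<And>l. 0 \<le> l \<Longrightarrow> a1 * inner y (mult_L2 (\<theta> l) y) \<le> 2 * energy (\<theta> l) (\<phi> t)" for y
  proof -
    define b where "b = (indicator (ball x0 d) :: real \<Rightarrow> real)"
    have wb: "bounded_weight b"
      unfolding bounded_weight_def b_def
    proof
      show "(indicator (ball x0 d) :: real \<Rightarrow> real) \<in> borel_measurable half_line"
        by (intro measurable_restrict_space1 borel_measurable_indicator) auto
      show "\<exists>B. \<forall>x>0. \<bar>indicator (ball x0 d) x :: real\<bar> \<le> B" by (intro exI[of _ 1]) (auto split: split_indicator)
    qed
    define Q where "Q = inner y (mult_L2 b y)"
    have Q_eq: "Q = (LINT x|half_line. b x * (rep_L2 y x * rep_L2 y x))"
      unfolding Q_def by (rule inner_mult_L2(1)[OF wb])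
    have Q_le: "a1 * Q \<le> exp \<kappa> * ((D + c\<^sup>2 * l * D') * exp (- (2 * d * l)))" if l: "0 \<le> l" for l
    proof -
      have "exp (- (2 * d * l)) * Q = (LINT x|half_line. exp (- (2 * d * l)) * (b x * (rep_L2 y x * rep_L2 y x)))"
        unfolding Q_eq by simp
      also have "\<dots> \<le> (LINT x|half_line. \<theta> l x * (rep_L2 y x * rep_L2 y x))"
      proof (rule integral_mono_AE)
        show "integrable half_line (\<lambda>x. exp (- (2 * d * l)) * (b x * (rep_L2 y x * rep_L2 y x)))"
          by (intro integrable_mult_right inner_mult_L2(2)[OF wb])
        show "integrable half_line (\<lambda>x. \<theta> l x * (rep_L2 y x * rep_L2 y x))"
          by (rule inner_mult_L2(2)[OF w\<theta>[OF l]])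
        show "AE x in half_line. exp (- (2 * d * l)) * (b x * (rep_L2 y x * rep_L2 y x)) \<le> \<theta> l x * (rep_L2 y x * rep_L2 y x)"
        proof (rule AE_I2)
          fix x
          have "exp (- (2 * d * l)) * b x \<le> \<theta> l x"
            using near[OF _ l, of x] \<theta>_pos[of l x] by (auto simp: b_def split: split_indicator)
          then have "exp (- (2 * d * l)) * b x * (rep_L2 y x * rep_L2 y x) \<le> \<theta> l x * (rep_L2 y x * rep_L2 y x)"
            by (intro mult_right_mono) auto
          then show "exp (- (2 * d * l)) * (b x * (rep_L2 y x * rep_L2 y x)) \<le> \<theta> l x * (rep_L2 y x * rep_L2 y x)"
            by (simp add: mult.assoc)
        qed
      qed
      also have "\<dots> = inner y (mult_L2 (\<theta> l) y)" by (rule inner_mult_L2(1)[OF w\<theta>[OF l], symmetric])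
      finally have "a1 * (exp (- (2 * d * l)) * Q) \<le> a1 * inner y (mult_L2 (\<theta> l) y)"
        using a1 by (intro mult_left_mono) auto
      also have "\<dots> \<le> 2 * energy (\<theta> l) (\<phi> t)" by (rule y[OF l])
      also have "\<dots> \<le> exp (\<kappa> + c * l * t) * (2 * energy (\<theta> l) (\<phi> 0))" using \<kappa>[OF l] by simp
      also have "\<dots> \<le> exp (\<kappa> + c * l * t) * (exp (- (l * r)) * (D + c\<^sup>2 * l * D'))"
        by (intro mult_left_mono init_energy[OF l]) auto
      finally have "exp (2 * d * l) * (a1 * (exp (- (2 * d * l)) * Q)) \<le> exp (2 * d * l) * (exp (\<kappa> + c * l * t) * (exp (- (l * r)) * (D + c\<^sup>2 * l * D')))"
        by (intro mult_left_mono) auto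
      moreover have "exp (2 * d * l) * (a1 * (exp (- (2 * d * l)) * Q)) = a1 * Q"
        by (simp add: exp_minus field_simps)
      moreover have "exp (2 * d * l) * (exp (\<kappa> + c * l * t) * (exp (- (l * r)) * X)) = exp \<kappa> * (X * exp (- (2 * d * l)))" for X
      proof -
        have "exp (2 * d * l) * exp (\<kappa> + c * l * t) * exp (- (l * r)) = exp \<kappa> * exp (- (2 * d * l))"
          unfolding exp_add[symmetric] using d(2) by (simp add: algebra_simps)
        then show ?thesis by (simp add: mult.assoc[symmetric])
      qed
      ultimately show ?thesis by simp
    qed
    \<comment> \<open>The linear factor is rewritten as a polynomial in \<open>2 * d * l\<close>, so
      that the decay \<open>poly_times_exp_tendsto_0\<close> behind the bump functions applies
      again.\<close>
    have "((\<lambda>l. exp \<kappa> * (poly [:D, c\<^sup>2 * D' / (2 * d):] (2 * d * l) * exp (- (2 * d * l)))) \<longlongrightarrow> exp \<kappa> * 0) at_top"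
      using d(1) by (intro tendsto_intros filterlim_compose[OF poly_times_exp_tendsto_0] filterlim_tendsto_pos_mult_at_top[OF tendsto_const]) (auto intro: filterlim_ident)
    moreover have "exp \<kappa> * (poly [:D, c\<^sup>2 * D' / (2 * d):] (2 * d * l) * exp (- (2 * d * l))) = exp \<kappa> * ((D + c\<^sup>2 * l * D') * exp (- (2 * d * l)))" for l
      using d(1) by simp
    ultimately have "((\<lambda>l. exp \<kappa> * ((D + c\<^sup>2 * l * D') * exp (- (2 * d * l)))) \<longlongrightarrow> 0) at_top" by simp
    then have "a1 * Q \<le> 0"
      by (rule tendsto_lowerbound) (use Q_le in \<open>auto intro: eventually_mono[OF eventually_ge_at_top[of 0]]\<close>)
    then have "Q \<le> 0" using a1 by (simp add: mult_le_0_iff)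
    moreover have "0 \<le> Q" unfolding Q_def by (rule inner_mult_L2_nonneg[OF wb]) (simp add: b_def)
    ultimately have "(LINT x|half_line. b x * (rep_L2 y x * rep_L2 y x)) = 0" using Q_eq by simp
    then have "AE x in half_line. b x * (rep_L2 y x * rep_L2 y x) = 0"
      by (subst (asm) integral_nonneg_eq_0_iff_AE[OF inner_mult_L2(2)[OF wb]]) (auto simp: b_def)
    then show ?thesis by eventually_elim (auto simp: b_def split: split_indicator_asm)
  qed
  show ?thesis
    using d(1) by (rule that) (intro zero energy_lower_bound w\<theta> less_imp_le[OF \<theta>_pos]; assumption)+
qed

end

text \<open>The complement of the support is a union of possibly uncountably many open sets;
  Lindelof's theorem leaves countably many, whose exceptional null sets may be united.\<close>

lemma AE_zero_off_supp: "AE x in half_line. x \<notin> supp f \<longrightarrow> rep_L2 f x = 0"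
proof -
  let ?U = "{U. open U \<and> (AE x in half_line. x \<in> U \<longrightarrow> rep_L2 f x = 0)}"
  obtain \<F> where \<F>: "\<F> \<subseteq> ?U" "countable \<F>" "\<Union>\<F> = \<Union>?U"
    using Lindelof[of ?U] by blast
  have "AE x in half_line. \<forall>U\<in>\<F>. x \<in> U \<longrightarrow> rep_L2 f x = 0"
    using \<F> by (subst AE_ball_countable) auto
  then show ?thesis
    by eventually_elim (use \<F>(3) in \<open>auto simp: supp_def\<close>)
qed

lemma not_in_suppI: "open U \<Longrightarrow> x \<in> U \<Longrightarrow> AE y in half_line. y \<in> U \<longrightarrow> rep_L2 f y = 0 \<Longrightarrow> x \<notin> supp f"
  unfolding supp_def by blast

theorem theorem7:
  fixes c a1 a2 R :: real
    and S :: "H \<Rightarrow> H"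
    and F :: "real \<Rightarrow> real"
    and f1 f2 :: L2
    and T :: ereal
    and \<phi> :: "real \<Rightarrow> H \<times> H"
    and u1 u2 :: "real \<Rightarrow> L2"
  assumes "0 < c" and "0 < a1" and "0 < a2" and "a1 < a2"
    and "is_positive_sqrt dom_sqrt_A S dom_A (op_A c a1 a2)"
    and "J_maps_domain F" and "J F 0 = 0" and "H0L S F" and "H1L S c a1 a2 F"
    and "(f1, f2) \<in> dom_A" and "f2 = 0"
    and "0 < R" and "compact (supp f1)" and "supp f1 \<subseteq> {0<..<R}"
    and "0 < T"
    and "is_solution S c a1 a2 F T ((f1, f2), 0) \<phi>"
    and "\<And>t. t \<in> time_interval T \<Longrightarrow> fst (\<phi> t) = (u1 t, u2 t)"
  shows "\<forall>t\<in>time_interval T.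
           supp (u1 t) \<subseteq> neighbourhood_upto (supp f1) (c * t) \<and>
           supp (u2 t) \<subseteq> neighbourhood_upto (supp f1) (c * t)"
proof
  fix t assume t: "t \<in> time_interval T"
  interpret wave_solution c a1 a2 S F T "((f1, f2), 0)" \<phi>
    using assms by unfold_locales
  have ut: "fst (u t) = u1 t" "snd (u t) = u2 t"
    using assms(17)[OF t] by (simp_all add: u_def)
  \<comment> \<open>Here \<open>x0\<close> is any real, the node 0 and negative numbers included:
    the weights live on the whole line.\<close>
  have "x0 \<notin> supp (u1 t) \<and> x0 \<notin> supp (u2 t)" if x0: "x0 \<notin> neighbourhood_upto (supp f1) (c * t)" for x0
  proof -
    \<comment> \<open>With empty support the neighbourhood is empty too and every radius above
      \<open>c * t\<close> qualifies; otherwise the radius is the distance of \<open>x0\<close> to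
      the support.\<close>
    obtain r where r: "c * t < r" "\<And>y. y \<in> supp f1 \<Longrightarrow> r \<le> \<bar>y - x0\<bar>"
    proof (cases "supp f1 = {}")
      case True
      then show ?thesis using that[of "c * t + 1"] by simp
    next
      case False
      then have "c * t < infdist x0 (supp f1)" using x0 by (auto simp: neighbourhood_upto_def)
      moreover have "infdist x0 (supp f1) \<le> \<bar>y - x0\<bar>" if "y \<in> supp f1" for y
        using infdist_le[OF that, of x0] by (simp add: dist_real_def abs_minus_commute)
      ultimately show ?thesis using that by blast
    qed
    have "AE x in half_line. \<bar>x - x0\<bar> < r \<longrightarrow> rep_L2 f1 x = 0"
      using AE_zero_off_supp[of f1] by eventually_elim (use r(2) in force)
    then obtain d where "d > 0" "AE x in half_line. x \<in> ball x0 d \<longrightarrow> rep_L2 (fst (u t)) x = 0"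
      "AE x in half_line. x \<in> ball x0 d \<longrightarrow> rep_L2 (snd (u t)) x = 0"
      using vanishes_near[OF _ t r(1)] assms(11) by blast
    then show ?thesis using not_in_suppI[of "ball x0 d" x0] ut by simp
  qed
  then show "supp (u1 t) \<subseteq> neighbourhood_upto (supp f1) (c * t) \<and> supp (u2 t) \<subseteq> neighbourhood_upto (supp f1) (c * t)"
    by blast
qed

end
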